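(* Let $c>0$ and $a,b>-1/2$. For each $N$, let $0\le\lambda_1(t)\le\cdots\le\lambda_N(t)\le1$ be the beta Jacobi process with parameters $a,b$ and $\beta=2c/N$ and given deterministic initial condition, and let $\mu_t^{(N)}=\frac1N\sum_{i=1}^N\delta_{\lambda_i(t)}$. Assume that $\mu_0^{(N)}$ converges weakly to a probability measure $\mu_0$ as $N\to\infty$, and let $(\mu_t)_{t\ge0}$ be the limiting probability measure-valued process of $(\mu_t^{(N)})$. Let $\xi$ be a random variable with distribution $\nu_0=\mathcal M_c(\mu_0)$, and let $Y_t$ be a ($[0,1]$-valued) process satisfying $$dY_t=\sqrt{2Y_t(1-Y_t)}\,db_t+(a+c+1)\,dt-(a+b+2c+2)Y_t\,dt,\qquad Y_0=\xi,$$ where $b_t$ is a standard Brownian motion independent of $\xi$. Then for every $t\ge0$ the distribution of $Y_t$ is the Markov--Krein transform of $\mu_t$ with parameter $c$, i.e. $\mathcal L(Y_t)=\mathcal M_c(\mu_t)$.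
   Context: Beta Jacobi process with parameters $a,b>-1/2$, $\beta>0$: the continuous ordered process $0\le\lambda_1(t)\le\cdots\le\lambda_N(t)\le1$ solving (strong solution, integral form) $$d\lambda_i=\sqrt{2\lambda_i(1-\lambda_i)}\,db_i+\left(a+1-(a+b+2)\lambda_i+\frac\beta2\sum_{j\ne i}\frac{2\lambda_i(1-\lambda_i)}{\lambda_i-\lambda_j}\right)dt,\quad i=1,\dots,N,$$ with $b_1,\dots,b_N$ independent standard Brownian motions. Limiting process (known from earlier work): if $\mu_0^{(N)}\to\mu_0$ weakly, then for each $T>0$ the process $(\mu_t^{(N)})_{0\le t\le T}$ converges in probability, as random elements of the space of continuous maps from $[0,T]$ to the probability measures on $[0,1]$ with the uniform topology, to a deterministic process $(\mu_t)_{0\le t\le T}$. Here $\mu_t$ is the unique probability measure on $[0,1]$ whose moments $m_n(t)$ solve $m_0\equiv1$ and, for $n\ge1$, $$m_n'(t)=-n(2c+a+b+n+1)m_n(t)+n(a+n)m_{n-1}(t)+cn\sum_{i=0}^{n-1}m_i(t)m_{n-1-i}(t)-cn\sum_{j=1}^{n-1}m_j(t)m_{n-j}(t),$$ with $m_n(0)=\int x^n\,d\mu_0(x)$. Markov--Krein transform: for a probability measure $\mu$ on $\mathbb R$ with $\int\log(1+|u|)\,d\mu(u)<\infty$, $\mathcal M_c(\mu)$ is the unique probability measure $\nu$ on $\mathbb R$ such that $\int_{\mathbb R}(z-t)^{-c}\,d\nu(t)=\exp\left(-c\int_{\mathbb R}\log(z-u)\,d\mu(u)\right)$ for all $z\in\mathbb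 C\setminus\mathbb R$ (principal branches of $\log$ and of powers). When $\mu$ is supported in $[0,1]$, so is $\mathcal M_c(\mu)$. $\mathcal L(X)$ denotes the law of $X$. *)

theory Defs
  imports "HOL-Probability.Probability"
begin

section \<open>Brownian motions and the Ito integral\<close>

definition filtered_prob_space :: "'w measure \<Rightarrow> (real \<Rightarrow> 'w measure) \<Rightarrow> bool" where
  "filtered_prob_space M F \<longleftrightarrow>
     prob_space M \<and> filtration (space M) F \<and> (\<forall>t. subalgebra M (F t))"

definition adapted_continuous ::
    "'w measure \<Rightarrow> (real \<Rightarrow> 'w measure) \<Rightarrow> (real \<Rightarrow> 'w \<Rightarrow> real) \<Rightarrow> bool" where
  "adapted_continuous M F X \<longleftrightarrow>
     (\<forall>t\<ge>0. X t \<in> borel_measurable (F t)) \<and>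
     (\<forall>\<omega>\<in>space M. continuous_on {0..} (\<lambda>t. X t \<omega>))"

text \<open>Independent standard Brownian motions \<open>(B i)\<^sub>i\<close>, \<open>i \<in> I\<close>, relative to the filtration \<open>F\<close>. In the
  independence clause the index \<open>None\<close> stands for the past \<open>F s\<close>: the past and the increments of
  all the components over \<open>[s, t]\<close> are jointly independent.\<close>

definition brownian_motions ::
    "'w measure \<Rightarrow> (real \<Rightarrow> 'w measure) \<Rightarrow> 'i set \<Rightarrow> ('i \<Rightarrow> real \<Rightarrow> 'w \<Rightarrow> real) \<Rightarrow> bool" where
  "brownian_motions M F I B \<longleftrightarrow>
     (\<forall>i\<in>I. adapted_continuous M F (B i) \<and> (AE \<omega> in M. B i 0 \<omega> = 0)) \<and>
     (\<forall>s t. 0 \<le> s \<and> s < t \<longrightarrow>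
        (\<forall>i\<in>I. distributed M lborel (\<lambda>\<omega>. B i t \<omega> - B i s \<omega>) (normal_density 0 (sqrt (t - s)))) \<and>
        prob_space.indep_sets M
          (\<lambda>k. case k of
                 None \<Rightarrow> sets (F s)
               | Some i \<Rightarrow> {(\<lambda>\<omega>. B i t \<omega> - B i s \<omega>) -` A \<inter> space M | A. A \<in> sets borel})
          (insert None (Some ` I)))"

definition brownian_motion ::
    "'w measure \<Rightarrow> (real \<Rightarrow> 'w measure) \<Rightarrow> (real \<Rightarrow> 'w \<Rightarrow> real) \<Rightarrow> bool" where
  "brownian_motion M F B \<longleftrightarrow> brownian_motions M F {()} (\<lambda>_. B)"

definition indep_of_process :: "'w measure \<Rightarrow> ('w \<Rightarrow> real) \<Rightarrow> (real \<Rightarrow> 'w \<Rightarrow> real) \<Rightarrow> bool" where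
  "indep_of_process M \<xi> B \<longleftrightarrow>
     prob_space.indep_set M
       {\<xi> -` A \<inter> space M | A. A \<in> sets borel}
       {(\<lambda>\<omega>. \<lambda>t\<in>{0..}. B t \<omega>) -` A \<inter> space M | A. A \<in> sets (Pi\<^sub>M {0..} (\<lambda>_. borel))}"

text \<open>Simple processes \<open>\<Sum>k<n. \<eta> k * 1_(\<tau> k, \<tau> (k+1)]\<close> with deterministic times and bounded,
  \<open>F (\<tau> k)\<close>-measurable \<open>\<eta> k\<close>.\<close>

definition simple_data ::
    "'w measure \<Rightarrow> (real \<Rightarrow> 'w measure) \<Rightarrow> nat \<Rightarrow> (nat \<Rightarrow> real) \<Rightarrow> (nat \<Rightarrow> 'w \<Rightarrow> real) \<Rightarrow> bool" where
  "simple_data M F n \<tau> \<eta> \<longleftrightarrow>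
     0 \<le> \<tau> 0 \<and>
     (\<forall>k<n. \<tau> k \<le> \<tau> (Suc k) \<and> \<eta> k \<in> borel_measurable (F (\<tau> k)) \<and>
            (\<exists>C. \<forall>\<omega>\<in>space M. \<bar>\<eta> k \<omega>\<bar> \<le> C))"

definition simple_process ::
    "nat \<Rightarrow> (nat \<Rightarrow> real) \<Rightarrow> (nat \<Rightarrow> 'w \<Rightarrow> real) \<Rightarrow> real \<Rightarrow> 'w \<Rightarrow> real" where
  "simple_process n \<tau> \<eta> s \<omega> = (\<Sum>k<n. \<eta> k \<omega> * indicator {\<tau> k<..\<tau> (Suc k)} s)"

definition simple_integral ::
    "nat \<Rightarrow> (nat \<Rightarrow> real) \<Rightarrow> (nat \<Rightarrow> 'w \<Rightarrow> real) \<Rightarrow> (real \<Rightarrow> 'w \<Rightarrow> real) \<Rightarrow> real \<Rightarrow> 'w \<Rightarrow> real" where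
  "simple_integral n \<tau> \<eta> B t \<omega> =
     (\<Sum>k<n. \<eta> k \<omega> * (B (min (\<tau> (Suc k)) t) \<omega> - B (min (\<tau> k) t) \<omega>))"

text \<open>\<open>J\<close> is (a version of) the Ito integral of \<open>H\<close> against \<open>B\<close> over \<open>[0, t]\<close>: the mean-square limit of
  the integrals of simple processes which converge to \<open>H\<close> in \<open>L\<^sup>2([0, t] \<times> M)\<close>. Since simple processes
  are bounded, this forces \<open>H\<close> itself to be square integrable.\<close>

definition has_ito_integral ::
    "'w measure \<Rightarrow> (real \<Rightarrow> 'w measure) \<Rightarrow> (real \<Rightarrow> 'w \<Rightarrow> real) \<Rightarrow> (real \<Rightarrow> 'w \<Rightarrow> real) \<Rightarrow> real
      \<Rightarrow> ('w \<Rightarrow> real) \<Rightarrow> bool" where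
  "has_ito_integral M F B H t J \<longleftrightarrow>
     (\<forall>s\<in>{0..t}. H s \<in> borel_measurable (F s)) \<and>
     (\<lambda>(s, \<omega>). H s \<omega>) \<in> borel_measurable (restrict_space lborel {0..t} \<Otimes>\<^sub>M M) \<and>
     J \<in> borel_measurable M \<and>
     (\<exists>n \<tau> \<eta>.
        (\<forall>j::nat. simple_data M F (n j) (\<tau> j) (\<eta> j)) \<and>
        (\<lambda>j. \<integral>\<^sup>+ \<omega>. (\<integral>\<^sup>+ s\<in>{0..t}. ennreal ((H s \<omega> - simple_process (n j) (\<tau> j) (\<eta> j) s \<omega>)\<^sup>2) \<partial>lborel) \<partial>M)
          \<longlonglongrightarrow> 0 \<and>
        (\<lambda>j. \<integral>\<^sup>+ \<omega>. ennreal ((J \<omega> - simple_integral (n j) (\<tau> j) (\<eta> j) B t \<omega>)\<^sup>2) \<partial>M)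
          \<longlonglongrightarrow> 0)"

text \<open>\<open>dX = H dB + G dt\<close> on \<open>[0, \<infinity>)\<close>, in integral form, for a continuous adapted \<open>X\<close>.\<close>

definition has_stochastic_differential ::
    "'w measure \<Rightarrow> (real \<Rightarrow> 'w measure) \<Rightarrow> (real \<Rightarrow> 'w \<Rightarrow> real) \<Rightarrow> (real \<Rightarrow> 'w \<Rightarrow> real)
      \<Rightarrow> (real \<Rightarrow> 'w \<Rightarrow> real) \<Rightarrow> (real \<Rightarrow> 'w \<Rightarrow> real) \<Rightarrow> bool" where
  "has_stochastic_differential M F B X H G \<longleftrightarrow>
     adapted_continuous M F X \<and>
     (\<forall>t\<ge>0. (AE \<omega> in M. set_integrable lborel {0..t} (\<lambda>s. G s \<omega>)) \<and>
        has_ito_integral M F B H t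
          (\<lambda>\<omega>. X t \<omega> - X 0 \<omega> - set_lebesgue_integral lborel {0..t} (\<lambda>s. G s \<omega>)))"

section \<open>The beta Jacobi process\<close>

definition beta_jacobi_drift ::
    "nat \<Rightarrow> real \<Rightarrow> real \<Rightarrow> real \<Rightarrow> (nat \<Rightarrow> real) \<Rightarrow> nat \<Rightarrow> real" where
  "beta_jacobi_drift N a b \<beta> x i =
     a + 1 - (a + b + 2) * x i
     + \<beta> / 2 * (\<Sum>j\<in>{1..N} - {i}. 2 * x i * (1 - x i) / (x i - x j))"

text \<open>The third clause says that the singular drift is meaningful: almost surely, collisions only
  happen on a Lebesgue null set of times (recall that \<open>x / 0 = 0\<close> here).\<close>

definition beta_jacobi_process ::
    "'w measure \<Rightarrow> (real \<Rightarrow> 'w measure) \<Rightarrow> nat \<Rightarrow> real \<Rightarrow> real \<Rightarrow> real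
      \<Rightarrow> (nat \<Rightarrow> real \<Rightarrow> 'w \<Rightarrow> real) \<Rightarrow> (nat \<Rightarrow> real \<Rightarrow> 'w \<Rightarrow> real) \<Rightarrow> bool" where
  "beta_jacobi_process M F N a b \<beta> B \<Lambda> \<longleftrightarrow>
     brownian_motions M F {1..N} B \<and>
     (\<forall>t\<ge>0. \<forall>\<omega>\<in>space M.
        (\<forall>i\<in>{1..N}. \<Lambda> i t \<omega> \<in> {0..1}) \<and>
        (\<forall>i\<in>{1..N}. \<forall>j\<in>{1..N}. i \<le> j \<longrightarrow> \<Lambda> i t \<omega> \<le> \<Lambda> j t \<omega>)) \<and>
     (\<forall>i\<in>{1..N}. \<forall>j\<in>{1..N}. i \<noteq> j \<longrightarrow>
        (AE \<omega> in M. AE t in lborel. t \<ge> 0 \<longrightarrow> \<Lambda> i t \<omega> \<noteq> \<Lambda> j t \<omega>)) \<and>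
     (\<forall>i\<in>{1..N}. has_stochastic_differential M F (B i) (\<Lambda> i)
        (\<lambda>t \<omega>. sqrt (2 * \<Lambda> i t \<omega> * (1 - \<Lambda> i t \<omega>)))
        (\<lambda>t \<omega>. beta_jacobi_drift N a b \<beta> (\<lambda>j. \<Lambda> j t \<omega>) i))"

definition empirical_measure :: "nat \<Rightarrow> (nat \<Rightarrow> real) \<Rightarrow> real measure" where
  "empirical_measure N x = distr (uniform_count_measure {1..N}) borel x"

section \<open>Measure-valued paths and their uniform convergence in probability\<close>

definition prob_measure_on_unit :: "real measure \<Rightarrow> bool" where
  "prob_measure_on_unit \<mu> \<longleftrightarrow> prob_space \<mu> \<and> sets \<mu> = sets borel \<and> measure \<mu> {0..1} = 1"

definition continuous_measure_path :: "(real \<Rightarrow> real measure) \<Rightarrow> bool" where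
  "continuous_measure_path \<mu> \<longleftrightarrow>
     (\<forall>t\<ge>0. prob_measure_on_unit (\<mu> t)) \<and>
     (\<forall>f::real \<Rightarrow> real. continuous_on UNIV f \<and> bounded (range f) \<longrightarrow>
        continuous_on {0..} (\<lambda>t. integral\<^sup>L (\<mu> t) f))"

text \<open>The bounded Lipschitz (Fortet-Mourier) metric, which induces the weak topology. The probability
  measures on \<open>[0, 1]\<close> being weakly compact, the uniform topology on measure-valued paths does
  not depend on which such metric is used.\<close>

definition bl_dist :: "real measure \<Rightarrow> real measure \<Rightarrow> real" where
  "bl_dist \<mu> \<nu> =
     (SUP f\<in>{f :: real \<Rightarrow> real. 1-lipschitz_on UNIV f \<and> (\<forall>x. \<bar>f x\<bar> \<le> 1)}.
        \<bar>integral\<^sup>L \<mu> f - integral\<^sup>L \<nu> f\<bar>)"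

text \<open>The random paths \<open>m N\<close> may live on different probability spaces \<open>P N\<close>; the limit is
  deterministic. The set below is an event for continuous paths, so that its outer measure is just
  its probability.\<close>

definition uniform_limit_in_probability ::
    "(nat \<Rightarrow> 'w measure) \<Rightarrow> (nat \<Rightarrow> real \<Rightarrow> 'w \<Rightarrow> real measure) \<Rightarrow> (real \<Rightarrow> real measure) \<Rightarrow> bool" where
  "uniform_limit_in_probability P m \<mu> \<longleftrightarrow>
     (\<forall>T>0. \<forall>\<epsilon>>0.
        (\<lambda>N. outer_measure_of (P N) {\<omega> \<in> space (P N). \<exists>t\<in>{0..T}. bl_dist (m N t \<omega>) (\<mu> t) > \<epsilon>})
          \<longlonglongrightarrow> 0)"

section \<open>The Markov--Krein transform\<close>

text \<open>\<open>\<nu>\<close> is the Markov--Krein transform of \<open>\<mu>\<close> with parameter \<open>c\<close>; \<open>powr\<close> and \<open>Ln\<close> are the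
  principal branches.\<close>

definition is_markov_krein_transform :: "real \<Rightarrow> real measure \<Rightarrow> real measure \<Rightarrow> bool" where
  "is_markov_krein_transform c \<mu> \<nu> \<longleftrightarrow>
     prob_space \<mu> \<and> sets \<mu> = sets borel \<and> integrable \<mu> (\<lambda>u. ln (1 + \<bar>u\<bar>)) \<and>
     prob_space \<nu> \<and> sets \<nu> = sets borel \<and>
     (\<forall>z::complex. z \<notin> \<real> \<longrightarrow>
        (LINT t|\<nu>. (z - complex_of_real t) powr (- complex_of_real c)) =
        exp (- complex_of_real c * (LINT u|\<mu>. Ln (z - complex_of_real u))))"

end

(* Both sides are determined by moments. Expanding in powers of w = 1/z, nu = M_c(mu) says that
   (c)_n/n! * (n-th moment of nu) is the n-th coefficient of exp(c * sum_k m_k w^k / k), m_k being the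
   moments of mu. Ito's formula in expectation for x^n gives a triangular linear system of ordinary
   differential equations for the moments of Y_t; for the particle system, after symmetrizing the
   repulsion and letting N tend to infinity (products of empirical moments decouple because the limit
   is deterministic), it gives the quadratic system for the m_n(t). Under the exponential substitution
   the quadratic system becomes exactly the linear one: if Phi = exp(c * sum_k m_k w^k / k) and
   K = sum_k m_k w^k, then w Phi' = c K Phi, so the terms quadratic in K are absorbed by the second
   derivative of Phi. Hence the relation between the moments propagates from time 0 to time t. *)

theory Submission
  imports Defs
begin

section \<open>The moment recursion behind the Markov--Krein transform\<close>

unbundle no vec_syntax and fps_syntax

text \<open>The obstacles lie in the analysis rather than in the algebra. The Ito integral is
  available only as a mean-square limit, separately at each time, so Ito's formula is derived in
  expectation only (Dynkin's formula), from Taylor sums along grids whose martingale terms have mean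
  zero. The repulsion is singular, and its integral over time has no evident deterministic bound;
  the equation itself, whose stochastic part is square integrable, supplies a random square
  integrable bound, and Dynkin's formula is proved for drifts with such a bound. For the particle
  system it is enough that the error in the integrated moment equation has mean zero: this error is
  bounded and converges in probability to a constant, which must then vanish, so that no variance
  estimate enters. Finally, the series in \<open>1 / z\<close> settles the transform only for large
  \<open>z\<close>; expansions about other centres reach every non-real \<open>z\<close>, and a
  differential equation in the centre carries the relation between moments from the centre 0 to all
  centres.\<close>

text \<open>The coefficients of \<open>exp (c * (\<Sum>k\<ge>1. m k * w ^ k / k))\<close>, read off its logarithmic derivative.\<close>

fun mk_coeff :: "'a::field_char_0 \<Rightarrow> (nat \<Rightarrow> 'a) \<Rightarrow> nat \<Rightarrow> 'a" where
  "mk_coeff c m 0 = 1"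
| "mk_coeff c m (Suc n) = c / of_nat (Suc n) * (\<Sum>k\<le>n. m (Suc k) * mk_coeff c m (n - k))"

lemma fps_deriv_mk_coeff:
  "fps_deriv (Abs_fps (mk_coeff c m)) =
     fps_const c * Abs_fps (\<lambda>n. m (Suc n)) * Abs_fps (mk_coeff c m)"
proof (rule fps_ext)
  fix n
  have "(fps_const c * Abs_fps (\<lambda>n. m (Suc n)) * Abs_fps (mk_coeff c m)) $ n =
      c * (\<Sum>k\<le>n. m (Suc k) * mk_coeff c m (n - k))"
    by (simp only: mult.assoc fps_mult_left_const_nth) (simp add: fps_mult_nth atMost_atLeast0)
  moreover have "of_nat (Suc n) \<noteq> (0::'a)" by (simp del: of_nat_Suc)
  ultimately show "fps_deriv (Abs_fps (mk_coeff c m)) $ n =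
      (fps_const c * Abs_fps (\<lambda>n. m (Suc n)) * Abs_fps (mk_coeff c m)) $ n"
    by (simp add: del: of_nat_Suc)
qed

text \<open>Coefficient \<open>k\<close> of the equation expresses \<open>E $ Suc k\<close> through
  coefficients of index at most \<open>k\<close>, and characteristic 0 allows division by
  \<open>Suc k\<close>. This is uniqueness for a linear first-order equation.\<close>

lemma fps_linear_ode_zero:
  fixes E :: "'a::field_char_0 fps"
  assumes "fps_deriv E = G * E" "E $ 0 = 0"
  shows "E = 0"
proof (rule fps_ext)
  fix n show "E $ n = 0 $ n"
  proof (induction n rule: less_induct)
    case (less n)
    show ?case
    proof (cases n)
      case 0 then show ?thesis using assms by simp
    next
      case (Suc k)
      have "of_nat (Suc k) * E $ Suc k = (G * E) $ k"
        using arg_cong[OF assms(1), of "\<lambda>F. F $ k"] by simp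
      also have "\<dots> = 0"
        using less Suc by (auto simp: fps_mult_nth intro!: sum.neutral)
      finally show ?thesis using Suc by (simp del: of_nat_Suc)
    qed
  qed
qed

lemma mk_coeff_unique:
  assumes "fps_deriv H = fps_const c * Abs_fps (\<lambda>n. m (Suc n)) * H" "H $ 0 = 1"
  shows "H $ n = mk_coeff c m n"
proof -
  have "H - Abs_fps (mk_coeff c m) = 0"
    by (rule fps_linear_ode_zero[where G = "fps_const c * Abs_fps (\<lambda>n. m (Suc n))"])
       (simp_all add: fps_deriv_mk_coeff assms algebra_simps)
  then show ?thesis by (metis eq_iff_diff_eq_0 fps_nth_Abs_fps)
qed

text \<open>This is the chain rule for \<open>exp (c * L)\<close> along a parameter. The coefficient
  of index \<open>Suc n\<close> of the exponent \<open>L\<close> is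
  \<open>m (Suc n) / Suc n\<close>, and \<open>l\<close> is the parameter derivative of
  \<open>L\<close>; hence \<open>l\<close> has no constant term. The argument stays on the level of
  coefficients: the recursion of \<open>mk_coeff\<close>, once differentiated, is the recursion read
  off from \<open>T'\<close>.\<close>

lemma mk_coeff_has_field_derivative:
  fixes c :: "'a::real_normed_field" and l :: "'a fps"
  assumes d: "\<And>n. ((\<lambda>s. m s (Suc n)) has_field_derivative of_nat (Suc n) * l $ Suc n) (at s within S)"
    and l0: "l $ 0 = 0"
  shows "((\<lambda>s. mk_coeff c (m s) n) has_field_derivative
           (fps_const c * l * Abs_fps (mk_coeff c (m s))) $ n) (at s within S)"
proof -
  define H where "H = Abs_fps (mk_coeff c (m s))"
  define K where "K = Abs_fps (\<lambda>n. m s (Suc n))"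
  define T where "T = fps_const c * l * H"
  have H': "fps_deriv H = fps_const c * K * H"
    unfolding H_def K_def by (rule fps_deriv_mk_coeff)
  have T': "fps_deriv T = fps_const c * (fps_deriv l * H + K * T)"
    unfolding T_def by (simp add: H' algebra_simps)
  have "((\<lambda>s. mk_coeff c (m s) n) has_field_derivative T $ n) (at s within S)"
  proof (induction n rule: less_induct)
    case (less n)
    show ?case
    proof (cases n)
      case 0
      have "T $ 0 = 0" by (simp add: T_def l0)
      then show ?thesis using 0 by simp
    next
      case (Suc k)
      have n0: "of_nat (Suc k) \<noteq> (0::'a)" by (metis of_nat_eq_0_iff nat.distinct(1))
      have "((\<lambda>s. c / of_nat (Suc k) * (\<Sum>i\<le>k. m s (Suc i) * mk_coeff c (m s) (k - i))) has_field_derivative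
          c / of_nat (Suc k) * (\<Sum>i\<le>k. (of_nat (Suc i) * l $ Suc i) * mk_coeff c (m s) (k - i) + T $ (k - i) * m s (Suc i))) (at s within S)"
        using Suc by (intro DERIV_cmult DERIV_sum DERIV_mult d less) auto
      moreover have "c * (\<Sum>i\<le>k. (of_nat (Suc i) * l $ Suc i) * mk_coeff c (m s) (k - i) + T $ (k - i) * m s (Suc i))
           = fps_deriv T $ k"
        unfolding T' fps_mult_left_const_nth fps_add_nth
        unfolding fps_mult_nth
        by (simp add: H_def K_def sum.distrib atMost_atLeast0 algebra_simps)
      ultimately show ?thesis using Suc n0
        by (simp del: of_nat_Suc)
    qed
  qed
  then show ?thesis by (simp add: T_def H_def)
qed

text \<open>The hypothesis is the way in which moments about \<open>p\<close> vary with the centre.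
  The exponent then has parameter derivative \<open>- w * M\<close>, where
  \<open>M = 1 + w * K\<close> is the full moment series, and \<open>c * K * H = H'\<close> turns
  \<open>c * w * M * H\<close> into \<open>c * w * H + w ^ 2 * H'\<close>. The resulting factor
  \<open>c + n\<close> is the one that \<open>pochhammer c n / fact n\<close> produces on the other
  side of the transform.\<close>

lemma mk_coeff_translate:
  fixes c :: "'a::real_normed_field"
  assumes "\<And>n. ((\<lambda>p. m p (Suc n)) has_field_derivative - of_nat (Suc n) * m p n) (at p within S)"
    and m0: "m p 0 = 1"
  shows "((\<lambda>p. mk_coeff c (m p) (Suc n)) has_field_derivative
           - (c + of_nat n) * mk_coeff c (m p) n) (at p within S)"
proof -
  define H where "H = Abs_fps (mk_coeff c (m p))"
  define K where "K = Abs_fps (\<lambda>n. m p (Suc n))"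
  have H': "fps_deriv H = fps_const c * K * H"
    unfolding H_def K_def by (rule fps_deriv_mk_coeff)
  define l where "l = - (fps_X * (1 + fps_X * K))"
  have l: "l $ Suc n = - m p n" for n
    by (cases n) (auto simp: l_def K_def m0)
  have "((\<lambda>p. mk_coeff c (m p) (Suc n)) has_field_derivative (fps_const c * l * H) $ Suc n) (at p within S)"
    unfolding H_def
  proof (rule mk_coeff_has_field_derivative)
    show "((\<lambda>p. m p (Suc n)) has_field_derivative of_nat (Suc n) * l $ Suc n) (at p within S)" for n
      unfolding l using assms(1)[of n] by (simp only: mult_minus_left mult_minus_right)
  qed (simp add: l_def)
  also have "fps_const c * l * H = - (fps_X * (fps_const c * H + fps_X * fps_deriv H))"
    unfolding H' l_def by (simp add: algebra_simps)
  also have "\<dots> $ Suc n = - (c + of_nat n) * mk_coeff c (m p) n"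
    by (cases n) (simp_all add: H_def algebra_simps del: mk_coeff.simps)
  finally show ?thesis .
qed

text \<open>The right-hand side of the equation for \<open>m\<^sub>n\<^sub>+\<^sub>1\<close>; the shift avoids truncated subtraction.\<close>

definition moment_rhs :: "real \<Rightarrow> real \<Rightarrow> real \<Rightarrow> nat \<Rightarrow> (nat \<Rightarrow> real) \<Rightarrow> real" where
  "moment_rhs a b c n m =
     - real (Suc n) * (2 * c + a + b + real n + 2) * m (Suc n)
     + real (Suc n) * (a + real n + 1) * m n
     + c * real (Suc n) * (\<Sum>i\<le>n. m i * m (n - i))
     - c * real (Suc n) * (\<Sum>i<n. m (Suc i) * m (n - i))"

text \<open>In \<open>c * l * H\<close> the part quadratic in \<open>K\<close> is
  \<open>c ^ 2 * (w ^ 3 - w ^ 2) * K ^ 2 * H\<close>. Since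
  \<open>H'' = c * K' * H + c ^ 2 * K ^ 2 * H\<close>, this is exactly the quadratic part of
  \<open>(w ^ 3 - w ^ 2) * H''\<close>; the remaining terms match too, so \<open>H\<close> evolves
  linearly.\<close>

lemma mk_coeff_moment_flow:
  fixes a b c :: real
  assumes m: "\<And>n. ((\<lambda>t. m t (Suc n)) has_real_derivative moment_rhs a b c n (m t)) (at t within S)"
    and m0: "m t 0 = 1"
  shows "((\<lambda>t. mk_coeff c (m t) (Suc n)) has_real_derivative
           (c + real n) * (a + c + real n + 1) * mk_coeff c (m t) n
           - real (Suc n) * (a + b + 2 * c + real n + 2) * mk_coeff c (m t) (Suc n)) (at t within S)"
proof -
  define H where "H = Abs_fps (mk_coeff c (m t))"
  define K where "K = Abs_fps (\<lambda>n. m t (Suc n))"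
  define A where "A = fps_const a"
  define B where "B = fps_const b"
  define C where "C = fps_const c"
  define M where "M = 1 + fps_X * K"
  have H': "fps_deriv H = C * K * H"
    unfolding H_def K_def C_def by (rule fps_deriv_mk_coeff)
  have H'': "fps_deriv (fps_deriv H) = C * fps_deriv K * H + C * K * (C * K * H)"
    by (simp add: H' C_def algebra_simps)
  have M: "M $ n = m t n" for n
    by (cases n) (auto simp: M_def K_def m0)
  \<comment> \<open>The coefficient of index \<open>Suc n\<close> is \<open>moment_rhs\<close>
    divided by \<open>Suc n\<close>: the operator \<open>w * d/dw\<close> supplies the factors
    linear in \<open>n\<close>, and the two convolutions become \<open>M * M\<close> and
    \<open>K * K\<close>.\<close>
  define l where "l = - ((2 * C + A + B + 1) * (fps_X * K)) - fps_X * fps_deriv (fps_X * K)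
     + (A + 1) * (fps_X * M) + fps_X * (fps_X * fps_deriv M) + C * (fps_X * (M * M))
     - C * (fps_X * (fps_X * (K * K)))"
  have l_eq: "l = - (fps_const (2 * c + a + b + 1) * (fps_X * K)) - fps_X * fps_deriv (fps_X * K)
     + fps_const (a + 1) * (fps_X * M) + fps_X * (fps_X * fps_deriv M) + fps_const c * (fps_X * (M * M))
     - fps_const c * (fps_X * (fps_X * (K * K)))"
    unfolding l_def A_def B_def C_def
    by (simp add: fps_const_add [symmetric] numeral_fps_const fps_const_mult [symmetric] del: fps_const_add fps_const_mult)
  have KK: "(fps_X * (K * K)) $ n = (\<Sum>i<n. m t (Suc i) * m t (n - i))" for n
  proof (cases n)
    case (Suc k)
    have "(\<Sum>i\<le>k. m t (Suc i) * m t (Suc (k - i))) = (\<Sum>i\<le>k. m t (Suc i) * m t (Suc k - i))"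
      by (intro sum.cong refl) (auto simp: Suc_diff_le)
    moreover have "(fps_X * (K * K)) $ Suc k = (K * K) $ k" by simp
    ultimately show ?thesis unfolding Suc
      by (simp only: fps_mult_nth) (simp add: K_def atLeast0AtMost lessThan_Suc_atMost del: sum.atMost_Suc sum.lessThan_Suc)
  qed simp
  have X: "(fps_X * fps_deriv F) $ k = real k * F $ k" for F :: "real fps" and k
    by (cases k) simp_all
  have XK: "(fps_X * K) $ Suc k = m t (Suc k)" for k
    by (simp add: K_def)
  have XF: "(fps_X * F) $ Suc k = F $ k" for F :: "real fps" and k
    by simp
  have l: "real (Suc n) * l $ Suc n = moment_rhs a b c n (m t)" for n
  proof -
    have e: "l $ Suc n = - (2 * c + a + b + 1) * m t (Suc n) - real (Suc n) * m t (Suc n) + (a + 1) * m t n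
       + real n * m t n + c * (\<Sum>i\<le>n. m t i * m t (n - i)) - c * (\<Sum>i<n. m t (Suc i) * m t (n - i))"
      unfolding l_eq fps_add_nth fps_sub_nth fps_neg_nth fps_mult_left_const_nth X XK
      by (simp only: XF X KK M)
         (simp add: fps_mult_nth M atLeast0AtMost KK algebra_simps)
    show ?thesis unfolding moment_rhs_def e by (simp add: algebra_simps)
  qed
  have "((\<lambda>t. mk_coeff c (m t) (Suc n)) has_field_derivative (C * l * H) $ Suc n) (at t within S)"
    unfolding H_def C_def
    by (rule mk_coeff_has_field_derivative) (use assms in \<open>simp_all add: l del: of_nat_Suc, simp add: l_def\<close>)
  \<comment> \<open>Written through the operator \<open>w * d/dw\<close>, which multiplies
    coefficient \<open>k\<close> by \<open>k\<close>, the right-hand side can be read off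
    coefficient by coefficient.\<close>
  also have "C * l * H = 
      fps_X * (C * (A + C + 1) * H + (A + 2 * C + 1) * (fps_X * fps_deriv H)
         + fps_X * fps_deriv (fps_X * fps_deriv H))
      - (A + B + 2 * C + 1) * (fps_X * fps_deriv H) - fps_X * fps_deriv (fps_X * fps_deriv H)"
    unfolding fps_deriv_mult[of fps_X] H'' fps_deriv_fps_X
    unfolding H' l_def M_def
    by (simp add: algebra_simps)
  also have "\<dots> = 
      fps_X * (fps_const (c * (a + c + 1)) * H + fps_const (a + 2 * c + 1) * (fps_X * fps_deriv H)
         + fps_X * fps_deriv (fps_X * fps_deriv H))
      - fps_const (a + b + 2 * c + 1) * (fps_X * fps_deriv H) - fps_X * fps_deriv (fps_X * fps_deriv H)"
    unfolding A_def B_def C_def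
    by (simp add: fps_const_add [symmetric] numeral_fps_const fps_const_mult [symmetric] del: fps_const_add fps_const_mult)
  also have "\<dots> $ Suc n = (c + real n) * (a + c + real n + 1) * mk_coeff c (m t) n
           - real (Suc n) * (a + b + 2 * c + real n + 2) * mk_coeff c (m t) (Suc n)"
  proof -
    show ?thesis
      by (simp only: XF fps_sub_nth fps_add_nth fps_mult_left_const_nth X)
         (simp add: H_def algebra_simps del: mk_coeff.simps)
  qed
  finally show ?thesis .
qed

section \<open>Power series of the transform\<close>

text \<open>Principal logarithms of factors add up to that of the product only modulo
  \<open>2 * pi * \<i>\<close>. The sign condition puts \<open>z - p\<close> into the same open
  half-plane as \<open>z\<close>, hence as \<open>z - t\<close>, while
  \<open>1 - (t - p) / (z - p)\<close> lies in the right half-plane; these ranges of the arguments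
  leave no room for a correction.\<close>

lemma Ln_shift:
  fixes z p :: complex and t :: real
  assumes z: "Im z \<noteq> 0" "Im z * Im p \<le> 0" and w: "cmod (of_real t - p) < cmod (z - p)"
  shows "Ln (z - of_real t) = Ln (z - p) + Ln (1 - (of_real t - p) / (z - p))"
proof -
  define q where "q = z - p"
  define r where "r = 1 - (of_real t - p) / (z - p)"
  have q0: "q \<noteq> 0" using w by (auto simp: q_def)
  have qr: "z - of_real t = q * r" using q0 by (simp add: q_def r_def field_simps)
  have "cmod ((of_real t - p) / (z - p)) < 1"
    using w q0 by (simp add: norm_divide q_def)
  then have "Re ((of_real t - p) / (z - p)) < 1"
    using complex_Re_le_cmod[of "(of_real t - p) / (z - p)"] by linarith
  then have r: "0 < Re r" by (simp add: r_def)
  then have r0: "r \<noteq> 0" by auto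
  have Lr: "\<bar>Im (Ln r)\<bar> < pi / 2" using r by (rule Re_Ln_pos_lt_imp)
  have zt0: "z - of_real t \<noteq> 0" using q0 r0 by (simp add: qr)
  note L = Ln_times[OF q0 r0, folded qr]
  consider "Im z > 0" | "Im z < 0" using z by linarith
  then have "Ln (z - of_real t) = Ln q + Ln r"
  proof cases
    case 1
    then have "Im p \<le> 0" using z(2) by (simp add: mult_le_0_iff)
    then have "Im q > 0" using 1 by (simp add: q_def)
    then have Lq: "0 < Im (Ln q)" "Im (Ln q) < pi" using Im_Ln_pos_lt[OF q0] by auto
    have "0 < Im (Ln (z - of_real t))" using Im_Ln_pos_lt[OF zt0] 1 by auto
    then show ?thesis using L Lq Lr by (auto split: if_splits)
  next
    case 2
    then have "Im p \<ge> 0" using z(2) by (simp add: mult_le_0_iff)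
    then have "Im q < 0" using 2 by (simp add: q_def)
    then have Lq: "Im (Ln q) < 0" "-pi < Im (Ln q)"
      using Im_Ln_pos_le[OF q0] mpi_less_Im_Ln[OF q0] Im_Ln_le_pi[OF q0] by auto
    have "Im (Ln (z - of_real t)) < 0" 
      using Im_Ln_pos_le[OF zt0] 2 mpi_less_Im_Ln[OF zt0] Im_Ln_le_pi[OF zt0] by auto
    then show ?thesis using L Lq Lr by (auto split: if_splits)
  qed
  then show ?thesis by (simp add: q_def r_def)
qed

text \<open>The numerical series at \<open>\<rho>\<close> dominates both pointwise and in mean, so
  sum and integral may be exchanged.\<close>

lemma integral_power_series:
  fixes \<alpha> :: "nat \<Rightarrow> complex" and g F :: "real \<Rightarrow> complex"
  assumes M: "prob_space M" "sets M = sets borel" and AE: "AE t in M. t \<in> {0..1}"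
    and [measurable]: "g \<in> borel_measurable borel" "F \<in> borel_measurable borel"
    and g: "\<And>t. t \<in> {0..1} \<Longrightarrow> cmod (g t) \<le> \<rho>"
    and s: "summable (\<lambda>n. cmod (\<alpha> n) * \<rho> ^ n)"
    and F: "\<And>t. t \<in> {0..1} \<Longrightarrow> (\<lambda>n. \<alpha> n * g t ^ n) sums F t"
  shows "(\<lambda>n. \<alpha> n * (LINT t|M. g t ^ n)) sums (LINT t|M. F t)"
proof -
  interpret prob_space M by fact
  note [measurable_cong] = M(2)
  have b: "AE t in M. cmod (\<alpha> n * g t ^ n) \<le> cmod (\<alpha> n) * \<rho> ^ n" for n
    using AE by eventually_elim (auto simp: norm_mult norm_power intro!: mult_left_mono power_mono g)
  have i: "integrable M (\<lambda>t. \<alpha> n * g t ^ n)" for n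
    using b[of n] by (intro integrable_const_bound) auto
  have "(\<lambda>n. LINT t|M. \<alpha> n * g t ^ n) sums (LINT t|M. (\<Sum>n. \<alpha> n * g t ^ n))"
  proof (rule sums_integral[OF i])
    show "AE x in M. summable (\<lambda>i. norm (\<alpha> i * g x ^ i))"
      using AE
    proof eventually_elim
      fix x :: real assume "x \<in> {0..1}"
      then show "summable (\<lambda>i. norm (\<alpha> i * g x ^ i))"
        by (intro summable_comparison_test'[OF s])
           (auto simp: norm_mult norm_power intro!: mult_left_mono power_mono g)
    qed
    have "(LINT x|M. norm (\<alpha> i * g x ^ i)) \<le> cmod (\<alpha> i) * \<rho> ^ i" for i
    proof -
      have "(LINT x|M. norm (\<alpha> i * g x ^ i)) \<le> (LINT x|M. cmod (\<alpha> i) * \<rho> ^ i)"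
        by (intro integral_mono_AE integrable_norm i b) auto
      then show ?thesis by (simp add: prob_space)
    qed
    then show "summable (\<lambda>i. LINT x|M. norm (\<alpha> i * g x ^ i))"
      by (intro summable_comparison_test'[OF s, of 0]) (simp del: norm_mult)
  qed
  also have "(\<lambda>n. LINT t|M. \<alpha> n * g t ^ n) = (\<lambda>n. \<alpha> n * (LINT t|M. g t ^ n))"
    by simp
  also have "(LINT t|M. (\<Sum>n. \<alpha> n * g t ^ n)) = (LINT t|M. F t)"
  proof (rule integral_cong_AE)
    show "AE t in M. (\<Sum>n. \<alpha> n * g t ^ n) = F t"
      using AE by eventually_elim (rule sums_unique[OF F, symmetric])
  qed auto
  finally show ?thesis .
qed

lemma integrable_centered_power:
  assumes "prob_space M" "sets M = sets borel" "AE t in M. t \<in> {0..1::real}"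
  shows "integrable M (\<lambda>t. (of_real t - p :: complex) ^ n)"
proof -
  interpret prob_space M by fact
  note [measurable_cong] = assms(2)
  show ?thesis
  proof (rule integrable_const_bound[where B = "(1 + cmod p) ^ n"])
    show "AE t in M. cmod ((of_real t - p) ^ n) \<le> (1 + cmod p) ^ n"
      using assms(3) by eventually_elim
        (auto simp: norm_power intro!: power_mono norm_triangle_le_diff)
  qed auto
qed

lemma cmod_centered_moment_le:
  assumes M: "prob_space M" "sets M = sets borel" and AE: "AE t in M. t \<in> {0..1::real}"
    and g: "\<And>t. t \<in> {0..1} \<Longrightarrow> cmod (of_real t - p) \<le> \<rho>"
  shows "cmod (LINT t|M. (of_real t - p) ^ n) \<le> \<rho> ^ n"
proof -
  interpret prob_space M by fact
  note [measurable_cong] = M(2)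
  have "cmod (LINT t|M. (of_real t - p) ^ n) \<le> (LINT t|M. cmod ((of_real t - p) ^ n))"
    by (rule integral_norm_bound)
  also have "\<dots> \<le> (LINT t|M. \<rho> ^ n)"
  proof (rule integral_mono_AE)
    show "integrable M (\<lambda>x. cmod ((complex_of_real x - p) ^ n))"
      using M AE by (intro integrable_norm integrable_centered_power)
    show "AE x in M. cmod ((complex_of_real x - p) ^ n) \<le> \<rho> ^ n"
      using AE by eventually_elim (auto simp: norm_power intro!: power_mono g)
  qed auto
  finally show ?thesis by (simp add: prob_space)
qed

abbreviation centered_moment :: "real measure \<Rightarrow> complex \<Rightarrow> nat \<Rightarrow> complex" where
  "centered_moment M p n \<equiv> (LINT t|M. (complex_of_real t - p) ^ n)"

lemma summable_binomial_coeff: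
  fixes c :: complex and r :: real
  assumes "0 \<le> r" "r < 1"
  shows "summable (\<lambda>n. cmod (pochhammer c n / fact n) * r ^ n)"
proof -
  \<comment> \<open>The midpoint of \<open>r\<close> and 1 is still inside the disc of convergence
    of the binomial series; convergence there yields absolute convergence at
    \<open>r\<close>.\<close>
  have "summable (\<lambda>n. (- c gchoose n) * of_real ((1 + r) / 2) ^ n)"
    using assms by (intro sums_summable[OF gen_binomial_complex]) (simp only: norm_of_real, simp)
  then have "summable (\<lambda>n. norm ((- c gchoose n) * of_real r ^ n))"
    by (rule powser_insidea) (use assms in \<open>simp only: norm_of_real, simp\<close>)
  moreover have "norm ((- c gchoose n) * of_real r ^ n) = cmod (pochhammer c n / fact n) * r ^ n" for n
    using assms by (simp add: gbinomial_pochhammer norm_mult norm_power norm_divide)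
  ultimately show ?thesis by simp
qed

lemma summable_log_coeff:
  fixes r :: real
  assumes "0 \<le> r" "r < 1"
  shows "summable (\<lambda>n. cmod (1 / of_nat n) * r ^ n)"
proof (rule summable_comparison_test')
  show "summable (\<lambda>n. r ^ n)" using assms by (simp add: summable_geometric)
  show "norm (cmod (1 / of_nat n) * r ^ n) \<le> r ^ n" for n
  proof -
    have "cmod (1 / of_nat n) \<le> 1" by (cases n) (simp_all add: norm_divide del: of_nat_Suc)
    then show ?thesis using assms mult_right_mono[of "cmod (1 / of_nat n)" 1 "r ^ n"] by (simp del: norm_divide)
  qed
qed

text \<open>Moments about \<open>p\<close> of order \<open>n\<close> are at most
  \<open>\<rho> ^ n\<close>, so attaching them to coefficients whose series converges absolutely
  inside the unit disc leaves a radius of at least \<open>1 / \<rho>\<close>.\<close>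

lemma fps_conv_radius_centered:
  assumes M: "prob_space M" "sets M = sets borel" and AE: "AE t in M. t \<in> {0..1::real}"
    and g: "\<And>t. t \<in> {0..1} \<Longrightarrow> cmod (of_real t - p) \<le> \<rho>" and \<rho>: "0 < \<rho>"
    and s: "\<And>r. 0 \<le> r \<Longrightarrow> r < 1 \<Longrightarrow> summable (\<lambda>n. cmod (\<alpha> n) * r ^ n)"
  shows "fps_conv_radius (Abs_fps (\<lambda>n. \<alpha> n * centered_moment M p n)) \<ge> ereal (1 / \<rho>)"
  unfolding fps_conv_radius_def
proof (rule conv_radius_geI_ex')
  fix r assume r: "0 < r" "ereal r < ereal (1 / \<rho>)"
  then have "r * \<rho> < 1" using \<rho> by (simp add: field_simps)
  then have "summable (\<lambda>n. cmod (\<alpha> n) * (r * \<rho>) ^ n)" using r \<rho> by (intro s) auto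
  then show "summable (\<lambda>n. Abs_fps (\<lambda>n. \<alpha> n * centered_moment M p n) $ n * complex_of_real r ^ n)"
  proof (rule summable_comparison_test'[of _ 0])
    fix n
    have "cmod (\<alpha> n) * cmod (centered_moment M p n) * r ^ n \<le> cmod (\<alpha> n) * \<rho> ^ n * r ^ n"
      using r by (intro mult_right_mono mult_left_mono cmod_centered_moment_le[OF M AE g]) auto
    then show "norm (Abs_fps (\<lambda>n. \<alpha> n * centered_moment M p n) $ n * complex_of_real r ^ n) \<le> cmod (\<alpha> n) * (r * \<rho>) ^ n"
      using r by (simp add: norm_mult norm_power power_mult_distrib mult_ac)
  qed
qed

text \<open>After \<open>(z - p) powr (- c)\<close> is factored out, the rest is the binomial series
  in \<open>(t - p) / (z - p)\<close>, whose modulus is at most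
  \<open>\<rho> / cmod (z - p) < 1\<close>. The factorization respects principal branches by
  \<open>Ln_shift\<close>.\<close>

lemma powr_transform_series:
  fixes z p :: complex and c \<rho> :: real
  assumes M: "prob_space M" "sets M = sets borel" and AE: "AE t in M. t \<in> {0..1::real}"
    and z: "Im z \<noteq> 0" "Im z * Im p \<le> 0"
    and g: "\<And>t. t \<in> {0..1} \<Longrightarrow> cmod (of_real t - p) \<le> \<rho>" and \<rho>: "0 < \<rho>" "\<rho> < cmod (z - p)"
  shows "(LINT t|M. (z - of_real t) powr (- of_real c)) = (z - p) powr (- of_real c) *
     eval_fps (Abs_fps (\<lambda>n. pochhammer (of_real c) n / fact n * centered_moment M p n)) (1 / (z - p))"
proof -
  define \<alpha> where "\<alpha> n = pochhammer (complex_of_real c) n / fact n * (1 / (z - p)) ^ n" for n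
  have q0: "z - p \<noteq> 0" using \<rho> by auto
  have cont: "continuous_on UNIV (\<lambda>t. Ln (z - complex_of_real t))"
    using z by (intro continuous_intros) (auto simp: complex_nonpos_Reals_iff)
  define F where "F t = exp (- of_real c * (Ln (z - complex_of_real t) - Ln (z - p)))" for t
  have F: "(z - of_real t) powr (- of_real c) = (z - p) powr (- of_real c) * F t" for t
  proof -
    have "z - of_real t \<noteq> 0" using z by auto
    then show ?thesis using q0 by (simp add: F_def powr_def exp_add [symmetric] algebra_simps)
  qed
  have "(\<lambda>n. \<alpha> n * centered_moment M p n) sums (LINT t|M. F t)"
  proof (rule integral_power_series[OF M AE])
    show "F \<in> borel_measurable borel"
      unfolding F_def by (intro borel_measurable_continuous_onI continuous_intros cont)
    show "(\<lambda>x. complex_of_real x - p) \<in> borel_measurable borel" by simp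
    show "cmod (complex_of_real t - p) \<le> \<rho>" if "t \<in> {0..1}" for t using g[OF that] .
    have "summable (\<lambda>n. cmod (pochhammer (complex_of_real c) n / fact n) * (\<rho> / cmod (z - p)) ^ n)"
      using \<rho> by (intro summable_binomial_coeff) (auto simp: divide_less_eq)
    then show "summable (\<lambda>n. cmod (\<alpha> n) * \<rho> ^ n)"
      by (simp add: \<alpha>_def norm_mult norm_divide norm_power power_divide)
    fix t :: real assume t: "t \<in> {0..1}"
    have w: "cmod (of_real t - p) < cmod (z - p)" using g[OF t] \<rho> by linarith
    define x where "x = (of_real t - p) / (z - p)"
    have x1: "cmod x < 1" using w q0 by (simp add: x_def norm_divide)
    then have x0: "1 - x \<noteq> 0" by auto
    have "(\<lambda>n. (- of_real c gchoose n) * (- x) ^ n) sums (1 + (- x)) powr (- of_real c)"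
      using x1 by (intro gen_binomial_complex) simp
    also have "(\<lambda>n. (- of_real c gchoose n) * (- x) ^ n) = (\<lambda>n. \<alpha> n * (of_real t - p) ^ n)"
    proof
      fix n show "(- of_real c gchoose n) * (- x) ^ n = \<alpha> n * (of_real t - p) ^ n"
        by (cases "even n") (simp_all add: \<alpha>_def x_def gbinomial_pochhammer power_divide)
    qed
    also have "(1 + (- x)) powr (- of_real c) = F t"
      using x0 Ln_shift[OF z w] by (simp add: F_def powr_def x_def)
    finally show "(\<lambda>n. \<alpha> n * (complex_of_real t - p) ^ n) sums F t" .
  qed
  then have "(LINT t|M. F t) = (\<Sum>n. \<alpha> n * centered_moment M p n)" by (rule sums_unique)
  also have "\<dots> = eval_fps (Abs_fps (\<lambda>n. pochhammer (of_real c) n / fact n * centered_moment M p n)) (1 / (z - p))"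
    unfolding eval_fps_def \<alpha>_def by (simp add: mult_ac)
  finally show ?thesis unfolding F by simp
qed

text \<open>The same factorization with the logarithmic series. Its term of index 0 is
  \<open>1 / of_nat 0 = 0\<close>, so the series has no constant term.\<close>

lemma log_transform_series:
  fixes z p :: complex and \<rho> :: real
  assumes M: "prob_space M" "sets M = sets borel" and AE: "AE t in M. t \<in> {0..1::real}"
    and z: "Im z \<noteq> 0" "Im z * Im p \<le> 0"
    and g: "\<And>t. t \<in> {0..1} \<Longrightarrow> cmod (of_real t - p) \<le> \<rho>" and \<rho>: "0 < \<rho>" "\<rho> < cmod (z - p)"
  shows "(LINT t|M. Ln (z - of_real t)) = Ln (z - p) -
     eval_fps (Abs_fps (\<lambda>n. 1 / of_nat n * centered_moment M p n)) (1 / (z - p))"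
proof -
  interpret prob_space M by fact
  note [measurable_cong] = M(2)
  define \<alpha> :: "nat \<Rightarrow> complex" where "\<alpha> n = 1 / of_nat n * (1 / (z - p)) ^ n" for n
  have q0: "z - p \<noteq> 0" using \<rho> by auto
  have cont: "continuous_on UNIV (\<lambda>t. Ln (z - complex_of_real t))"
    using z by (intro continuous_intros) (auto simp: complex_nonpos_Reals_iff)
  then have contm: "(\<lambda>t. Ln (z - complex_of_real t)) \<in> borel_measurable borel"
    by (rule borel_measurable_continuous_onI)
  define F where "F t = Ln (z - p) - Ln (z - complex_of_real t)" for t
  have "compact ((\<lambda>t. Ln (z - complex_of_real t)) ` {0..1})"
    by (intro compact_continuous_image continuous_on_subset[OF cont]) auto
  then obtain C where C: "\<And>t. t \<in> {0..1} \<Longrightarrow> cmod (Ln (z - complex_of_real t)) \<le> C"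
    using compact_imp_bounded bounded_iff by (metis (no_types, lifting) imageI)
  have int: "integrable M (\<lambda>t. Ln (z - complex_of_real t))"
  proof (rule integrable_const_bound)
    show "AE t in M. cmod (Ln (z - complex_of_real t)) \<le> C"
      using AE by eventually_elim (rule C)
  qed (use contm in measurable)
  have "(\<lambda>n. \<alpha> n * centered_moment M p n) sums (LINT t|M. F t)"
  proof (rule integral_power_series[OF M AE])
    show "F \<in> borel_measurable borel"
      unfolding F_def using contm by measurable
    show "(\<lambda>x. complex_of_real x - p) \<in> borel_measurable borel" by simp
    show "cmod (complex_of_real t - p) \<le> \<rho>" if "t \<in> {0..1}" for t using g[OF that] .
    have "summable (\<lambda>n. cmod (1 / of_nat n) * (\<rho> / cmod (z - p)) ^ n)"
      using \<rho> by (intro summable_log_coeff) (auto simp: divide_less_eq)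
    then show "summable (\<lambda>n. cmod (\<alpha> n) * \<rho> ^ n)"
      by (simp add: \<alpha>_def norm_mult norm_divide norm_power power_divide)
    fix t :: real assume t: "t \<in> {0..1}"
    have w: "cmod (of_real t - p) < cmod (z - p)" using g[OF t] \<rho> by linarith
    define x where "x = (of_real t - p) / (z - p)"
    have x1: "cmod x < 1" using w q0 by (simp add: x_def norm_divide)
    have "(\<lambda>n. - ((- (- x)) ^ n) / of_nat n) sums Ln (1 + (- x))"
      using x1 by (intro Ln_series') simp
    from sums_minus[OF this] have "(\<lambda>n. x ^ n / of_nat n) sums - Ln (1 - x)" by simp
    also have "(\<lambda>n. x ^ n / of_nat n) = (\<lambda>n. \<alpha> n * (of_real t - p) ^ n)"
      by (simp add: \<alpha>_def x_def power_divide fun_eq_iff)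
    also have "- Ln (1 - x) = F t"
      using Ln_shift[OF z w] by (simp add: F_def x_def)
    finally show "(\<lambda>n. \<alpha> n * (complex_of_real t - p) ^ n) sums F t" .
  qed
  then have "(LINT t|M. F t) = (\<Sum>n. \<alpha> n * centered_moment M p n)" by (rule sums_unique)
  also have "\<dots> = eval_fps (Abs_fps (\<lambda>n. 1 / of_nat n * centered_moment M p n)) (1 / (z - p))"
    unfolding eval_fps_def \<alpha>_def by (simp add: mult_ac)
  finally show ?thesis unfolding F_def using int by (simp add: prob_space algebra_simps)
qed

section \<open>Characterization of the transform by moments\<close>

text \<open>About the centre 0 and with \<open>w = 1 / z\<close>, the defining identity becomes
  \<open>\<Phi> = exp (c * L)\<close> on the unit disc. Differentiation gives the equation that
  characterizes \<open>mk_coeff\<close>, and convergent power series that agree near 0 have equal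
  coefficients.\<close>

lemma mk_transform_moments:
  fixes c :: real
  assumes MK: "is_markov_krein_transform c \<mu> \<nu>"
    and AE\<mu>: "AE t in \<mu>. t \<in> {0..1}" and AE\<nu>: "AE t in \<nu>. t \<in> {0..1}"
  shows "of_real (pochhammer c n / fact n) * centered_moment \<nu> 0 n
    = mk_coeff (of_real c) (centered_moment \<mu> 0) n"
proof -
  have M: "prob_space \<mu>" "sets \<mu> = sets borel" "prob_space \<nu>" "sets \<nu> = sets borel"
    using MK by (auto simp: is_markov_krein_transform_def)
  have g: "\<And>t. t \<in> {0..1} \<Longrightarrow> cmod (of_real t - 0) \<le> 1" by auto
  define c' where "c' = complex_of_real c"
  define \<Phi> where "\<Phi> = Abs_fps (\<lambda>n. pochhammer c' n / fact n * centered_moment \<nu> 0 n)"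
  define L where "L = Abs_fps (\<lambda>n. 1 / of_nat n * centered_moment \<mu> 0 n)"
  have r\<Phi>: "fps_conv_radius \<Phi> \<ge> 1"
    using fps_conv_radius_centered[OF M(3,4) AE\<nu> g zero_less_one summable_binomial_coeff]
    unfolding \<Phi>_def one_ereal_def by fastforce
  have rL: "fps_conv_radius L \<ge> 1"
    using fps_conv_radius_centered[OF M(1,2) AE\<mu> g zero_less_one summable_log_coeff]
    unfolding L_def one_ereal_def by fastforce
  have in\<Phi>: "ereal (cmod w) < fps_conv_radius \<Phi>" and inL: "ereal (cmod w) < fps_conv_radius L"
    if "cmod w < 1" for w
    using r\<Phi> rL that by (metis ereal_less(3) less_le_trans one_ereal_def ereal_less_eq(3) less_ereal.simps(1))+
  have nonreal: "eval_fps \<Phi> w = exp (c' * eval_fps L w)" if w: "cmod w < 1" "Im w \<noteq> 0" for w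
  proof -
    define z where "z = 1 / w"
    have w0: "w \<noteq> 0" using w by auto
    have z: "Im z \<noteq> 0" "Im z * Im 0 \<le> 0"
      using w w0 by (auto simp: z_def Im_divide complex_eq_iff)
    have z1: "1 < cmod (z - 0)" using w w0 by (simp add: z_def norm_divide)
    have z0: "z \<noteq> 0" using z by auto
    have zw: "1 / (z - 0) = w" by (simp add: z_def)
    have znr: "z \<notin> \<real>" using z by (auto simp: complex_is_Real_iff)
    have "(LINT t|\<nu>. (z - of_real t) powr (- c')) = exp (- c' * (LINT u|\<mu>. Ln (z - of_real u)))"
      using MK znr unfolding is_markov_krein_transform_def c'_def by blast
    also have "(LINT t|\<nu>. (z - of_real t) powr (- c')) = z powr (- c') * eval_fps \<Phi> w"
      using powr_transform_series[OF M(3,4) AE\<nu> z g zero_less_one z1, of c] unfolding zw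
      by (simp add: \<Phi>_def c'_def)
    also have "(LINT u|\<mu>. Ln (z - of_real u)) = Ln z - eval_fps L w"
      using log_transform_series[OF M(1,2) AE\<mu> z g zero_less_one z1] unfolding zw
      by (simp add: L_def)
    finally have "exp (- c' * Ln z) * eval_fps \<Phi> w = exp (- c' * Ln z) * exp (c' * eval_fps L w)"
      using z0 by (simp add: powr_def exp_add [symmetric] algebra_simps)
    then show ?thesis by simp
  qed
  \<comment> \<open>The definition speaks of non-real \<open>z\<close> only; real \<open>w\<close>
    are reached by continuity.\<close>
  have all: "eval_fps \<Phi> w = exp (c' * eval_fps L w)" if w: "cmod w < 1" for w
  proof (cases "Im w = 0")
    case True
    \<comment> \<open>The denominator \<open>n + 2\<close> keeps the vertical displacement strictly
      below \<open>1 - cmod w\<close>, so every \<open>s n\<close> stays in the disc.\<close>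
    define s where "s n = w + \<i> * of_real ((1 - cmod w) / of_nat (Suc (Suc n)))" for n :: nat
    have nz: "(1 - cmod w) / of_nat (Suc (Suc n)) \<noteq> 0" for n using w by (simp del: of_nat_Suc)
    have sI: "Im (s n) \<noteq> 0" for n using nz[of n] True by (simp add: s_def del: of_nat_Suc)
    have sn: "cmod (s n) < 1" for n
    proof -
      have "cmod (s n) \<le> cmod w + \<bar>(1 - cmod w) / of_nat (Suc (Suc n))\<bar>"
        unfolding s_def by (rule norm_triangle_le) (simp only: norm_mult norm_ii norm_of_real mult_1 order_refl)
      also have "\<bar>(1 - cmod w) / of_nat (Suc (Suc n))\<bar> < 1 - cmod w"
        using w mult_left_mono[of "cmod w" 1 "real n"] by (simp add: field_simps)
      finally show ?thesis by simp
    qed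
    have "(\<lambda>n. (1 - cmod w) * (1 / of_nat (Suc (Suc n)))) \<longlonglongrightarrow> (1 - cmod w) * 0"
      by (intro tendsto_mult tendsto_const LIMSEQ_Suc lim_1_over_n)
    then have "(\<lambda>n. w + \<i> * of_real ((1 - cmod w) / of_nat (Suc (Suc n)))) \<longlonglongrightarrow> w + \<i> * of_real 0"
      by (intro tendsto_intros) (simp del: of_nat_Suc)
    then have lim: "s \<longlonglongrightarrow> w" by (simp add: s_def [abs_def])
    have c1: "isCont (eval_fps \<Phi>) w" and c2: "isCont (eval_fps L) w"
      using in\<Phi>[OF w] inL[OF w] by (auto intro!: continuous_eval_fps)
    have "(\<lambda>n. eval_fps \<Phi> (s n)) \<longlonglongrightarrow> eval_fps \<Phi> w"
      using c1 lim by (rule isCont_tendsto_compose)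
    moreover have "(\<lambda>n. eval_fps \<Phi> (s n)) \<longlonglongrightarrow> exp (c' * eval_fps L w)"
      unfolding nonreal[OF sn sI] by (intro tendsto_intros isCont_tendsto_compose[OF c2 lim])
    ultimately show ?thesis by (rule LIMSEQ_unique)
  qed (use nonreal that in auto)
  define K where "K = Abs_fps (\<lambda>n. centered_moment \<mu> 0 (Suc n))"
  have LK: "fps_deriv L = K"
    by (rule fps_ext) (simp add: L_def K_def del: of_nat_Suc)
  have rK: "fps_conv_radius K \<ge> 1"
    using fps_conv_radius_deriv[of L] rL unfolding LK by (meson order_trans)
  have e1: "(0::ereal) < 1" by simp
  have ode: "fps_deriv \<Phi> = fps_const c' * K * \<Phi>"
  proof (rule eval_fps_eqD)
    show "0 < fps_conv_radius (fps_deriv \<Phi>)"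
      using fps_conv_radius_deriv[of \<Phi>] r\<Phi> by (metis order_trans less_le_trans e1)
    have "1 \<le> fps_conv_radius (fps_const c' * K * \<Phi>)"
      using fps_conv_radius_mult[of "fps_const c' * K" \<Phi>] fps_conv_radius_mult[of "fps_const c'" K] rK r\<Phi>
      by (simp add: min_def split: if_splits)
    then show "0 < fps_conv_radius (fps_const c' * K * \<Phi>)" by (metis less_le_trans e1)
    have "eval_fps (fps_deriv \<Phi>) w = eval_fps (fps_const c' * K * \<Phi>) w" if w: "w \<in> ball 0 1" for w
    proof -
      have w1: "cmod w < 1" using w by simp
      have iK: "ereal (cmod w) < fps_conv_radius K" using rK w1
        by (metis less_le_trans one_ereal_def less_ereal.simps(1))
      have "(eval_fps \<Phi> has_field_derivative eval_fps (fps_deriv \<Phi>) w) (at w)"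
        using in\<Phi>[OF w1] by (intro has_field_derivative_eval_fps)
      moreover have "(eval_fps \<Phi> has_field_derivative c' * eval_fps K w * eval_fps \<Phi> w) (at w)"
      proof (rule has_field_derivative_transform_within_open)
        show "((\<lambda>w. exp (c' * eval_fps L w)) has_field_derivative c' * eval_fps K w * eval_fps \<Phi> w) (at w)"
          unfolding all[OF w1] LK[symmetric]
          by (auto intro!: derivative_eq_intros has_field_derivative_eval_fps inL[OF w1])
        show "exp (c' * eval_fps L v) = eval_fps \<Phi> v" if "v \<in> ball 0 1" for v
          using all[of v] that by simp
      qed (use w in auto)
      ultimately have "eval_fps (fps_deriv \<Phi>) w = c' * eval_fps K w * eval_fps \<Phi> w"
        by (rule DERIV_unique)
      moreover have "ereal (cmod w) < fps_conv_radius (fps_const c' * K)"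
        using iK fps_conv_radius_mult[of "fps_const c'" K] by (simp add: less_le_trans)
      ultimately show ?thesis using iK in\<Phi>[OF w1] by (simp add: eval_fps_mult)
    qed
    then show "\<forall>\<^sub>F w in nhds 0. eval_fps (fps_deriv \<Phi>) w = eval_fps (fps_const c' * K * \<Phi>) w"
      by (intro eventually_nhds_in_open[THEN eventually_mono, of "ball 0 1"]) auto
  qed
  interpret prob_space \<nu> by fact
  have "\<Phi> $ n = mk_coeff c' (centered_moment \<mu> 0) n"
    using ode unfolding K_def by (intro mk_coeff_unique) (simp_all add: \<Phi>_def prob_space)
  then show ?thesis by (simp add: \<Phi>_def c'_def pochhammer_of_real)
qed

text \<open>For non-real \<open>z\<close>, a centre \<open>p\<close> lying far away on the other side of the real axis satisfies
  \<open>cmod (t - p) < cmod (z - p)\<close> for all \<open>t\<close> in the unit interval, so that the series about \<open>p\<close> converge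
  at \<open>z\<close>. This replaces analytic continuation from large \<open>z\<close>.\<close>

lemma mk_transform_if_centered_moments:
  fixes c :: real
  assumes M: "prob_space \<mu>" "sets \<mu> = sets borel" "prob_space \<nu>" "sets \<nu> = sets borel"
    and AE\<mu>: "AE t in \<mu>. t \<in> {0..1}" and AE\<nu>: "AE t in \<nu>. t \<in> {0..1}"
    and mom: "\<And>p n. of_real (pochhammer c n / fact n) * centered_moment \<nu> p n
      = mk_coeff (of_real c) (centered_moment \<mu> p) n"
  shows "is_markov_krein_transform c \<mu> \<nu>"
proof -
  interpret \<mu>: prob_space \<mu> by fact
  note [measurable_cong] = M(2)
  have "integrable \<mu> (\<lambda>u. ln (1 + \<bar>u\<bar>))"
  proof (rule \<mu>.integrable_const_bound[where B = "ln 2"])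
    show "AE u in \<mu>. norm (ln (1 + \<bar>u\<bar>)) \<le> ln 2"
      using AE\<mu> by eventually_elim auto
  qed measurable
  moreover have "(LINT t|\<nu>. (z - of_real t) powr (- of_real c)) =
        exp (- of_real c * (LINT u|\<mu>. Ln (z - of_real u)))" if "z \<notin> \<real>" for z
  proof -
    have y: "Im z \<noteq> 0" using that by (auto simp: complex_is_Real_iff)
    \<comment> \<open>With this \<open>R\<close> the cross term in the square of
      \<open>cmod (z - p)\<close> is \<open>2 * \<bar>Im z\<bar> * R = 2\<close>, which beats the
      \<open>1/4\<close> that the half-length of the interval contributes to the square of
      \<open>\<rho>\<close>.\<close>
    define R where "R = 1 / \<bar>Im z\<bar>"
    have R: "0 < R" using y by (simp add: R_def)
    define p where "p = Complex (1/2) (- sgn (Im z) * R)"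
    \<comment> \<open>The largest distance from \<open>p\<close> to a point of the unit interval,
      attained at both ends because \<open>Re p = 1/2\<close>.\<close>
    define \<rho> where "\<rho> = sqrt (1/4 + R\<^sup>2)"
    have z: "Im z \<noteq> 0" "Im z * Im p \<le> 0"
      using y R by (auto simp: p_def sgn_if mult_le_0_iff)
    have \<rho>: "0 < \<rho>" by (simp add: \<rho>_def add_pos_nonneg)
    have g: "cmod (of_real t - p) \<le> \<rho>" if "t \<in> {0..1}" for t
    proof -
      have "\<bar>t - 1/2\<bar> \<le> 1/2" using that unfolding abs_le_iff by auto
      then have "(t - 1/2)\<^sup>2 \<le> (1/2)\<^sup>2" by (simp only: abs_le_square_iff [symmetric])
      then have "(t - 1/2)\<^sup>2 + (sgn (Im z) * R)\<^sup>2 \<le> 1/4 + R\<^sup>2"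
        using y by (auto simp: power_mult_distrib sgn_if power2_eq_square split: if_splits)
      then show ?thesis unfolding cmod_def \<rho>_def by (simp add: p_def)
    qed
    have g2: "\<rho> < cmod (z - p)"
    proof -
      have "Im z * sgn (Im z) = \<bar>Im z\<bar>" by (simp add: sgn_if)
      then have "2 * (Im z * sgn (Im z)) * R = 2" using y by (simp add: R_def)
      moreover have "(sgn (Im z))\<^sup>2 = 1" using y by (simp add: sgn_if)
      ultimately have "(Im z + sgn (Im z) * R)\<^sup>2 = (Im z)\<^sup>2 + 2 + R\<^sup>2"
        by (simp add: power2_sum power_mult_distrib mult_ac)
      then have "1/4 + R\<^sup>2 < (Re z - 1/2)\<^sup>2 + (Im z + sgn (Im z) * R)\<^sup>2"
        using zero_le_power2[of "Re z - 1/2"] zero_le_power2[of "Im z"] by linarith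
      then show ?thesis unfolding cmod_def \<rho>_def by (simp add: p_def)
    qed
    define c' where "c' = complex_of_real c"
    define \<Phi> where "\<Phi> = Abs_fps (\<lambda>n. pochhammer c' n / fact n * centered_moment \<nu> p n)"
    define L where "L = Abs_fps (\<lambda>n. 1 / of_nat n * centered_moment \<mu> p n)"
    define K where "K = Abs_fps (\<lambda>n. centered_moment \<mu> p (Suc n))"
    have r\<Phi>: "fps_conv_radius \<Phi> \<ge> ereal (1 / \<rho>)"
      unfolding \<Phi>_def using summable_binomial_coeff
      by (intro fps_conv_radius_centered[OF M(3,4) AE\<nu> g \<rho>]) auto
    have rL: "fps_conv_radius L \<ge> ereal (1 / \<rho>)"
      unfolding L_def using summable_log_coeff
      by (intro fps_conv_radius_centered[OF M(1,2) AE\<mu> g \<rho>]) auto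
    have LK: "fps_deriv L = K"
      by (rule fps_ext) (simp add: L_def K_def del: of_nat_Suc)
    have \<Phi>: "\<Phi> = Abs_fps (mk_coeff c' (centered_moment \<mu> p))"
      unfolding \<Phi>_def using mom[of _ p] by (simp add: c'_def pochhammer_of_real)
    have ode: "fps_deriv \<Phi> = fps_const c' * K * \<Phi>"
      unfolding \<Phi> K_def by (rule fps_deriv_mk_coeff)
    \<comment> \<open>By the differential equation \<open>\<Phi> * exp (- c' * L)\<close> has
      derivative 0 on the disc, and its value at 0 is 1.\<close>
    have in_disc: "eval_fps \<Phi> w = exp (c' * eval_fps L w)" if w: "w \<in> ball 0 (1 / \<rho>)" for w
    proof -
      have "((\<lambda>w. eval_fps \<Phi> w * exp (- c' * eval_fps L w)) has_field_derivative 0) (at v within ball 0 (1 / \<rho>))"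
        if v: "v \<in> ball 0 (1 / \<rho>)" for v
      proof -
        have i: "ereal (cmod v) < fps_conv_radius \<Phi>" "ereal (cmod v) < fps_conv_radius L"
          using v r\<Phi> rL by (auto intro: less_le_trans[rotated])
        have iK: "ereal (cmod v) < fps_conv_radius K"
          using i(2) fps_conv_radius_deriv[of L] by (simp add: LK less_le_trans)
        have "ereal (cmod v) < fps_conv_radius (fps_const c' * K)"
          using iK fps_conv_radius_mult[of "fps_const c'" K] by (simp add: less_le_trans)
        then have d: "eval_fps (fps_deriv \<Phi>) v = c' * eval_fps K v * eval_fps \<Phi> v"
          unfolding ode using iK i by (simp add: eval_fps_mult)
        have "((\<lambda>w. eval_fps \<Phi> w * exp (- c' * eval_fps L w)) has_field_derivative
           eval_fps (fps_deriv \<Phi>) v * exp (- c' * eval_fps L v)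
             + (exp (- c' * eval_fps L v) * (- c' * eval_fps K v)) * eval_fps \<Phi> v) (at v within ball 0 (1 / \<rho>))"
          unfolding LK[symmetric]
          by (auto intro!: derivative_eq_intros has_field_derivative_eval_fps i)
        then show ?thesis unfolding d by (simp add: algebra_simps)
      qed
      then have "\<exists>k. \<forall>v\<in>ball 0 (1 / \<rho>). eval_fps \<Phi> v * exp (- c' * eval_fps L v) = k"
        by (intro has_field_derivative_zero_constant) auto
      then obtain k where k: "\<And>v. v \<in> ball 0 (1 / \<rho>) \<Longrightarrow> eval_fps \<Phi> v * exp (- c' * eval_fps L v) = k"
        by blast
      have "k = 1" using k[of 0] \<rho> by (simp add: eval_fps_at_0 L_def \<Phi>)
      then show ?thesis using k[OF w] by (simp add: exp_minus field_simps)
    qed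
    define w where "w = 1 / (z - p)"
    have wb: "w \<in> ball 0 (1 / \<rho>)" using g2 \<rho> by (simp add: w_def norm_divide divide_less_eq field_simps)
    have q0: "z - p \<noteq> 0" using g2 \<rho> by auto
    have i1: "(LINT t|\<nu>. (z - of_real t) powr (- c')) = (z - p) powr (- c') * eval_fps \<Phi> w"
      using powr_transform_series[OF M(3,4) AE\<nu> z g \<rho> g2, of c] 
      by (simp add: \<Phi>_def c'_def w_def)
    have i2: "(LINT u|\<mu>. Ln (z - of_real u)) = Ln (z - p) - eval_fps L w"
      using log_transform_series[OF M(1,2) AE\<mu> z g \<rho> g2]
      by (simp add: L_def w_def)
    show ?thesis
      unfolding c'_def[symmetric] i1 i2 in_disc[OF wb]
      using q0 by (simp add: powr_def exp_add [symmetric] algebra_simps)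
  qed
  ultimately show ?thesis using M unfolding is_markov_krein_transform_def by blast
qed

section \<open>Moments about the origin and about arbitrary centres\<close>

lemma mk_coeff_of_real:
  "mk_coeff (of_real c) (\<lambda>n. of_real (m n)) n = (of_real (mk_coeff c m n) :: 'a::{real_field})"
proof (induction n rule: less_induct)
  case (less n)
  show ?case
  proof (cases n)
    case (Suc k)
    then show ?thesis using less by simp
  qed simp
qed

lemma centered_moment_0: "centered_moment M 0 n = of_real (LINT t|M. t ^ n)"
  by (simp flip: of_real_power)

text \<open>The binomial expansion makes the moment a polynomial in \<open>p\<close>, which replaces
  differentiation under the integral sign; the absorption identity for binomial coefficients then
  pulls out the factor \<open>Suc n\<close>.\<close>

lemma centered_moment_has_derivative:
  assumes M: "prob_space M" "sets M = sets borel" and AE: "AE t in M. t \<in> {0..1::real}"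
  shows "((\<lambda>p. centered_moment M p (Suc n)) has_field_derivative
           - of_nat (Suc n) * centered_moment M p n) (at p)"
proof -
  have int: "integrable M (\<lambda>t. complex_of_real t ^ n)" for n
    using integrable_centered_power[OF M AE, of 0] by simp
  have binom: "centered_moment M p n =
     (\<Sum>k\<le>n. of_nat (n choose k) * centered_moment M 0 k * (- p) ^ (n - k))" for p n
  proof -
    have "centered_moment M p n =
        (LINT t|M. (\<Sum>k\<le>n. of_nat (n choose k) * complex_of_real t ^ k * (- p) ^ (n - k)))"
      using binomial_ring[of "complex_of_real _" "- p" n] by simp
    also have "\<dots> = (\<Sum>k\<le>n. of_nat (n choose k) * (LINT t|M. complex_of_real t ^ k) * (- p) ^ (n - k))"
      by (subst Bochner_Integration.integral_sum)
         (auto intro!: integrable_mult_left integrable_mult_right int simp: mult.assoc)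
    finally show ?thesis by simp
  qed
  have "((\<lambda>p. \<Sum>k\<le>Suc n. of_nat (Suc n choose k) * centered_moment M 0 k * (- p) ^ (Suc n - k)) has_field_derivative
     (\<Sum>k\<le>Suc n. of_nat (Suc n choose k) * centered_moment M 0 k * (of_nat (Suc n - k) * ((- p) ^ (Suc n - k - 1)) * - 1))) (at p)"
    by (intro DERIV_sum DERIV_cmult) (auto intro!: derivative_eq_intros)
  also have "(\<Sum>k\<le>Suc n. of_nat (Suc n choose k) * centered_moment M 0 k * (of_nat (Suc n - k) * ((- p) ^ (Suc n - k - 1)) * - 1))
     = (\<Sum>k\<le>n. of_nat (Suc n choose k) * centered_moment M 0 k * (of_nat (Suc n - k) * ((- p) ^ (n - k)) * - 1))"
    by simp
  also have "\<dots> = (\<Sum>k\<le>n. - of_nat (Suc n) * (of_nat (n choose k) * centered_moment M 0 k * (- p) ^ (n - k)))"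
  proof (intro sum.cong refl)
    fix k
    have "(Suc n - k) * (Suc n choose k) = Suc n * (n choose k)"
      using binomial_absorb_comp[of "Suc n" k] by simp
    then have "complex_of_nat (Suc n choose k) * of_nat (Suc n - k) = of_nat (Suc n) * of_nat (n choose k)"
      by (metis mult.commute of_nat_mult)
    moreover have "x * m * (y * q * - 1) = - u * (v * m * q)" if "x * y = u * v" for x y u v m q :: complex
      using that by algebra
    ultimately show "of_nat (Suc n choose k) * centered_moment M 0 k * (of_nat (Suc n - k) * ((- p) ^ (n - k)) * - 1) =
        - of_nat (Suc n) * (of_nat (n choose k) * centered_moment M 0 k * (- p) ^ (n - k))"
      by blast
  qed
  also have "\<dots> = - of_nat (Suc n) * centered_moment M p n"
    unfolding binom[of p n] by (simp add: sum_distrib_left)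
  finally show ?thesis unfolding binom[of _ "Suc n"] .
qed

text \<open>Both sides of the relation about \<open>p\<close> obey the same recursion in the complex
  variable \<open>p\<close>, so their difference satisfies
  \<open>e (Suc n)' = - (c + n) * e n\<close>. Inductively \<open>e (Suc n)\<close> is constant in
  \<open>p\<close>, and it vanishes at \<open>p = 0\<close> by hypothesis.\<close>

lemma mk_transform_if_moments:
  fixes c :: real
  assumes M: "prob_space \<mu>" "sets \<mu> = sets borel" "prob_space \<nu>" "sets \<nu> = sets borel"
    and AE\<mu>: "AE t in \<mu>. t \<in> {0..1}" and AE\<nu>: "AE t in \<nu>. t \<in> {0..1}"
    and mom: "\<And>n. pochhammer c n / fact n * (LINT t|\<nu>. t ^ n) = mk_coeff c (\<lambda>n. LINT t|\<mu>. t ^ n) n"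
  shows "is_markov_krein_transform c \<mu> \<nu>"
proof (rule mk_transform_if_centered_moments[OF assms(1-6)])
  interpret \<mu>: prob_space \<mu> by fact
  interpret \<nu>: prob_space \<nu> by fact
  define c' where "c' = complex_of_real c"
  define e where "e n p = pochhammer c' n / fact n * centered_moment \<nu> p n - mk_coeff c' (centered_moment \<mu> p) n" for n p
  have e0: "e n 0 = 0" for n
  proof -
    have "of_real (pochhammer c n / fact n * (LINT t|\<nu>. t ^ n)) = complex_of_real (mk_coeff c (\<lambda>n. LINT t|\<mu>. t ^ n) n)"
      unfolding mom ..
    also have "\<dots> = mk_coeff c' (centered_moment \<mu> 0) n"
      unfolding centered_moment_0 c'_def by (rule mk_coeff_of_real [symmetric])
    finally show ?thesis unfolding e_def centered_moment_0[of \<nu>] by (simp add: c'_def pochhammer_of_real)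
  qed
  have d: "(e (Suc n) has_field_derivative - (c' + of_nat n) * e n p) (at p)" for n p
  proof -
    have "(e (Suc n) has_field_derivative pochhammer c' (Suc n) / fact (Suc n) * (- of_nat (Suc n) * centered_moment \<nu> p n)
      - (- (c' + of_nat n) * mk_coeff c' (centered_moment \<mu> p) n)) (at p)"
      unfolding e_def
      by (intro DERIV_diff DERIV_cmult centered_moment_has_derivative mk_coeff_translate M AE\<mu> AE\<nu>)
         (simp add: \<mu>.prob_space)
    moreover have "pochhammer c' (Suc n) / fact (Suc n) * of_nat (Suc n) = (c' + of_nat n) * (pochhammer c' n / fact n)"
      by (simp add: pochhammer_Suc fact_Suc del: of_nat_Suc)
    moreover have "P * (- x * M) - (- u * h) = - u * (Q * M - h)" if "P * x = u * Q" for P x M u h Q :: complex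
      using that by algebra
    ultimately show ?thesis unfolding e_def[of n] by metis
  qed
  have "e n p = 0" for n p
  proof (induction n arbitrary: p)
    case 0
    then show ?case by (simp add: e_def \<nu>.prob_space)
  next
    case (Suc n)
    then have "(e (Suc n) has_field_derivative 0) (at p within UNIV)" for p using d[of n p] by simp
    then obtain k where "\<And>p. e (Suc n) p = k"
      using has_field_derivative_zero_constant[of UNIV "e (Suc n)"] by auto
    then show ?case using e0[of "Suc n"] by metis
  qed
  then show "of_real (pochhammer c n / fact n) * centered_moment \<nu> p n
      = mk_coeff (of_real c) (centered_moment \<mu> p) n" for p n
    unfolding e_def c'_def by (simp add: pochhammer_of_real)
qed

lemma moments_if_mk_transform:
  fixes c :: real
  assumes "is_markov_krein_transform c \<mu> \<nu>" "AE t in \<mu>. t \<in> {0..1}" "AE t in \<nu>. t \<in> {0..1}"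
  shows "pochhammer c n / fact n * (LINT t|\<nu>. t ^ n) = mk_coeff c (\<lambda>n. LINT t|\<mu>. t ^ n) n"
proof -
  have "complex_of_real (pochhammer c n / fact n * (LINT t|\<nu>. t ^ n)) = of_real (mk_coeff c (\<lambda>n. LINT t|\<mu>. t ^ n) n)"
    using mk_transform_moments[OF assms, of n] unfolding centered_moment_0 mk_coeff_of_real by simp
  then show ?thesis by (simp only: of_real_eq_iff)
qed

text \<open>Both sides satisfy the same triangular linear system of ordinary differential equations.\<close>

lemma moment_flow_mk:
  fixes a b c T :: real and m y :: "real \<Rightarrow> nat \<Rightarrow> real"
  assumes m: "\<And>n t. t \<in> {0..T} \<Longrightarrow> ((\<lambda>t. m t (Suc n)) has_real_derivative moment_rhs a b c n (m t)) (at t within {0..T})"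
    and y: "\<And>n t. t \<in> {0..T} \<Longrightarrow> ((\<lambda>t. y t (Suc n)) has_real_derivative
        real (Suc n) * (a + c + real n + 1) * y t n
        - real (Suc n) * (a + b + 2 * c + real n + 2) * y t (Suc n)) (at t within {0..T})"
    and m0: "\<And>t. t \<in> {0..T} \<Longrightarrow> m t 0 = 1" and y0: "\<And>t. t \<in> {0..T} \<Longrightarrow> y t 0 = 1"
    and init: "\<And>n. pochhammer c n / fact n * y 0 n = mk_coeff c (m 0) n"
    and t: "t \<in> {0..T}"
  shows "pochhammer c n / fact n * y t n = mk_coeff c (m t) n"
proof -
  define e where "e n t = pochhammer c n / fact n * y t n - mk_coeff c (m t) n" for n t
  have d: "(e (Suc n) has_real_derivative (c + real n) * (a + c + real n + 1) * e n t
       - real (Suc n) * (a + b + 2 * c + real n + 2) * e (Suc n) t) (at t within {0..T})"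
    if t: "t \<in> {0..T}" for n t
  proof -
    have p: "pochhammer c (Suc n) / fact (Suc n) * real (Suc n) = (c + real n) * (pochhammer c n / fact n)"
      by (simp add: pochhammer_Suc fact_Suc del: of_nat_Suc)
    have "(e (Suc n) has_real_derivative pochhammer c (Suc n) / fact (Suc n) * (real (Suc n) * (a + c + real n + 1) * y t n
        - real (Suc n) * (a + b + 2 * c + real n + 2) * y t (Suc n)) - 
       ((c + real n) * (a + c + real n + 1) * mk_coeff c (m t) n
           - real (Suc n) * (a + b + 2 * c + real n + 2) * mk_coeff c (m t) (Suc n))) (at t within {0..T})"
      unfolding e_def
      by (intro DERIV_diff DERIV_cmult y mk_coeff_moment_flow m m0 t)
    moreover have "P * (x * v * Y - x * w * Y') - (u * v * h - x * w * h') = u * v * (Q * Y - h) - x * w * (P * Y' - h')"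
      if "P * x = u * Q" for P x v Y w Y' u h h' Q :: real
      using that by algebra
    ultimately show ?thesis unfolding e_def[of n] e_def[of "Suc n" t] using p by metis
  qed
  have "\<forall>t\<in>{0..T}. e n t = 0"
  proof (induction n)
    case 0
    then show ?case by (simp add: e_def y0)
  next
    case (Suc n)
    define k where "k = real (Suc n) * (a + b + 2 * c + real n + 2)"
    \<comment> \<open>Once \<open>e n\<close> vanishes, \<open>e (Suc n)\<close> solves a
      homogeneous equation with constant rate \<open>k\<close>, and the integrating factor turns it
      into a constant.\<close>
    have "((\<lambda>t. exp (k * t) * e (Suc n) t) has_real_derivative 0) (at t within {0..T})" if t: "t \<in> {0..T}" for t
    proof -
      have "(e (Suc n) has_real_derivative - k * e (Suc n) t) (at t within {0..T})"
        using d[OF t, of n] Suc t by (simp add: k_def)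
      then have "((\<lambda>t. exp (k * t) * e (Suc n) t) has_real_derivative
          (exp (k * t) * k) * e (Suc n) t + exp (k * t) * (- k * e (Suc n) t)) (at t within {0..T})"
        by (auto intro!: derivative_eq_intros)
      then show ?thesis by (simp add: algebra_simps)
    qed
    then obtain K where K: "\<And>t. t \<in> {0..T} \<Longrightarrow> exp (k * t) * e (Suc n) t = K"
      using has_field_derivative_zero_constant[of "{0..T}" "\<lambda>t. exp (k * t) * e (Suc n) t"] by auto
    have "K = 0" using K[of 0] t init[of "Suc n"] by (simp add: e_def del: mk_coeff.simps)
    then show ?case using K by fastforce
  qed
  then show ?thesis using t by (simp add: e_def)
qed

section \<open>Square integrable functions\<close>

definition sq_int :: "'a measure \<Rightarrow> ('a \<Rightarrow> real) \<Rightarrow> bool" where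
  "sq_int M f \<longleftrightarrow> f \<in> borel_measurable M \<and> integrable M (\<lambda>x. (f x)\<^sup>2)"

lemma sq_int_measurable: "sq_int M f \<Longrightarrow> f \<in> borel_measurable M"
  by (simp add: sq_int_def)

lemma sq_int_mult:
  assumes "sq_int M f" "sq_int M g"
  shows "integrable M (\<lambda>x. f x * g x)"
proof (rule Bochner_Integration.integrable_bound)
  show "integrable M (\<lambda>x. (f x)\<^sup>2 + (g x)\<^sup>2)" using assms by (auto simp: sq_int_def)
  show "(\<lambda>x. f x * g x) \<in> borel_measurable M" using assms by (auto simp: sq_int_def)
  have "\<bar>u * v\<bar> \<le> u\<^sup>2 + v\<^sup>2" for u v :: real
  proof -
    have "2 * (\<bar>u\<bar> * \<bar>v\<bar>) \<le> u\<^sup>2 + v\<^sup>2"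
      using zero_le_power2[of "\<bar>u\<bar> - \<bar>v\<bar>"] by (simp add: power2_diff mult.assoc)
    moreover have "0 \<le> \<bar>u\<bar> * \<bar>v\<bar>" by simp
    ultimately show ?thesis unfolding abs_mult by linarith
  qed
  then show "AE x in M. norm (f x * g x) \<le> norm ((f x)\<^sup>2 + (g x)\<^sup>2)" by auto
qed

lemma sq_int_add:
  assumes "sq_int M f" "sq_int M g" shows "sq_int M (\<lambda>x. f x + g x)"
proof -
  have "integrable M (\<lambda>x. (f x)\<^sup>2 + (g x)\<^sup>2 + 2 * (f x * g x))"
    using assms sq_int_mult[OF assms] by (intro Bochner_Integration.integrable_add) (auto simp: sq_int_def)
  then show ?thesis using assms by (auto simp: sq_int_def power2_sum mult.assoc)
qed

lemma sq_int_bounded_mult: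
  assumes "sq_int M f" "g \<in> borel_measurable M" "\<And>x. x \<in> space M \<Longrightarrow> \<bar>g x\<bar> \<le> C"
  shows "sq_int M (\<lambda>x. g x * f x)"
  unfolding sq_int_def
proof
  show "(\<lambda>x. g x * f x) \<in> borel_measurable M" using assms by (auto simp: sq_int_def)
  show "integrable M (\<lambda>x. (g x * f x)\<^sup>2)"
  proof (rule Bochner_Integration.integrable_bound)
    show "integrable M (\<lambda>x. C\<^sup>2 * (f x)\<^sup>2)" using assms by (auto simp: sq_int_def)
    show "(\<lambda>x. (g x * f x)\<^sup>2) \<in> borel_measurable M" using assms by (auto simp: sq_int_def)
    have "(g x)\<^sup>2 \<le> C\<^sup>2" if "x \<in> space M" for x
      using assms(3)[OF that] by (metis abs_ge_zero abs_le_square_iff abs_of_nonneg order_trans)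
    then show "AE x in M. norm ((g x * f x)\<^sup>2) \<le> norm (C\<^sup>2 * (f x)\<^sup>2)"
      by (auto simp: power_mult_distrib intro!: mult_right_mono)
  qed
qed

lemma integrable_weighted_square:
  assumes "sq_int M f" "g \<in> borel_measurable M" "\<And>x. x \<in> space M \<Longrightarrow> \<bar>g x\<bar> \<le> C"
  shows "integrable M (\<lambda>x. g x * (f x)\<^sup>2)"
  using sq_int_mult[OF sq_int_bounded_mult[OF assms] assms(1)] by (simp add: power2_eq_square mult.assoc)

lemma sq_int_cmult: "sq_int M f \<Longrightarrow> sq_int M (\<lambda>x. c * f x)"
  by (rule sq_int_bounded_mult[where C = "\<bar>c\<bar>"]) auto

lemma sq_int_diff:
  assumes "sq_int M f" "sq_int M g" shows "sq_int M (\<lambda>x. f x - g x)"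
  using sq_int_add[OF assms(1) sq_int_cmult[OF assms(2), of "-1"]] by simp

lemma sq_int_zero: "sq_int M (\<lambda>x. 0)"
  by (simp add: sq_int_def)

lemma sq_int_sum: "(\<And>i. i \<in> I \<Longrightarrow> sq_int M (f i)) \<Longrightarrow> sq_int M (\<lambda>x. \<Sum>i\<in>I. f i x)"
  by (induction I rule: infinite_finite_induct) (auto intro: sq_int_add sq_int_zero)

lemma (in finite_measure) sq_int_bounded:
  assumes "f \<in> borel_measurable M" "\<And>x. x \<in> space M \<Longrightarrow> \<bar>f x\<bar> \<le> C"
  shows "sq_int M f"
  using sq_int_bounded_mult[of M "\<lambda>_. 1" f C] assms by (simp add: sq_int_def)

lemma sq_int_nn_integral:
  assumes "f \<in> borel_measurable M" "(\<integral>\<^sup>+x. ennreal ((f x)\<^sup>2) \<partial>M) < \<infinity>"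
  shows "sq_int M f"
  using assms by (auto simp: sq_int_def intro!: integrableI_bounded)

lemma sq_int_abs: "sq_int M f \<Longrightarrow> sq_int M (\<lambda>x. \<bar>f x\<bar>)"
  by (auto simp: sq_int_def intro: borel_measurable_abs)

text \<open>The numbers \<open>d j\<close> in the proof are the parameters of Young's inequality
  \<open>2 \<bar>u\<bar> \<bar>y\<bar> \<le> u\<^sup>2 / d + d y\<^sup>2\<close>, which replaces an appeal to the Cauchy-Schwarz inequality.\<close>

lemma L2_limit_weighted_square:
  assumes fj: "\<And>j::nat. sq_int N (f j)" and [measurable]: "g \<in> borel_measurable N" "\<Phi> \<in> borel_measurable N"
    and lim: "(\<lambda>j. \<integral>\<^sup>+x. ennreal ((g x - f j x)\<^sup>2) \<partial>N) \<longlonglongrightarrow> 0"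
    and C: "\<And>x. x \<in> space N \<Longrightarrow> \<bar>\<Phi> x\<bar> \<le> C"
  shows "sq_int N g" and "(\<lambda>j. \<integral>x. \<Phi> x * (f j x)\<^sup>2 \<partial>N) \<longlonglongrightarrow> (\<integral>x. \<Phi> x * (g x)\<^sup>2 \<partial>N)"
proof -
  note [measurable] = sq_int_measurable[OF fj]
  have ev: "\<forall>\<^sub>F j in sequentially. sq_int N (\<lambda>x. g x - f j x)"
    using order_tendstoD(2)[OF lim zero_less_one]
  proof eventually_elim
    case (elim j)
    then have "(\<integral>\<^sup>+x. ennreal ((g x - f j x)\<^sup>2) \<partial>N) < \<infinity>"
      by (metis ennreal_one_less_top infinity_ennreal_def less_trans)
    then show ?case by (intro sq_int_nn_integral) auto
  qed
  then obtain j0 where j0: "\<And>j. j \<ge> j0 \<Longrightarrow> sq_int N (\<lambda>x. g x - f j x)"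
    by (auto simp: eventually_sequentially)
  show g: "sq_int N g"
    using sq_int_add[OF j0[OF order_refl] fj[of j0]] by simp
  have gf: "sq_int N (\<lambda>x. g x - f j x)" for j
    using sq_int_diff[OF g fj[of j]] .
  define e where "e j = (\<integral>x. (g x - f j x)\<^sup>2 \<partial>N)" for j
  have e0: "e j \<ge> 0" for j unfolding e_def by simp
  have "ennreal (e j) = (\<integral>\<^sup>+x. ennreal ((g x - f j x)\<^sup>2) \<partial>N)" for j
    unfolding e_def using gf[of j] by (subst nn_integral_eq_integral) (auto simp: sq_int_def)
  then have "(\<lambda>j. ennreal (e j)) \<longlonglongrightarrow> ennreal 0" using lim by simp
  then have e: "e \<longlonglongrightarrow> 0" using e0 by (subst (asm) tendsto_ennreal_iff) auto
  \<comment> \<open>\<open>d\<close> has to tend to 0 although it also divides \<open>e\<close>: the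
    square root gives \<open>e / d \<le> sqrt e\<close>, and \<open>1 / Suc j\<close> keeps
    \<open>d\<close> positive where \<open>e\<close> vanishes.\<close>
  define d where "d j = sqrt (e j) + 1 / real (Suc j)" for j
  have d0: "d j > 0" for j unfolding d_def using e0[of j] by (intro add_nonneg_pos) auto
  define S where "S = (\<integral>x. (g x)\<^sup>2 \<partial>N)"
  have wi: "integrable N (\<lambda>x. \<Phi> x * (h x)\<^sup>2)" if "sq_int N h" for h
    by (rule integrable_weighted_square[OF that _ C]) auto
  have bound: "\<bar>(\<integral>x. \<Phi> x * (f j x)\<^sup>2 \<partial>N) - (\<integral>x. \<Phi> x * (g x)\<^sup>2 \<partial>N)\<bar>
      \<le> \<bar>C\<bar> * ((1 + 1 / d j) * e j + d j * S)" for j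
  proof -
    have "(\<integral>x. \<Phi> x * (f j x)\<^sup>2 \<partial>N) - (\<integral>x. \<Phi> x * (g x)\<^sup>2 \<partial>N) = (\<integral>x. \<Phi> x * (f j x)\<^sup>2 - \<Phi> x * (g x)\<^sup>2 \<partial>N)"
      by (rule Bochner_Integration.integral_diff [symmetric]) (intro wi fj g)+
    also have "\<bar>\<dots>\<bar> \<le> (\<integral>x. \<bar>\<Phi> x * (f j x)\<^sup>2 - \<Phi> x * (g x)\<^sup>2\<bar> \<partial>N)"
      by (rule integral_abs_bound)
    also have "\<dots> \<le> (\<integral>x. \<bar>C\<bar> * ((1 + 1 / d j) * (g x - f j x)\<^sup>2 + d j * (g x)\<^sup>2) \<partial>N)"
    proof (rule integral_mono)
      show "integrable N (\<lambda>x. \<bar>\<Phi> x * (f j x)\<^sup>2 - \<Phi> x * (g x)\<^sup>2\<bar>)"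
        by (intro Bochner_Integration.integrable_abs Bochner_Integration.integrable_diff wi fj g)
      show "integrable N (\<lambda>x. \<bar>C\<bar> * ((1 + 1 / d j) * (g x - f j x)\<^sup>2 + d j * (g x)\<^sup>2))"
        using gf[of j] g by (auto simp: sq_int_def)
      fix x assume x: "x \<in> space N"
      define u where "u = g x - f j x"
      have "2 * \<bar>u\<bar> * \<bar>g x\<bar> \<le> u\<^sup>2 / d j + d j * (g x)\<^sup>2"
      proof -
        have "0 \<le> (\<bar>u\<bar> - d j * \<bar>g x\<bar>)\<^sup>2 / d j" using d0[of j] by simp
        also have "(\<bar>u\<bar> - d j * \<bar>g x\<bar>)\<^sup>2 / d j = u\<^sup>2 / d j + d j * (g x)\<^sup>2 - 2 * \<bar>u\<bar> * \<bar>g x\<bar>"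
          using d0[of j] by (simp add: power2_diff power_mult_distrib field_simps power2_eq_square)
        finally show ?thesis by simp
      qed
      moreover have "\<bar>(f j x)\<^sup>2 - (g x)\<^sup>2\<bar> \<le> u\<^sup>2 + 2 * \<bar>u\<bar> * \<bar>g x\<bar>"
      proof -
        have "(f j x)\<^sup>2 - (g x)\<^sup>2 = u\<^sup>2 - 2 * u * g x" unfolding u_def by (simp add: power2_eq_square algebra_simps)
        also have "\<bar>\<dots>\<bar> \<le> \<bar>u\<^sup>2\<bar> + \<bar>2 * u * g x\<bar>" by (rule abs_triangle_ineq4)
        finally show ?thesis by (simp add: abs_mult)
      qed
      ultimately have "\<bar>(f j x)\<^sup>2 - (g x)\<^sup>2\<bar> \<le> (1 + 1 / d j) * u\<^sup>2 + d j * (g x)\<^sup>2"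
        by (simp add: algebra_simps)
      then have "\<bar>\<Phi> x\<bar> * \<bar>(f j x)\<^sup>2 - (g x)\<^sup>2\<bar> \<le> \<bar>C\<bar> * ((1 + 1 / d j) * u\<^sup>2 + d j * (g x)\<^sup>2)"
        using C[OF x] by (intro mult_mono) auto
      then show "\<bar>\<Phi> x * (f j x)\<^sup>2 - \<Phi> x * (g x)\<^sup>2\<bar> \<le> \<bar>C\<bar> * ((1 + 1 / d j) * (g x - f j x)\<^sup>2 + d j * (g x)\<^sup>2)"
        by (simp add: right_diff_distrib [symmetric] abs_mult u_def)
    qed
    also have "\<dots> = \<bar>C\<bar> * ((1 + 1 / d j) * e j + d j * S)"
      unfolding e_def S_def using gf[of j] g
      by (simp add: sq_int_def)
    finally show ?thesis .
  qed
  have "(1 + 1 / d j) * e j \<le> e j + sqrt (e j)" for j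
  proof -
    have "sqrt (e j) \<le> d j" unfolding d_def by simp
    then have "sqrt (e j) * sqrt (e j) \<le> sqrt (e j) * d j" by (intro mult_left_mono) (auto simp: e0)
    then have "e j / d j \<le> sqrt (e j)" using d0[of j] e0[of j] by (simp add: divide_le_eq)
    then show ?thesis by (simp add: algebra_simps)
  qed
  then have bound2: "\<bar>(\<integral>x. \<Phi> x * (f j x)\<^sup>2 \<partial>N) - (\<integral>x. \<Phi> x * (g x)\<^sup>2 \<partial>N)\<bar>
      \<le> \<bar>C\<bar> * (e j + sqrt (e j) + d j * S)" for j
    using bound[of j] by (smt (verit) abs_ge_zero mult_left_mono)
  have "(\<lambda>j. 1 / real (Suc j)) \<longlonglongrightarrow> 0" by (rule LIMSEQ_Suc[OF lim_1_over_n])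
  then have "d \<longlonglongrightarrow> sqrt 0 + 0" unfolding d_def by (intro tendsto_intros e)
  then have "(\<lambda>j. \<bar>C\<bar> * (e j + sqrt (e j) + d j * S)) \<longlonglongrightarrow> \<bar>C\<bar> * (0 + sqrt 0 + (sqrt 0 + 0) * S)"
    by (intro tendsto_intros e)
  then have "(\<lambda>j. \<bar>C\<bar> * (e j + sqrt (e j) + d j * S)) \<longlonglongrightarrow> 0" by simp
  then have "(\<lambda>j. (\<integral>x. \<Phi> x * (f j x)\<^sup>2 \<partial>N) - (\<integral>x. \<Phi> x * (g x)\<^sup>2 \<partial>N)) \<longlonglongrightarrow> 0"
    by (rule Lim_null_comparison[rotated]) (use bound2 in auto)
  then show "(\<lambda>j. \<integral>x. \<Phi> x * (f j x)\<^sup>2 \<partial>N) \<longlonglongrightarrow> (\<integral>x. \<Phi> x * (g x)\<^sup>2 \<partial>N)"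
    by (simp add: LIM_zero_iff)
qed

text \<open>Polarization with the constant 1, \<open>2 * \<Phi> * h = \<Phi> * (h + 1)\<^sup>2 -
  \<Phi> * h\<^sup>2 - \<Phi>\<close>, reduces the linear functional to the quadratic case. The
  constant is square integrable because the measure is finite.\<close>

lemma (in finite_measure) L2_limit_weighted:
  assumes fj: "\<And>j::nat. sq_int M (f j)" and [measurable]: "g \<in> borel_measurable M" "\<Phi> \<in> borel_measurable M"
    and lim: "(\<lambda>j. \<integral>\<^sup>+x. ennreal ((g x - f j x)\<^sup>2) \<partial>M) \<longlonglongrightarrow> 0"
    and C: "\<And>x. x \<in> space M \<Longrightarrow> \<bar>\<Phi> x\<bar> \<le> C"
  shows "(\<lambda>j. \<integral>x. \<Phi> x * f j x \<partial>M) \<longlonglongrightarrow> (\<integral>x. \<Phi> x * g x \<partial>M)"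
proof -
  have one: "sq_int M (\<lambda>_. 1)" by (simp add: sq_int_def)
  have wi: "integrable M (\<lambda>x. \<Phi> x * (h x)\<^sup>2)" if "sq_int M h" for h
    by (rule integrable_weighted_square[OF that _ C]) auto
  have pol: "(\<integral>x. \<Phi> x * h x \<partial>M) = ((\<integral>x. \<Phi> x * (h x + 1)\<^sup>2 \<partial>M) - (\<integral>x. \<Phi> x * (h x)\<^sup>2 \<partial>M) - (\<integral>x. \<Phi> x * 1\<^sup>2 \<partial>M)) / 2"
    if h: "sq_int M h" for h
  proof -
    have "(\<integral>x. \<Phi> x * (h x + 1)\<^sup>2 \<partial>M) - (\<integral>x. \<Phi> x * (h x)\<^sup>2 \<partial>M) - (\<integral>x. \<Phi> x * 1\<^sup>2 \<partial>M)
       = (\<integral>x. \<Phi> x * (h x + 1)\<^sup>2 - \<Phi> x * (h x)\<^sup>2 - \<Phi> x * 1\<^sup>2 \<partial>M)"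
      using wi[OF sq_int_add[OF h one]] wi[OF h] wi[OF one] by simp
    also have "\<dots> = (\<integral>x. 2 * (\<Phi> x * h x) \<partial>M)"
      by (simp add: power2_eq_square algebra_simps)
    finally show ?thesis by simp
  qed
  have g: "sq_int M g" by (rule L2_limit_weighted_square(1)[OF fj _ _ lim C]) auto
  have l1: "(\<lambda>j. \<integral>x. \<Phi> x * (f j x)\<^sup>2 \<partial>M) \<longlonglongrightarrow> (\<integral>x. \<Phi> x * (g x)\<^sup>2 \<partial>M)"
    by (rule L2_limit_weighted_square(2)[OF fj _ _ lim C]) auto
  have l2: "(\<lambda>j. \<integral>x. \<Phi> x * (f j x + 1)\<^sup>2 \<partial>M) \<longlonglongrightarrow> (\<integral>x. \<Phi> x * (g x + 1)\<^sup>2 \<partial>M)"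
    by (rule L2_limit_weighted_square(2)[OF sq_int_add[OF fj one] _ _ _ C]) (use lim in auto)
  show ?thesis unfolding pol[OF fj] pol[OF g] by (intro tendsto_intros l1 l2) simp
qed

section \<open>Increments of Brownian motion\<close>

text \<open>One Brownian motion whose increments are independent of the past. The driver of
  \<open>Y\<close> and each single driver of the particle system are instances, so the stochastic
  calculus below is one-dimensional throughout; the particles interact through their drifts.\<close>

locale wiener =
  fixes M :: "'w measure" and F :: "real \<Rightarrow> 'w measure" and B :: "real \<Rightarrow> 'w \<Rightarrow> real"
  assumes filtered: "filtered_prob_space M F"
    and B_adapted_continuous: "adapted_continuous M F B"
    and increment_distributed: "\<And>s t. 0 \<le> s \<Longrightarrow> s < t \<Longrightarrow>
      distributed M lborel (\<lambda>\<omega>. B t \<omega> - B s \<omega>) (normal_density 0 (sqrt (t - s)))"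
    and past_indep: "\<And>s t a A. 0 \<le> s \<Longrightarrow> s < t \<Longrightarrow> a \<in> sets (F s) \<Longrightarrow> A \<in> sets borel \<Longrightarrow>
      measure M (a \<inter> ((\<lambda>\<omega>. B t \<omega> - B s \<omega>) -` A \<inter> space M))
        = measure M a * measure M ((\<lambda>\<omega>. B t \<omega> - B s \<omega>) -` A \<inter> space M)"
begin

sublocale prob_space M
  using filtered by (simp add: filtered_prob_space_def)

lemma space_F: "space (F t) = space M" and sets_F_mono: "s \<le> t \<Longrightarrow> sets (F s) \<subseteq> sets (F t)"
  and sub: "subalgebra M (F t)"
  using filtered by (auto simp: filtered_prob_space_def filtration_def)

lemma measurable_F_mono: "f \<in> borel_measurable (F s) \<Longrightarrow> s \<le> t \<Longrightarrow> f \<in> borel_measurable (F t)"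
  using sets_F_mono[of s t] space_F by (auto simp: measurable_def)

lemma measurable_F: "f \<in> borel_measurable (F s) \<Longrightarrow> f \<in> borel_measurable M"
  using measurable_from_subalg[OF sub] .

lemma B_adapted: "0 \<le> t \<Longrightarrow> B t \<in> borel_measurable (F t)"
  using B_adapted_continuous by (auto simp: adapted_continuous_def)

lemma B_measurable [measurable]: "0 \<le> t \<Longrightarrow> B t \<in> borel_measurable M"
  using B_adapted measurable_F by blast

text \<open>The preimages under the increment already form a sigma-algebra, which
  \<open>past_indep\<close> makes independent of \<open>F s\<close>; the sigma-algebras generated by
  \<open>X\<close> and by a function of the increment are contained in these two.\<close>

lemma increment_indep:
  assumes st: "0 \<le> s" "s < t" and X: "X \<in> borel_measurable (F s)"
    and g: "g \<in> borel_measurable borel"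
  shows "indep_var borel X borel (\<lambda>\<omega>. g (B t \<omega> - B s \<omega>) :: real)"
proof -
  let ?D = "\<lambda>\<omega>. B t \<omega> - B s \<omega>"
  define E where "E = {?D -` A \<inter> space M | A. A \<in> sets borel}"
  have D: "?D \<in> borel_measurable M"
    using st by (intro borel_measurable_diff B_measurable) auto
  have "indep_set (sets (F s)) E"
  proof (rule indep_setI)
    show "sets (F s) \<subseteq> events" using sub by (auto simp: subalgebra_def)
    show "E \<subseteq> events" using D by (auto simp: E_def)
    fix a b assume a: "a \<in> sets (F s)" and b: "b \<in> E"
    from b obtain A where "A \<in> sets borel" "b = ?D -` A \<inter> space M" by (auto simp: E_def)
    then show "prob (a \<inter> b) = prob a * prob b" using past_indep[OF st a] by simp
  qed
  then have "indep_set (sigma_sets (space M) {X -` A \<inter> space M | A. A \<in> sets borel})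
      (sigma_sets (space M) {(\<lambda>\<omega>. g (?D \<omega>)) -` A \<inter> space M | A. A \<in> sets borel})"
    unfolding indep_set_def
  proof (rule indep_sets_mono_sets)
    fix k :: bool
    have X1: "sigma_sets (space M) {X -` A \<inter> space M | A. A \<in> sets borel} \<subseteq> sets (F s)"
      unfolding space_F[of s, symmetric] using X by (intro sets.sigma_sets_subset) (auto simp: measurable_sets)
    have "E = sets (vimage_algebra (space M) ?D borel)"
      unfolding E_def by (rule sets_vimage_algebra2 [symmetric]) auto
    then have *: "sigma_sets (space M) E = E"
      using sets.sigma_sets_eq[of "vimage_algebra (space M) ?D borel"] by simp
    have gE: "{(\<lambda>\<omega>. g (?D \<omega>)) -` A \<inter> space M | A. A \<in> sets borel} \<subseteq> E"
    proof safe
      fix A :: "real set" assume "A \<in> sets borel"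
      then have "g -` A \<in> sets borel" using g measurable_sets[of g borel borel A] by simp
      then show "(\<lambda>\<omega>. g (?D \<omega>)) -` A \<inter> space M \<in> E"
        unfolding E_def by (auto intro!: exI[of _ "g -` A"])
    qed
    have "sigma_sets (space M) {(\<lambda>\<omega>. g (?D \<omega>)) -` A \<inter> space M | A. A \<in> sets borel} \<subseteq> E"
      using sigma_sets_mono'[OF gE, of "space M"] unfolding * .
    then show "case_bool (sigma_sets (space M) {X -` A \<inter> space M | A. A \<in> sets borel})
        (sigma_sets (space M) {(\<lambda>\<omega>. g (?D \<omega>)) -` A \<inter> space M | A. A \<in> sets borel}) k
        \<subseteq> case_bool (sets (F s)) E k"
      using X1 by (cases k) auto
  qed
  moreover have "X \<in> borel_measurable M" using X by (rule measurable_F)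
  moreover have "(\<lambda>\<omega>. g (?D \<omega>)) \<in> borel_measurable M" using g D by measurable
  ultimately show ?thesis by (simp add: indep_var_eq)
qed

lemma increment_moments:
  assumes "0 \<le> s" "s < t"
  shows "sq_int M (\<lambda>\<omega>. B t \<omega> - B s \<omega>)" "expectation (\<lambda>\<omega>. B t \<omega> - B s \<omega>) = 0"
    "expectation (\<lambda>\<omega>. (B t \<omega> - B s \<omega>)\<^sup>2) = t - s"
proof -
  note D = increment_distributed[OF assms]
  have sg: "0 < sqrt (t - s)" using assms by simp
  have "integrable lborel (\<lambda>x. normal_density 0 (sqrt (t - s)) x * (x - 0) ^ 2)"
    using sg by (rule integrable_normal_moment)
  then have "integrable M (\<lambda>\<omega>. (B t \<omega> - B s \<omega>)\<^sup>2)"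
    using distributed_integrable[OF D, of "\<lambda>x. x\<^sup>2"] by simp
  then show "sq_int M (\<lambda>\<omega>. B t \<omega> - B s \<omega>)"
    using assms by (auto simp: sq_int_def)
  show "expectation (\<lambda>\<omega>. B t \<omega> - B s \<omega>) = 0"
    using distributed_integral[OF D, of "\<lambda>x. x"] integral_normal_moment_nz_1[OF sg, of 0] by simp
  show "expectation (\<lambda>\<omega>. (B t \<omega> - B s \<omega>)\<^sup>2) = t - s"
    using distributed_integral[OF D, of "\<lambda>x. x\<^sup>2"] integral_normal_moment_even[OF sg, of 0 1] assms
    by (simp add: power2_eq_square)
qed

lemma increment_mean_zero:
  assumes "0 \<le> s" "s \<le> t" "X \<in> borel_measurable (F s)" "integrable M X"
  shows "expectation (\<lambda>\<omega>. X \<omega> * (B t \<omega> - B s \<omega>)) = 0"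
proof (cases "s = t")
  case False
  then have st: "0 \<le> s" "s < t" using assms by auto
  have "integrable M (\<lambda>\<omega>. B t \<omega> - B s \<omega>)"
    using square_integrable_imp_integrable increment_moments(1)[OF st] by (auto simp: sq_int_def)
  then show ?thesis
    using indep_var_lebesgue_integral[OF increment_indep[OF st assms(3), of "\<lambda>x. x"]] assms(4)
    by (simp add: increment_moments(2)[OF st])
qed simp

lemma increment_square:
  assumes "0 \<le> s" "s \<le> t" "X \<in> borel_measurable (F s)" "integrable M X"
  shows "expectation (\<lambda>\<omega>. X \<omega> * (B t \<omega> - B s \<omega>)\<^sup>2) = expectation X * (t - s)"
proof (cases "s = t")
  case False
  then have st: "0 \<le> s" "s < t" using assms by auto
  have "integrable M (\<lambda>\<omega>. (B t \<omega> - B s \<omega>)\<^sup>2)"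
    using increment_moments(1)[OF st] by (auto simp: sq_int_def)
  then show ?thesis
    using indep_var_lebesgue_integral[OF increment_indep[OF st assms(3), of "\<lambda>x. x\<^sup>2"]] assms(4)
    by (simp add: increment_moments(3)[OF st])
qed simp

lemma increment_sq_int: "0 \<le> s \<Longrightarrow> s \<le> t \<Longrightarrow> sq_int M (\<lambda>\<omega>. B t \<omega> - B s \<omega>)"
  using increment_moments(1)[of s t] sq_int_zero by (cases "s = t") auto

text \<open>An integrand \<open>\<eta>\<close> on the interval from \<open>u\<close> to
  \<open>v\<close>. Measurability at time \<open>u\<close> is asked only of nondegenerate intervals:
  clipping to \<open>[s, t]\<close> collapses a piece lying outside to a point, where
  \<open>\<eta>\<close> may belong to a later sigma-algebra.\<close>

definition block :: "real \<Rightarrow> real \<Rightarrow> ('w \<Rightarrow> real) \<Rightarrow> bool" where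
  "block u v \<eta> \<longleftrightarrow> 0 \<le> u \<and> u \<le> v \<and> \<eta> \<in> borel_measurable M \<and>
     (u < v \<longrightarrow> \<eta> \<in> borel_measurable (F u)) \<and> (\<exists>C. \<forall>\<omega>\<in>space M. \<bar>\<eta> \<omega>\<bar> \<le> C)"

lemma block_sq_int:
  assumes "block u v \<eta>" shows "sq_int M (\<lambda>\<omega>. \<eta> \<omega> * (B v \<omega> - B u \<omega>))"
proof -
  obtain C where "\<forall>\<omega>\<in>space M. \<bar>\<eta> \<omega>\<bar> \<le> C" using assms by (auto simp: block_def)
  then show ?thesis
    using assms by (intro sq_int_bounded_mult[OF increment_sq_int, where C = C]) (auto simp: block_def)
qed

text \<open>Overlapping intervals are cut at \<open>u'\<close> and at \<open>w\<close>, the smaller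
  of the right ends. The common piece \<open>D2\<close> times itself contributes its length; in the
  other products either the later increment is independent of all remaining factors and has mean
  zero, or one of the leftovers \<open>D3\<close> and \<open>D4\<close> is identically zero. For
  disjoint intervals the whole later increment has mean zero.\<close>

lemma block_covariance_ordered:
  assumes b: "block u v \<eta>" "block u' v' \<eta>'" and le: "u \<le> u'"
  shows "expectation (\<lambda>\<omega>. (\<eta> \<omega> * (B v \<omega> - B u \<omega>)) * (\<eta>' \<omega> * (B v' \<omega> - B u' \<omega>))) =
     expectation (\<lambda>\<omega>. \<eta> \<omega> * \<eta>' \<omega>) * max 0 (min v v' - max u u')"
proof (cases "u = v \<or> u' = v'")
  case True
  then show ?thesis using b le by (auto simp: block_def max_def min_def)
next
  case False
  then have uv: "0 \<le> u" "u < v" "u' < v'" and \<eta>: "\<eta> \<in> borel_measurable (F u)" "\<eta>' \<in> borel_measurable (F u')"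
    using b by (auto simp: block_def)
  obtain C where C: "\<And>\<omega>. \<omega>\<in>space M \<Longrightarrow> \<bar>\<eta> \<omega>\<bar> \<le> C" using b by (auto simp: block_def)
  obtain C' where C': "\<And>\<omega>. \<omega>\<in>space M \<Longrightarrow> \<bar>\<eta>' \<omega>\<bar> \<le> C'" using b by (auto simp: block_def)
  note \<eta>M = measurable_F[OF \<eta>(1)] measurable_F[OF \<eta>(2)]
  have s\<eta>: "sq_int M \<eta>" "sq_int M \<eta>'"
    by (rule sq_int_bounded[OF \<eta>M(1) C] sq_int_bounded[OF \<eta>M(2) C'], assumption)+
  note mF = measurable_F_mono B_adapted[THEN measurable_F_mono]
  show ?thesis
  proof (cases "v \<le> u'")
    case True
    have "expectation (\<lambda>\<omega>. ((\<eta> \<omega> * (B v \<omega> - B u \<omega>)) * \<eta>' \<omega>) * (B v' \<omega> - B u' \<omega>)) = 0"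
    proof (rule increment_mean_zero)
      show "(\<lambda>\<omega>. \<eta> \<omega> * (B v \<omega> - B u \<omega>) * \<eta>' \<omega>) \<in> borel_measurable (F u')"
        using uv le True by (intro borel_measurable_times borel_measurable_diff \<eta>(2) mF(1)[OF \<eta>(1)] mF(2)) auto
    qed (use uv le in \<open>auto intro!: sq_int_mult[OF block_sq_int[OF b(1)] s\<eta>(2)]\<close>)
    then show ?thesis using uv True by (simp add: mult.assoc)
  next
    case False
    define w where "w = min v v'"
    have w: "u' < w" "w \<le> v" "w \<le> v'" "w = v \<or> w = v'" "0 \<le> u'" using False uv le by (auto simp: w_def)
    define D1 where "D1 \<omega> = B u' \<omega> - B u \<omega>" for \<omega>
    define D2 where "D2 \<omega> = B w \<omega> - B u' \<omega>" for \<omega>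
    define D3 where "D3 \<omega> = B v \<omega> - B w \<omega>" for \<omega>
    define D4 where "D4 \<omega> = B v' \<omega> - B w \<omega>" for \<omega>
    have D34: "D3 = (\<lambda>_. 0) \<or> D4 = (\<lambda>_. 0)" using w by (auto simp: D3_def D4_def fun_eq_iff)
    have s: "sq_int M D1" "sq_int M D2" "sq_int M D3" "sq_int M D4"
      unfolding D1_def D2_def D3_def D4_def using w uv le by (auto intro!: increment_sq_int)
    have s1: "sq_int M (\<lambda>\<omega>. \<eta> \<omega> * D \<omega>)" and s2: "sq_int M (\<lambda>\<omega>. \<eta>' \<omega> * D \<omega>)" if "sq_int M D" for D
      by (rule sq_int_bounded_mult[OF that \<eta>M(1) C] sq_int_bounded_mult[OF that \<eta>M(2) C'], assumption)+
    have i: "integrable M (\<lambda>\<omega>. (\<eta> \<omega> * D \<omega>) * (\<eta>' \<omega> * D' \<omega>))" if "sq_int M D" "sq_int M D'" for D D'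
      using that by (intro sq_int_mult s1 s2)
    have m1: "D1 \<in> borel_measurable (F u')" and m2: "D2 \<in> borel_measurable (F w)"
      and m1': "D1 \<in> borel_measurable (F w)"
      and e1: "\<eta> \<in> borel_measurable (F u')" and e2: "\<eta> \<in> borel_measurable (F w)" "\<eta>' \<in> borel_measurable (F w)"
      unfolding D1_def D2_def using uv w le
      by (intro borel_measurable_diff mF(2) mF(1)[OF \<eta>(1)] mF(1)[OF \<eta>(2)]; simp)+
    have z1: "expectation (\<lambda>\<omega>. (\<eta> \<omega> * D1 \<omega>) * (\<eta>' \<omega> * D2 \<omega>)) = 0"
    proof -
      have "expectation (\<lambda>\<omega>. ((\<eta> \<omega> * D1 \<omega>) * \<eta>' \<omega>) * D2 \<omega>) = 0"
        unfolding D2_def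
        by (rule increment_mean_zero[OF _ _ borel_measurable_times[OF borel_measurable_times[OF e1 m1] \<eta>(2)]
            sq_int_mult[OF s1[OF s(1)] s\<eta>(2)]]) (use w in auto)
      then show ?thesis by (simp add: mult.assoc)
    qed
    have z2: "expectation (\<lambda>\<omega>. (\<eta> \<omega> * D \<omega>) * (\<eta>' \<omega> * D4 \<omega>)) = 0"
      if "D \<in> borel_measurable (F w)" "sq_int M D" for D
    proof -
      have "expectation (\<lambda>\<omega>. ((\<eta> \<omega> * D \<omega>) * \<eta>' \<omega>) * D4 \<omega>) = 0"
        unfolding D4_def
        by (rule increment_mean_zero[OF _ _ borel_measurable_times[OF borel_measurable_times[OF e2(1) that(1)] e2(2)]
            sq_int_mult[OF s1[OF that(2)] s\<eta>(2)]]) (use w in auto)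
      then show ?thesis by (simp add: mult.assoc)
    qed
    have z3: "expectation (\<lambda>\<omega>. (\<eta> \<omega> * D3 \<omega>) * (\<eta>' \<omega> * D2 \<omega>)) = 0"
    proof -
      have "expectation (\<lambda>\<omega>. (\<eta> \<omega> * (\<eta>' \<omega> * D2 \<omega>)) * D3 \<omega>) = 0"
        unfolding D3_def
        by (rule increment_mean_zero[OF _ _ borel_measurable_times[OF e2(1) borel_measurable_times[OF e2(2) m2]]
            sq_int_mult[OF s\<eta>(1) s2[OF s(2)]]]) (use w in auto)
      then show ?thesis by (simp add: mult_ac)
    qed
    have z4: "expectation (\<lambda>\<omega>. (\<eta> \<omega> * D2 \<omega>) * (\<eta>' \<omega> * D2 \<omega>)) = expectation (\<lambda>\<omega>. \<eta> \<omega> * \<eta>' \<omega>) * (w - u')"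
    proof -
      have "expectation (\<lambda>\<omega>. (\<eta> \<omega> * \<eta>' \<omega>) * (D2 \<omega>)\<^sup>2) = expectation (\<lambda>\<omega>. \<eta> \<omega> * \<eta>' \<omega>) * (w - u')"
        unfolding D2_def
        by (rule increment_square[OF _ _ borel_measurable_times[OF e1 \<eta>(2)] sq_int_mult[OF s\<eta>]])
           (use w in auto)
      then show ?thesis by (simp add: power2_eq_square mult_ac)
    qed
    have z5: "expectation (\<lambda>\<omega>. (\<eta> \<omega> * D3 \<omega>) * (\<eta>' \<omega> * D4 \<omega>)) = 0"
      using D34 by auto
    have split: "B v \<omega> - B u \<omega> = D1 \<omega> + D2 \<omega> + D3 \<omega>" "B v' \<omega> - B u' \<omega> = D2 \<omega> + D4 \<omega>" for \<omega>
      by (simp_all add: D1_def D2_def D3_def D4_def)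
    have expand: "(h * (x1 + x2 + x3)) * (h' * (x2 + x4)) = (h * x1) * (h' * x2) + (h * x1) * (h' * x4)
       + (h * x2) * (h' * x2) + (h * x2) * (h' * x4) + (h * x3) * (h' * x2) + (h * x3) * (h' * x4)"
      for h h' x1 x2 x3 x4 :: real
      by algebra
    have "expectation (\<lambda>\<omega>. (\<eta> \<omega> * (B v \<omega> - B u \<omega>)) * (\<eta>' \<omega> * (B v' \<omega> - B u' \<omega>))) =
      expectation (\<lambda>\<omega>. (\<eta> \<omega> * D1 \<omega>) * (\<eta>' \<omega> * D2 \<omega>) + (\<eta> \<omega> * D1 \<omega>) * (\<eta>' \<omega> * D4 \<omega>)
         + (\<eta> \<omega> * D2 \<omega>) * (\<eta>' \<omega> * D2 \<omega>) + (\<eta> \<omega> * D2 \<omega>) * (\<eta>' \<omega> * D4 \<omega>)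
         + (\<eta> \<omega> * D3 \<omega>) * (\<eta>' \<omega> * D2 \<omega>) + (\<eta> \<omega> * D3 \<omega>) * (\<eta>' \<omega> * D4 \<omega>))"
      unfolding split expand ..
    also have "\<dots> = expectation (\<lambda>\<omega>. \<eta> \<omega> * \<eta>' \<omega>) * (w - u')"
      by (simp add: i s z1 z2[OF m1' s(1)] z2[OF m2 s(2)] z3 z4 z5)
    finally show ?thesis using w le by (simp add: w_def)
  qed
qed

lemma block_covariance:
  assumes b: "block u v \<eta>" "block u' v' \<eta>'"
  shows "expectation (\<lambda>\<omega>. (\<eta> \<omega> * (B v \<omega> - B u \<omega>)) * (\<eta>' \<omega> * (B v' \<omega> - B u' \<omega>))) =
     expectation (\<lambda>\<omega>. \<eta> \<omega> * \<eta>' \<omega>) * max 0 (min v v' - max u u')"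
  using block_covariance_ordered[OF b] block_covariance_ordered[OF b(2,1)]
  by (cases "u \<le> u'") (simp_all add: mult.commute min.commute max.commute)

end

text \<open>Joint independence of the past and all increments is restricted to the two-element
  family of the past and component \<open>i\<close>.\<close>

lemma wiener_component:
  assumes filt: "filtered_prob_space M F" and bm: "brownian_motions M F I B" and i: "i \<in> I"
  shows "wiener M F (B i)"
proof
  interpret prob_space M using filt by (simp add: filtered_prob_space_def)
  show "filtered_prob_space M F" by fact
  show "adapted_continuous M F (B i)" using bm i by (simp add: brownian_motions_def)
  fix s t :: real assume st: "0 \<le> s" "s < t"
  show "distributed M lborel (\<lambda>\<omega>. B i t \<omega> - B i s \<omega>) (normal_density 0 (sqrt (t - s)))"
    using bm i st by (simp add: brownian_motions_def)
  fix a A assume a: "a \<in> sets (F s)" and A: "A \<in> sets (borel :: real measure)"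
  let ?b = "(\<lambda>\<omega>. B i t \<omega> - B i s \<omega>) -` A \<inter> space M"
  have I: "indep_sets (\<lambda>k. case k of None \<Rightarrow> sets (F s)
      | Some i \<Rightarrow> {(\<lambda>\<omega>. B i t \<omega> - B i s \<omega>) -` A \<inter> space M | A. A \<in> sets borel}) (insert None (Some ` I))"
    using bm st by (simp add: brownian_motions_def)
  have "prob (\<Inter>j\<in>{None, Some i}. case j of None \<Rightarrow> a | Some _ \<Rightarrow> ?b)
      = (\<Prod>j\<in>{None, Some i}. prob (case j of None \<Rightarrow> a | Some _ \<Rightarrow> ?b))"
    by (rule indep_setsD[OF I]) (use i a A in auto)
  then show "prob (a \<inter> ?b) = prob a * prob ?b" by simp
qed

section \<open>Ito isometry\<close>

definition clip :: "real \<Rightarrow> real \<Rightarrow> real \<Rightarrow> real" where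
  "clip s t r = max s (min r t)"

lemma overlap_integral:
  assumes "s \<le> t" "u \<le> v" "u' \<le> v'"
  shows "has_bochner_integral lborel (\<lambda>r. indicator {s<..t} r * (indicator {u<..v} r * indicator {u'<..v'} r) :: real)
     (max 0 (min (clip s t v) (clip s t v') - max (clip s t u) (clip s t u')))"
proof -
  define l where "l = max s (max u u')"
  define h where "h = min t (min v v')"
  have e: "(\<lambda>r. indicator {s<..t} r * (indicator {u<..v} r * indicator {u'<..v'} r) :: real) = indicator {l<..h}"
    by (auto simp: fun_eq_iff indicator_def l_def h_def)
  have "max 0 (min (clip s t v) (clip s t v') - max (clip s t u) (clip s t u')) = max 0 (h - l)"
    using assms unfolding l_def h_def clip_def by (auto simp: max_def min_def)
  also have "\<dots> = measure lborel {l<..h}" by (cases "l \<le> h") auto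
  finally have m: "max 0 (min (clip s t v) (clip s t v') - max (clip s t u) (clip s t u')) = measure lborel {l<..h}" .
  show ?thesis unfolding e m
  proof (rule has_bochner_integral_real_indicator)
    have "emeasure lborel {l<..h} \<le> emeasure lborel {l..h}" by (intro emeasure_mono) auto
    also have "\<dots> < \<infinity>" by (rule emeasure_compact_finite) simp
    finally show "emeasure lborel {l<..h} < \<infinity>" .
  qed simp
qed

lemma simple_process_measurable:
  assumes "\<And>k. k < n \<Longrightarrow> \<eta> k \<in> borel_measurable M"
  shows "(\<lambda>(\<omega>, r). simple_process n \<tau> \<eta> r \<omega>) \<in> borel_measurable (M \<Otimes>\<^sub>M lborel)"
proof -
  have "(\<lambda>x. \<eta> k (fst x) * indicator {\<tau> k<..\<tau> (Suc k)} (snd x)) \<in> borel_measurable (M \<Otimes>\<^sub>M lborel)" if "k < n" for k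
    using assms[OF that] by measurable
  then show ?thesis unfolding simple_process_def split_def by (intro borel_measurable_sum) auto
qed

lemma simple_process_bounded:
  assumes "simple_data M F n \<tau> \<eta>"
  shows "\<exists>C. \<forall>\<omega>\<in>space M. \<forall>r. \<bar>simple_process n \<tau> \<eta> r \<omega>\<bar> \<le> C"
proof -
  have "\<forall>k<n. \<exists>C. \<forall>\<omega>\<in>space M. \<bar>\<eta> k \<omega>\<bar> \<le> C"
    using assms by (auto simp: simple_data_def)
  then obtain C where C: "\<And>k \<omega>. k < n \<Longrightarrow> \<omega> \<in> space M \<Longrightarrow> \<bar>\<eta> k \<omega>\<bar> \<le> C k" by metis
  have "\<bar>simple_process n \<tau> \<eta> r \<omega>\<bar> \<le> (\<Sum>k<n. C k)" if "\<omega> \<in> space M" for r \<omega>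
    unfolding simple_process_def
    by (rule order_trans[OF sum_abs sum_mono]) (use C[OF _ that] in \<open>auto simp: indicator_def intro: order_trans[OF abs_ge_zero]\<close>)
  then show ?thesis by blast
qed

context wiener
begin

lemma simple_data_measurable: "simple_data M F n \<tau> \<eta> \<Longrightarrow> k < n \<Longrightarrow> \<eta> k \<in> borel_measurable M"
  by (auto simp: simple_data_def intro: measurable_F)

text \<open>The \<open>F s\<close>-measurable weight is absorbed into the integrand: a nondegenerate
  clipped interval starts neither before \<open>s\<close> nor before \<open>\<tau> k\<close>, so
  both factors are measurable at its left end.\<close>

lemma simple_data_block:
  assumes D: "simple_data M F n \<tau> \<eta>" and k: "k < n" and st: "0 \<le> s" "s \<le> t"
    and \<phi>: "\<phi> \<in> borel_measurable (F s)" "\<And>\<omega>. \<omega> \<in> space M \<Longrightarrow> \<bar>\<phi> \<omega>\<bar> \<le> C"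
  shows "block (clip s t (\<tau> k)) (clip s t (\<tau> (Suc k))) (\<lambda>\<omega>. \<phi> \<omega> * \<eta> k \<omega>)"
proof -
  have le: "\<tau> k \<le> \<tau> (Suc k)" and \<eta>: "\<eta> k \<in> borel_measurable (F (\<tau> k))"
    using D k by (auto simp: simple_data_def)
  have "\<exists>C. \<forall>\<omega>\<in>space M. \<bar>\<eta> k \<omega>\<bar> \<le> C" using D k unfolding simple_data_def by blast
  then obtain C' where C': "\<And>\<omega>. \<omega> \<in> space M \<Longrightarrow> \<bar>\<eta> k \<omega>\<bar> \<le> C'" by blast
  have "\<bar>\<phi> \<omega> * \<eta> k \<omega>\<bar> \<le> C * C'" if "\<omega> \<in> space M" for \<omega>
    unfolding abs_mult using \<phi>(2)[OF that] C'[OF that] by (intro mult_mono) auto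
  moreover have "(\<lambda>\<omega>. \<phi> \<omega> * \<eta> k \<omega>) \<in> borel_measurable (F (clip s t (\<tau> k)))"
    if "clip s t (\<tau> k) < clip s t (\<tau> (Suc k))"
  proof -
    have "s \<le> clip s t (\<tau> k)" "\<tau> k \<le> clip s t (\<tau> k)"
      using that le st by (auto simp: clip_def max_def min_def split: if_splits)
    then show ?thesis by (intro borel_measurable_times measurable_F_mono[OF \<phi>(1)] measurable_F_mono[OF \<eta>])
  qed
  moreover have "(\<lambda>\<omega>. \<phi> \<omega> * \<eta> k \<omega>) \<in> borel_measurable M"
    by (intro borel_measurable_times measurable_F[OF \<phi>(1)] measurable_F[OF \<eta>])
  moreover have "0 \<le> clip s t (\<tau> k)" "clip s t (\<tau> k) \<le> clip s t (\<tau> (Suc k))"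
    using st le by (auto simp: clip_def)
  ultimately show ?thesis unfolding block_def by blast
qed

lemma simple_integral_increment:
  assumes "0 \<le> s" "s \<le> t"
  shows "simple_integral n \<tau> \<eta> B t \<omega> - simple_integral n \<tau> \<eta> B s \<omega> =
    (\<Sum>k<n. \<eta> k \<omega> * (B (clip s t (\<tau> (Suc k))) \<omega> - B (clip s t (\<tau> k)) \<omega>))"
proof -
  have "B (min r t) \<omega> - B (min r s) \<omega> = B (clip s t r) \<omega> - B s \<omega>" for r
    using assms by (cases "r \<le> s") (auto simp: clip_def min_def max_def)
  then have "B (min r' t) \<omega> - B (min r t) \<omega> - (B (min r' s) \<omega> - B (min r s) \<omega>)
      = B (clip s t r') \<omega> - B (clip s t r) \<omega>" for r r'
    by (smt (verit))
  then show ?thesis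
    unfolding simple_integral_def sum_subtractf [symmetric] right_diff_distrib [symmetric] by simp
qed

lemma simple_increment_sq_int:
  assumes D: "simple_data M F n \<tau> \<eta>" and st: "0 \<le> s" "s \<le> t"
  shows "sq_int M (\<lambda>\<omega>. simple_integral n \<tau> \<eta> B t \<omega> - simple_integral n \<tau> \<eta> B s \<omega>)"
  unfolding simple_integral_increment[OF st]
proof (rule sq_int_sum)
  fix k assume "k \<in> {..<n}"
  then have "block (clip s t (\<tau> k)) (clip s t (\<tau> (Suc k))) (\<lambda>\<omega>. 1 * \<eta> k \<omega>)"
    using D st by (intro simple_data_block[where C = 1]) auto
  from block_sq_int[OF this]
  show "sq_int M (\<lambda>\<omega>. \<eta> k \<omega> * (B (clip s t (\<tau> (Suc k))) \<omega> - B (clip s t (\<tau> k)) \<omega>))" by simp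
qed

lemma simple_increment_mean:
  assumes D: "simple_data M F n \<tau> \<eta>" and st: "0 \<le> s" "s \<le> t"
    and \<phi>: "\<phi> \<in> borel_measurable (F s)" "\<And>\<omega>. \<omega> \<in> space M \<Longrightarrow> \<bar>\<phi> \<omega>\<bar> \<le> C"
  shows "expectation (\<lambda>\<omega>. \<phi> \<omega> * (simple_integral n \<tau> \<eta> B t \<omega> - simple_integral n \<tau> \<eta> B s \<omega>)) = 0"
proof -
  have b: "block (clip s t (\<tau> k)) (clip s t (\<tau> (Suc k))) (\<lambda>\<omega>. \<phi> \<omega> * \<eta> k \<omega>)" if "k < n" for k
    by (rule simple_data_block[OF D that st \<phi>])
  have z: "integrable M (\<lambda>\<omega>. (\<phi> \<omega> * \<eta> k \<omega>) * (B (clip s t (\<tau> (Suc k))) \<omega> - B (clip s t (\<tau> k)) \<omega>))"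
      "expectation (\<lambda>\<omega>. (\<phi> \<omega> * \<eta> k \<omega>) * (B (clip s t (\<tau> (Suc k))) \<omega> - B (clip s t (\<tau> k)) \<omega>)) = 0" if k: "k < n" for k
  proof -
    show i: "integrable M (\<lambda>\<omega>. (\<phi> \<omega> * \<eta> k \<omega>) * (B (clip s t (\<tau> (Suc k))) \<omega> - B (clip s t (\<tau> k)) \<omega>))"
      using block_sq_int[OF b[OF k]] by (auto simp: sq_int_def intro: square_integrable_imp_integrable)
    show "expectation (\<lambda>\<omega>. (\<phi> \<omega> * \<eta> k \<omega>) * (B (clip s t (\<tau> (Suc k))) \<omega> - B (clip s t (\<tau> k)) \<omega>)) = 0"
    proof (cases "clip s t (\<tau> k) = clip s t (\<tau> (Suc k))")
      case False
      obtain K where K: "\<And>\<omega>. \<omega> \<in> space M \<Longrightarrow> \<bar>\<phi> \<omega> * \<eta> k \<omega>\<bar> \<le> K" using b[OF k] unfolding block_def by blast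
      have "integrable M (\<lambda>\<omega>. \<phi> \<omega> * \<eta> k \<omega>)"
        using b[OF k] K by (intro integrable_const_bound[where B = K]) (auto simp: block_def)
      then show ?thesis using b[OF k] False by (intro increment_mean_zero) (auto simp: block_def)
    qed simp
  qed
  have "expectation (\<lambda>\<omega>. \<phi> \<omega> * (simple_integral n \<tau> \<eta> B t \<omega> - simple_integral n \<tau> \<eta> B s \<omega>))
      = expectation (\<lambda>\<omega>. \<Sum>k<n. (\<phi> \<omega> * \<eta> k \<omega>) * (B (clip s t (\<tau> (Suc k))) \<omega> - B (clip s t (\<tau> k)) \<omega>))"
    unfolding simple_integral_increment[OF st] by (simp add: sum_distrib_left mult.assoc)
  also have "\<dots> = 0" using z by (subst Bochner_Integration.integral_sum) auto
  finally show ?thesis .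
qed

text \<open>The bilinear form serves to compare different approximating sequences of one integrand,
  and the weight \<open>\<phi>\<close> makes it an isometry conditional on \<open>F s\<close>. It is
  the covariance of blocks summed over all pairs of pieces, the length of an overlap being the
  integral of the product of two indicators.\<close>

lemma simple_increment_isometry:
  assumes D: "simple_data M F n \<tau> \<eta>" and D': "simple_data M F n' \<tau>' \<eta>'" and st: "0 \<le> s" "s \<le> t"
    and \<phi>: "\<phi> \<in> borel_measurable (F s)" "\<And>\<omega>. \<omega> \<in> space M \<Longrightarrow> \<bar>\<phi> \<omega>\<bar> \<le> C"
  shows "expectation (\<lambda>\<omega>. \<phi> \<omega> * ((simple_integral n \<tau> \<eta> B t \<omega> - simple_integral n \<tau> \<eta> B s \<omega>)
        * (simple_integral n' \<tau>' \<eta>' B t \<omega> - simple_integral n' \<tau>' \<eta>' B s \<omega>)))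
     = expectation (\<lambda>\<omega>. \<phi> \<omega> * (LINT r|lborel. indicator {s<..t} r * (simple_process n \<tau> \<eta> r \<omega> * simple_process n' \<tau>' \<eta>' r \<omega>)))"
proof -
  let ?u = "\<lambda>k. clip s t (\<tau> k)" and ?u' = "\<lambda>l. clip s t (\<tau>' l)"
  define I where "I k l = max 0 (min (?u (Suc k)) (?u' (Suc l)) - max (?u k) (?u' l))" for k l
  have b: "block (?u k) (?u (Suc k)) (\<lambda>\<omega>. \<phi> \<omega> * \<eta> k \<omega>)" if "k < n" for k
    by (rule simple_data_block[OF D that st \<phi>])
  have b': "block (?u' l) (?u' (Suc l)) (\<eta>' l)" if "l < n'" for l
    using simple_data_block[OF D' that st, of "\<lambda>_. 1" 1] by simp
  have cov: "expectation (\<lambda>\<omega>. ((\<phi> \<omega> * \<eta> k \<omega>) * (B (?u (Suc k)) \<omega> - B (?u k) \<omega>)) * (\<eta>' l \<omega> * (B (?u' (Suc l)) \<omega> - B (?u' l) \<omega>)))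
     = expectation (\<lambda>\<omega>. \<phi> \<omega> * \<eta> k \<omega> * \<eta>' l \<omega>) * I k l" if "k < n" "l < n'" for k l
    unfolding I_def by (rule block_covariance[OF b[OF that(1)] b'[OF that(2)]])
  have int: "integrable M (\<lambda>\<omega>. ((\<phi> \<omega> * \<eta> k \<omega>) * (B (?u (Suc k)) \<omega> - B (?u k) \<omega>)) * (\<eta>' l \<omega> * (B (?u' (Suc l)) \<omega> - B (?u' l) \<omega>)))"
    if "k < n" "l < n'" for k l
    by (intro sq_int_mult block_sq_int b b' that)
  have int2: "integrable M (\<lambda>\<omega>. \<phi> \<omega> * \<eta> k \<omega> * \<eta>' l \<omega>)" if kl: "k < n" "l < n'" for k l
  proof -
    have "sq_int M \<eta>" if bl: "block u v \<eta>" for u v \<eta>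
    proof -
      obtain K where "\<And>\<omega>. \<omega> \<in> space M \<Longrightarrow> \<bar>\<eta> \<omega>\<bar> \<le> K" using bl unfolding block_def by blast
      then show ?thesis using bl by (intro sq_int_bounded) (auto simp: block_def)
    qed
    then show ?thesis using b[OF kl(1)] b'[OF kl(2)] by (intro sq_int_mult) auto
  qed
  have lin: "(LINT r|lborel. indicator {s<..t} r * (simple_process n \<tau> \<eta> r \<omega> * simple_process n' \<tau>' \<eta>' r \<omega>))
     = (\<Sum>k<n. \<Sum>l<n'. \<eta> k \<omega> * \<eta>' l \<omega> * I k l)" for \<omega>
  proof -
    have h: "has_bochner_integral lborel (\<lambda>r. indicator {s<..t} r * (indicator {\<tau> k<..\<tau> (Suc k)} r * indicator {\<tau>' l<..\<tau>' (Suc l)} r))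
         (I k l)" if "k < n" "l < n'" for k l
      unfolding I_def using D D' that st by (intro overlap_integral) (auto simp: simple_data_def)
    have "has_bochner_integral lborel (\<lambda>r. \<Sum>k<n. \<Sum>l<n'. (\<eta> k \<omega> * \<eta>' l \<omega>) * (indicator {s<..t} r *
        (indicator {\<tau> k<..\<tau> (Suc k)} r * indicator {\<tau>' l<..\<tau>' (Suc l)} r)))
      (\<Sum>k<n. \<Sum>l<n'. (\<eta> k \<omega> * \<eta>' l \<omega>) * I k l)"
      by (intro has_bochner_integral_sum has_bochner_integral_mult_right h) auto
    moreover have "(\<Sum>k<n. \<Sum>l<n'. (\<eta> k \<omega> * \<eta>' l \<omega>) * (indicator {s<..t} r *
        (indicator {\<tau> k<..\<tau> (Suc k)} r * indicator {\<tau>' l<..\<tau>' (Suc l)} r)))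
       = indicator {s<..t} r * (simple_process n \<tau> \<eta> r \<omega> * simple_process n' \<tau>' \<eta>' r \<omega>)" for r
      unfolding simple_process_def sum_product by (simp add: sum_distrib_left mult_ac)
    ultimately show ?thesis by (simp add: has_bochner_integral_iff)
  qed
  have "expectation (\<lambda>\<omega>. \<phi> \<omega> * ((simple_integral n \<tau> \<eta> B t \<omega> - simple_integral n \<tau> \<eta> B s \<omega>)
        * (simple_integral n' \<tau>' \<eta>' B t \<omega> - simple_integral n' \<tau>' \<eta>' B s \<omega>)))
    = expectation (\<lambda>\<omega>. \<Sum>k<n. \<Sum>l<n'. ((\<phi> \<omega> * \<eta> k \<omega>) * (B (?u (Suc k)) \<omega> - B (?u k) \<omega>)) * (\<eta>' l \<omega> * (B (?u' (Suc l)) \<omega> - B (?u' l) \<omega>)))"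
    unfolding simple_integral_increment[OF st] sum_product by (simp add: sum_distrib_left mult.assoc)
  also have "\<dots> = (\<Sum>k<n. \<Sum>l<n'. expectation (\<lambda>\<omega>. \<phi> \<omega> * \<eta> k \<omega> * \<eta>' l \<omega>) * I k l)"
    using int cov by (subst Bochner_Integration.integral_sum; auto intro!: sum.cong)+
  also have "\<dots> = expectation (\<lambda>\<omega>. \<Sum>k<n. \<Sum>l<n'. (\<phi> \<omega> * \<eta> k \<omega> * \<eta>' l \<omega>) * I k l)"
    using int2 by (subst Bochner_Integration.integral_sum; auto intro!: sum.cong Bochner_Integration.integrable_sum)+
  also have "\<dots> = expectation (\<lambda>\<omega>. \<phi> \<omega> * (LINT r|lborel. indicator {s<..t} r * (simple_process n \<tau> \<eta> r \<omega> * simple_process n' \<tau>' \<eta>' r \<omega>)))"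
    unfolding lin by (simp add: sum_distrib_left mult.assoc)
  finally show ?thesis .
qed

end

section \<open>From simple processes to the Ito integral\<close>

lemma nn_integral_square_triangle:
  assumes [measurable]: "f \<in> borel_measurable N" "g \<in> borel_measurable N" "h \<in> borel_measurable N"
  shows "(\<integral>\<^sup>+x. ennreal ((f x - h x :: real)\<^sup>2) \<partial>N) \<le>
     2 * (\<integral>\<^sup>+x. ennreal ((f x - g x)\<^sup>2) \<partial>N) + 2 * (\<integral>\<^sup>+x. ennreal ((g x - h x)\<^sup>2) \<partial>N)"
proof -
  have "(f x - h x)\<^sup>2 \<le> 2 * (f x - g x)\<^sup>2 + 2 * (g x - h x)\<^sup>2" for x
    using zero_le_power2[of "(f x - g x) - (g x - h x)"] by (simp add: power2_eq_square algebra_simps)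
  then have "(\<integral>\<^sup>+x. ennreal ((f x - h x)\<^sup>2) \<partial>N) \<le> (\<integral>\<^sup>+x. 2 * ennreal ((f x - g x)\<^sup>2) + 2 * ennreal ((g x - h x)\<^sup>2) \<partial>N)"
    by (intro nn_integral_mono)
       (simp add: ennreal_mult' [symmetric] ennreal_plus [symmetric] flip: ennreal_numeral del: ennreal_plus)
  also have "\<dots> = 2 * (\<integral>\<^sup>+x. ennreal ((f x - g x)\<^sup>2) \<partial>N) + 2 * (\<integral>\<^sup>+x. ennreal ((g x - h x)\<^sup>2) \<partial>N)"
    by (simp add: nn_integral_add nn_integral_cmult)
  finally show ?thesis .
qed

lemma L2_limit_triangle:
  fixes f g h :: "nat \<Rightarrow> 'a \<Rightarrow> real"
  assumes [measurable]: "\<And>j. f j \<in> borel_measurable N" "\<And>j. g j \<in> borel_measurable N" "\<And>j. h j \<in> borel_measurable N"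
    and 1: "(\<lambda>j. \<integral>\<^sup>+x. ennreal ((f j x - g j x)\<^sup>2) \<partial>N) \<longlonglongrightarrow> 0"
    and 2: "(\<lambda>j. \<integral>\<^sup>+x. ennreal ((g j x - h j x)\<^sup>2) \<partial>N) \<longlonglongrightarrow> 0"
  shows "(\<lambda>j. \<integral>\<^sup>+x. ennreal ((f j x - h j x)\<^sup>2) \<partial>N) \<longlonglongrightarrow> 0"
proof (rule tendsto_sandwich[OF _ _ tendsto_const])
  show "\<forall>\<^sub>F j in sequentially. (\<integral>\<^sup>+x. ennreal ((f j x - h j x)\<^sup>2) \<partial>N) \<le>
     2 * (\<integral>\<^sup>+x. ennreal ((f j x - g j x)\<^sup>2) \<partial>N) + 2 * (\<integral>\<^sup>+x. ennreal ((g j x - h j x)\<^sup>2) \<partial>N)"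
    by (intro always_eventually allI nn_integral_square_triangle) auto
  have "(\<lambda>j. 2 * (\<integral>\<^sup>+x. ennreal ((f j x - g j x)\<^sup>2) \<partial>N) + 2 * (\<integral>\<^sup>+x. ennreal ((g j x - h j x)\<^sup>2) \<partial>N)) \<longlonglongrightarrow> 2 * 0 + 2 * 0"
    by (intro tendsto_add ennreal_tendsto_cmult 1 2) auto
  then show "(\<lambda>j. 2 * (\<integral>\<^sup>+x. ennreal ((f j x - g j x)\<^sup>2) \<partial>N) + 2 * (\<integral>\<^sup>+x. ennreal ((g j x - h j x)\<^sup>2) \<partial>N)) \<longlonglongrightarrow> 0"
    by simp
qed auto

context wiener
begin

sublocale time: pair_sigma_finite M "lborel :: real measure" ..

lemma sq_int_strip:
  assumes [measurable]: "f \<in> borel_measurable (M \<Otimes>\<^sub>M lborel)"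
    and f: "\<And>\<omega> r. \<omega> \<in> space M \<Longrightarrow> \<bar>f (\<omega>, r)\<bar> \<le> C * indicator {s<..t::real} r"
  shows "sq_int (M \<Otimes>\<^sub>M lborel) f"
proof -
  have "emeasure (M \<Otimes>\<^sub>M lborel) (space M \<times> {s<..t}) = emeasure M (space M) * emeasure lborel {s<..t}"
    by (rule lborel.emeasure_pair_measure_Times) auto
  also have "\<dots> < \<infinity>"
    by (cases "s \<le> t") (auto simp: emeasure_space_1)
  finally have "integrable (M \<Otimes>\<^sub>M lborel) (indicator (space M \<times> {s<..t}) :: _ \<Rightarrow> real)"
    by (intro integrable_real_indicator) auto
  then have i: "integrable (M \<Otimes>\<^sub>M lborel) (\<lambda>x. C\<^sup>2 * indicator (space M \<times> {s<..t}) x)" by simp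
  have "integrable (M \<Otimes>\<^sub>M lborel) (\<lambda>x. (f x)\<^sup>2)"
  proof (rule Bochner_Integration.integrable_bound[OF i])
    have "(f x)\<^sup>2 \<le> C\<^sup>2 * indicator (space M \<times> {s<..t}) x" if xs: "x \<in> space (M \<Otimes>\<^sub>M lborel)" for x
    proof -
      obtain \<omega> r where x: "x = (\<omega>, r)" "\<omega> \<in> space M"
        using xs by (cases x) (auto simp: space_pair_measure)
      then have b: "\<bar>f x\<bar> \<le> C * indicator {s<..t} r" using f by auto
      then have "(f x)\<^sup>2 \<le> (C * indicator {s<..t} r)\<^sup>2"
        by (metis abs_ge_zero abs_le_square_iff abs_of_nonneg order_trans)
      then show ?thesis using x by (auto simp: indicator_def)
    qed
    then show "AE x in M \<Otimes>\<^sub>M lborel. norm ((f x)\<^sup>2) \<le> norm (C\<^sup>2 * indicator (space M \<times> {s<..t}) x)"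
      by (auto intro!: AE_I2)
  qed simp
  then show ?thesis by (simp add: sq_int_def)
qed

text \<open>Simple processes cut off at time \<open>t\<close>, as functions on the product with the
  whole time line, so that mean-square convergence over time and chance is convergence with respect
  to one product measure.\<close>

definition simple_strip :: "real \<Rightarrow> nat \<Rightarrow> (nat \<Rightarrow> real) \<Rightarrow> (nat \<Rightarrow> 'w \<Rightarrow> real) \<Rightarrow> 'w \<times> real \<Rightarrow> real" where
  "simple_strip t n \<tau> \<eta> x = indicator {0<..t} (snd x) * simple_process n \<tau> \<eta> (snd x) (fst x)"

lemma simple_strip_sq_int:
  assumes D: "simple_data M F n \<tau> \<eta>"
  shows "sq_int (M \<Otimes>\<^sub>M lborel) (simple_strip t n \<tau> \<eta>)"
proof -
  have "(\<lambda>(\<omega>, r). simple_process n \<tau> \<eta> r \<omega>) \<in> borel_measurable (M \<Otimes>\<^sub>M lborel)"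
    by (intro simple_process_measurable simple_data_measurable[OF D])
  then have [measurable]: "(\<lambda>x. simple_process n \<tau> \<eta> (snd x) (fst x)) \<in> borel_measurable (M \<Otimes>\<^sub>M lborel)"
    by (simp add: split_def)
  obtain C where "\<And>\<omega> r. \<omega> \<in> space M \<Longrightarrow> \<bar>simple_process n \<tau> \<eta> r \<omega>\<bar> \<le> C"
    using simple_process_bounded[OF D] by blast
  then show ?thesis
    unfolding simple_strip_def by (intro sq_int_strip[where C = C and s = 0 and t = t]) (auto simp: indicator_def)
qed

lemma simple_isometry_strip:
  assumes D: "simple_data M F n \<tau> \<eta>" and D': "simple_data M F n' \<tau>' \<eta>'" and st: "0 \<le> s" "s \<le> t"
    and \<phi>: "\<phi> \<in> borel_measurable (F s)" "\<And>\<omega>. \<omega> \<in> space M \<Longrightarrow> \<bar>\<phi> \<omega>\<bar> \<le> C"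
  shows "expectation (\<lambda>\<omega>. \<phi> \<omega> * ((simple_integral n \<tau> \<eta> B t \<omega> - simple_integral n \<tau> \<eta> B s \<omega>)
        * (simple_integral n' \<tau>' \<eta>' B t \<omega> - simple_integral n' \<tau>' \<eta>' B s \<omega>)))
     = (\<integral>x. \<phi> (fst x) * indicator {s<..t} (snd x) * (simple_strip t n \<tau> \<eta> x * simple_strip t n' \<tau>' \<eta>' x) \<partial>(M \<Otimes>\<^sub>M lborel))"
proof -
  have [measurable]: "\<phi> \<in> borel_measurable M" using \<phi>(1) by (rule measurable_F)
  note s = simple_strip_sq_int[OF D, of t] simple_strip_sq_int[OF D', of t]
  have "sq_int (M \<Otimes>\<^sub>M lborel) (\<lambda>x. \<phi> (fst x) * indicator {s<..t} (snd x) * simple_strip t n \<tau> \<eta> x)"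
    by (intro sq_int_bounded_mult[OF s(1), where C = "\<bar>C\<bar>"])
      (auto simp: space_pair_measure indicator_def intro: order_trans[OF \<phi>(2) abs_ge_self])
  from sq_int_mult[OF this s(2)]
  have i: "integrable (M \<Otimes>\<^sub>M lborel) (\<lambda>x. \<phi> (fst x) * indicator {s<..t} (snd x) * (simple_strip t n \<tau> \<eta> x * simple_strip t n' \<tau>' \<eta>' x))"
    by (simp add: mult.assoc)
  have "expectation (\<lambda>\<omega>. \<phi> \<omega> * (LINT r|lborel. indicator {s<..t} r * (simple_process n \<tau> \<eta> r \<omega> * simple_process n' \<tau>' \<eta>' r \<omega>)))
     = (\<integral>\<omega>. (\<integral>r. \<phi> (fst (\<omega>, r)) * indicator {s<..t} (snd (\<omega>, r)) * (simple_strip t n \<tau> \<eta> (\<omega>, r) * simple_strip t n' \<tau>' \<eta>' (\<omega>, r)) \<partial>lborel) \<partial>M)"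
    unfolding integral_mult_right_zero [symmetric]
    by (intro Bochner_Integration.integral_cong refl) (use st in \<open>auto simp: simple_strip_def indicator_def\<close>)
  also have "\<dots> = (\<integral>x. \<phi> (fst x) * indicator {s<..t} (snd x) * (simple_strip t n \<tau> \<eta> x * simple_strip t n' \<tau>' \<eta>' x) \<partial>(M \<Otimes>\<^sub>M lborel))"
    by (rule time.integral_fst'[OF i])
  finally show ?thesis by (subst simple_increment_isometry[OF D D' st]) (auto intro: \<phi>)
qed

lemma simple_integral_0:
  assumes D: "simple_data M F n \<tau> \<eta>" shows "simple_integral n \<tau> \<eta> B 0 \<omega> = 0"
proof -
  have "0 \<le> \<tau> k" if "k \<le> n" for k
    using that
  proof (induction k)
    case (Suc k) then show ?case using D by (auto simp: simple_data_def intro: order_trans)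
  qed (use D in \<open>auto simp: simple_data_def\<close>)
  then show ?thesis unfolding simple_integral_def by (intro sum.neutral) auto
qed

text \<open>The square is expanded and the bilinear isometry applied to each term, so no common
  refinement of the two partitions has to be formed.\<close>

lemma simple_isometry_nn:
  assumes D: "simple_data M F n \<tau> \<eta>" and D': "simple_data M F n' \<tau>' \<eta>'" and t: "0 \<le> t"
  shows "(\<integral>\<^sup>+\<omega>. ennreal ((simple_integral n \<tau> \<eta> B t \<omega> - simple_integral n' \<tau>' \<eta>' B t \<omega>)\<^sup>2) \<partial>M)
     = (\<integral>\<^sup>+x. ennreal ((simple_strip t n \<tau> \<eta> x - simple_strip t n' \<tau>' \<eta>' x)\<^sup>2) \<partial>(M \<Otimes>\<^sub>M lborel))"
proof -
  let ?I = "simple_integral n \<tau> \<eta> B t" and ?I' = "simple_integral n' \<tau>' \<eta>' B t"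
  let ?U = "simple_strip t n \<tau> \<eta>" and ?U' = "simple_strip t n' \<tau>' \<eta>'"
  have I: "sq_int M ?I" "sq_int M ?I'"
    using simple_increment_sq_int[OF D order_refl t] simple_increment_sq_int[OF D' order_refl t]
    by (auto simp: simple_integral_0[OF D] simple_integral_0[OF D'])
  have U: "sq_int (M \<Otimes>\<^sub>M lborel) ?U" "sq_int (M \<Otimes>\<^sub>M lborel) ?U'"
    by (intro simple_strip_sq_int D D')+
  have iso: "expectation (\<lambda>\<omega>. simple_integral p \<sigma> \<theta> B t \<omega> * simple_integral p' \<sigma>' \<theta>' B t \<omega>)
     = (\<integral>x. simple_strip t p \<sigma> \<theta> x * simple_strip t p' \<sigma>' \<theta>' x \<partial>(M \<Otimes>\<^sub>M lborel))"
    if E: "simple_data M F p \<sigma> \<theta>" "simple_data M F p' \<sigma>' \<theta>'" for p \<sigma> \<theta> p' \<sigma>' \<theta>'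
  proof -
    have "indicator {0<..t} (snd x) * (simple_strip t p \<sigma> \<theta> x * simple_strip t p' \<sigma>' \<theta>' x)
        = simple_strip t p \<sigma> \<theta> x * simple_strip t p' \<sigma>' \<theta>' x" for x
      by (auto simp: simple_strip_def indicator_def)
    then have "(\<integral>x. indicator {0<..t} (snd x) * (simple_strip t p \<sigma> \<theta> x * simple_strip t p' \<sigma>' \<theta>' x) \<partial>(M \<Otimes>\<^sub>M lborel))
       = (\<integral>x. simple_strip t p \<sigma> \<theta> x * simple_strip t p' \<sigma>' \<theta>' x \<partial>(M \<Otimes>\<^sub>M lborel))"
      by (simp only:)
    then show ?thesis
      using simple_isometry_strip[OF E order_refl t, of "\<lambda>_. 1" 1]
      by (simp add: simple_integral_0[OF E(1)] simple_integral_0[OF E(2)])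
  qed
  have "expectation (\<lambda>\<omega>. (?I \<omega> - ?I' \<omega>)\<^sup>2) = expectation (\<lambda>\<omega>. ?I \<omega> * ?I \<omega> - 2 * (?I \<omega> * ?I' \<omega>) + ?I' \<omega> * ?I' \<omega>)"
    by (simp add: power2_eq_square algebra_simps)
  also have "\<dots> = expectation (\<lambda>\<omega>. ?I \<omega> * ?I \<omega>) - 2 * expectation (\<lambda>\<omega>. ?I \<omega> * ?I' \<omega>) + expectation (\<lambda>\<omega>. ?I' \<omega> * ?I' \<omega>)"
    by (simp add: sq_int_mult I)
  also have "\<dots> = (\<integral>x. ?U x * ?U x - 2 * (?U x * ?U' x) + ?U' x * ?U' x \<partial>(M \<Otimes>\<^sub>M lborel))"
    unfolding iso[OF D D] iso[OF D D'] iso[OF D' D'] by (simp add: sq_int_mult U)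
  also have "\<dots> = (\<integral>x. (?U x - ?U' x)\<^sup>2 \<partial>(M \<Otimes>\<^sub>M lborel))"
    by (simp add: power2_eq_square algebra_simps)
  finally have e: "expectation (\<lambda>\<omega>. (?I \<omega> - ?I' \<omega>)\<^sup>2) = (\<integral>x. (?U x - ?U' x)\<^sup>2 \<partial>(M \<Otimes>\<^sub>M lborel))" .
  have "(\<integral>\<^sup>+\<omega>. ennreal ((?I \<omega> - ?I' \<omega>)\<^sup>2) \<partial>M) = ennreal (expectation (\<lambda>\<omega>. (?I \<omega> - ?I' \<omega>)\<^sup>2))"
    using sq_int_diff[OF I] by (intro nn_integral_eq_integral) (auto simp: sq_int_def)
  also have "\<dots> = (\<integral>\<^sup>+x. ennreal ((?U x - ?U' x)\<^sup>2) \<partial>(M \<Otimes>\<^sub>M lborel))"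
    unfolding e using sq_int_diff[OF U] by (intro nn_integral_eq_integral [symmetric]) (auto simp: sq_int_def)
  finally show ?thesis .
qed

text \<open>Each time comes with an approximating sequence of its own, whereas an increment calls
  for one sequence at both times. The sequence for \<open>t\<close> also approximates
  \<open>H\<close> up to time \<open>s\<close>; by the isometry its integrals at \<open>s\<close>
  are asymptotically those of the sequence chosen for \<open>s\<close>, hence converge to
  \<open>J s\<close>.\<close>

lemma ito_approximation:
  assumes ito: "\<And>t. 0 \<le> t \<Longrightarrow> has_ito_integral M F B H t (J t)"
    and Hm: "(\<lambda>x. H (max 0 (snd x)) (fst x)) \<in> borel_measurable (M \<Otimes>\<^sub>M lborel)"
    and st: "0 \<le> s" "s \<le> t"
  obtains n \<tau> \<eta> where "\<And>j::nat. simple_data M F (n j) (\<tau> j) (\<eta> j)"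
    "(\<lambda>j. \<integral>\<^sup>+x. ennreal ((indicator {0<..t} (snd x) * H (max 0 (snd x)) (fst x) - simple_strip t (n j) (\<tau> j) (\<eta> j) x)\<^sup>2) \<partial>(M \<Otimes>\<^sub>M lborel)) \<longlonglongrightarrow> 0"
    "(\<lambda>j. \<integral>\<^sup>+\<omega>. ennreal (((J t \<omega> - J s \<omega>) - (simple_integral (n j) (\<tau> j) (\<eta> j) B t \<omega> - simple_integral (n j) (\<tau> j) (\<eta> j) B s \<omega>))\<^sup>2) \<partial>M) \<longlonglongrightarrow> 0"
proof -
  let ?H = "\<lambda>t x. indicator {0<..t} (snd x) * H (max 0 (snd x)) (fst x)"
  note [measurable] = Hm
  have Jm [measurable]: "J t \<in> borel_measurable M" if "0 \<le> t" for t
    using ito[OF that] by (simp add: has_ito_integral_def)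
  have approx: "\<exists>n \<tau> \<eta>. (\<forall>j::nat. simple_data M F (n j) (\<tau> j) (\<eta> j)) \<and>
     (\<forall>s\<in>{0..t}. (\<lambda>j. \<integral>\<^sup>+x. ennreal ((?H s x - simple_strip s (n j) (\<tau> j) (\<eta> j) x)\<^sup>2) \<partial>(M \<Otimes>\<^sub>M lborel)) \<longlonglongrightarrow> 0) \<and>
     (\<lambda>j. \<integral>\<^sup>+\<omega>. ennreal ((J t \<omega> - simple_integral (n j) (\<tau> j) (\<eta> j) B t \<omega>)\<^sup>2) \<partial>M) \<longlonglongrightarrow> 0"
    if t: "0 \<le> t" for t
  proof -
    obtain n \<tau> \<eta> where D: "\<And>j::nat. simple_data M F (n j) (\<tau> j) (\<eta> j)"
      and lim1: "(\<lambda>j. \<integral>\<^sup>+ \<omega>. (\<integral>\<^sup>+ s\<in>{0..t}. ennreal ((H s \<omega> - simple_process (n j) (\<tau> j) (\<eta> j) s \<omega>)\<^sup>2) \<partial>lborel) \<partial>M) \<longlonglongrightarrow> 0"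
      and lim2: "(\<lambda>j. \<integral>\<^sup>+ \<omega>. ennreal ((J t \<omega> - simple_integral (n j) (\<tau> j) (\<eta> j) B t \<omega>)\<^sup>2) \<partial>M) \<longlonglongrightarrow> 0"
      using ito[OF t] unfolding has_ito_integral_def by blast
    have "(\<lambda>j. \<integral>\<^sup>+x. ennreal ((?H s x - simple_strip s (n j) (\<tau> j) (\<eta> j) x)\<^sup>2) \<partial>(M \<Otimes>\<^sub>M lborel)) \<longlonglongrightarrow> 0"
      if s: "s \<in> {0..t}" for s
    proof (rule tendsto_sandwich[OF _ _ tendsto_const lim1])
      show "\<forall>\<^sub>F j in sequentially. (\<integral>\<^sup>+x. ennreal ((?H s x - simple_strip s (n j) (\<tau> j) (\<eta> j) x)\<^sup>2) \<partial>(M \<Otimes>\<^sub>M lborel))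
        \<le> (\<integral>\<^sup>+ \<omega>. (\<integral>\<^sup>+ s\<in>{0..t}. ennreal ((H s \<omega> - simple_process (n j) (\<tau> j) (\<eta> j) s \<omega>)\<^sup>2) \<partial>lborel) \<partial>M)"
      proof (intro always_eventually allI)
        fix j
        have [measurable]: "simple_strip s (n j) (\<tau> j) (\<eta> j) \<in> borel_measurable (M \<Otimes>\<^sub>M lborel)"
          by (intro sq_int_measurable simple_strip_sq_int D)
        have "(\<integral>\<^sup>+x. ennreal ((?H s x - simple_strip s (n j) (\<tau> j) (\<eta> j) x)\<^sup>2) \<partial>(M \<Otimes>\<^sub>M lborel))
          = (\<integral>\<^sup>+ \<omega>. (\<integral>\<^sup>+ r. ennreal ((?H s (\<omega>, r) - simple_strip s (n j) (\<tau> j) (\<eta> j) (\<omega>, r))\<^sup>2) \<partial>lborel) \<partial>M)"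
          by (rule lborel.nn_integral_fst [symmetric]) measurable
        also have "\<dots> \<le> (\<integral>\<^sup>+ \<omega>. (\<integral>\<^sup>+ s\<in>{0..t}. ennreal ((H s \<omega> - simple_process (n j) (\<tau> j) (\<eta> j) s \<omega>)\<^sup>2) \<partial>lborel) \<partial>M)"
          using s by (intro nn_integral_mono) (auto simp: simple_strip_def indicator_def max_def)
        finally show "(\<integral>\<^sup>+x. ennreal ((?H s x - simple_strip s (n j) (\<tau> j) (\<eta> j) x)\<^sup>2) \<partial>(M \<Otimes>\<^sub>M lborel))
          \<le> (\<integral>\<^sup>+ \<omega>. (\<integral>\<^sup>+ s\<in>{0..t}. ennreal ((H s \<omega> - simple_process (n j) (\<tau> j) (\<eta> j) s \<omega>)\<^sup>2) \<partial>lborel) \<partial>M)" .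
      qed
    qed simp
    then show ?thesis using D lim2 by blast
  qed
  obtain n \<tau> \<eta> where D: "\<And>j::nat. simple_data M F (n j) (\<tau> j) (\<eta> j)"
    and U: "\<And>s. s \<in> {0..t} \<Longrightarrow> (\<lambda>j. \<integral>\<^sup>+x. ennreal ((?H s x - simple_strip s (n j) (\<tau> j) (\<eta> j) x)\<^sup>2) \<partial>(M \<Otimes>\<^sub>M lborel)) \<longlonglongrightarrow> 0"
    and I: "(\<lambda>j. \<integral>\<^sup>+\<omega>. ennreal ((J t \<omega> - simple_integral (n j) (\<tau> j) (\<eta> j) B t \<omega>)\<^sup>2) \<partial>M) \<longlonglongrightarrow> 0"
    using approx[of t] st by (meson order_trans)
  obtain n' \<tau>' \<eta>' where D': "\<And>j::nat. simple_data M F (n' j) (\<tau>' j) (\<eta>' j)"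
    and U': "\<And>r. r \<in> {0..s} \<Longrightarrow> (\<lambda>j. \<integral>\<^sup>+x. ennreal ((?H r x - simple_strip r (n' j) (\<tau>' j) (\<eta>' j) x)\<^sup>2) \<partial>(M \<Otimes>\<^sub>M lborel)) \<longlonglongrightarrow> 0"
    and I': "(\<lambda>j. \<integral>\<^sup>+\<omega>. ennreal ((J s \<omega> - simple_integral (n' j) (\<tau>' j) (\<eta>' j) B s \<omega>)\<^sup>2) \<partial>M) \<longlonglongrightarrow> 0"
    using approx[of s] st by meson
  have t: "0 \<le> t" using st by simp
  have Im: "simple_integral p \<sigma> \<theta> B r \<in> borel_measurable M" if "simple_data M F p \<sigma> \<theta>" "0 \<le> r" for p \<sigma> \<theta> r
    using sq_int_measurable[OF simple_increment_sq_int[OF that(1) order_refl that(2)]]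
    by (simp add: simple_integral_0[OF that(1)])
  have strip_m: "simple_strip r p \<sigma> \<theta> \<in> borel_measurable (M \<Otimes>\<^sub>M lborel)" if "simple_data M F p \<sigma> \<theta>" for p \<sigma> \<theta> r
    by (intro sq_int_measurable simple_strip_sq_int that)
  have "(\<lambda>j. \<integral>\<^sup>+x. ennreal ((simple_strip s (n' j) (\<tau>' j) (\<eta>' j) x - simple_strip s (n j) (\<tau> j) (\<eta> j) x)\<^sup>2) \<partial>(M \<Otimes>\<^sub>M lborel)) \<longlonglongrightarrow> 0"
  proof (rule L2_limit_triangle[where g = "\<lambda>j. ?H s"])
    show "(\<lambda>j. \<integral>\<^sup>+x. ennreal ((simple_strip s (n' j) (\<tau>' j) (\<eta>' j) x - ?H s x)\<^sup>2) \<partial>(M \<Otimes>\<^sub>M lborel)) \<longlonglongrightarrow> 0"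
      using U'[of s] st by (subst power2_commute) auto
    show "(\<lambda>j. \<integral>\<^sup>+x. ennreal ((?H s x - simple_strip s (n j) (\<tau> j) (\<eta> j) x)\<^sup>2) \<partial>(M \<Otimes>\<^sub>M lborel)) \<longlonglongrightarrow> 0"
      using U[of s] st by auto
  qed (auto intro: strip_m D D')
  then have Id: "(\<lambda>j. \<integral>\<^sup>+\<omega>. ennreal ((simple_integral (n' j) (\<tau>' j) (\<eta>' j) B s \<omega> - simple_integral (n j) (\<tau> j) (\<eta> j) B s \<omega>)\<^sup>2) \<partial>M) \<longlonglongrightarrow> 0"
    using st by (subst simple_isometry_nn[OF D' D]) auto
  have Is: "(\<lambda>j. \<integral>\<^sup>+\<omega>. ennreal ((J s \<omega> - simple_integral (n j) (\<tau> j) (\<eta> j) B s \<omega>)\<^sup>2) \<partial>M) \<longlonglongrightarrow> 0"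
    by (rule L2_limit_triangle[OF _ _ _ I' Id]) (use st in \<open>auto intro: Im D D' Jm\<close>)
  have "(\<lambda>j. \<integral>\<^sup>+\<omega>. ennreal (((J t \<omega> - J s \<omega>) - (simple_integral (n j) (\<tau> j) (\<eta> j) B t \<omega> - simple_integral (n j) (\<tau> j) (\<eta> j) B s \<omega>))\<^sup>2) \<partial>M) \<longlonglongrightarrow> 0"
  proof (rule L2_limit_triangle[where g = "\<lambda>j \<omega>. simple_integral (n j) (\<tau> j) (\<eta> j) B t \<omega> - J s \<omega>"])
    show "(\<lambda>j. \<integral>\<^sup>+\<omega>. ennreal (((J t \<omega> - J s \<omega>) - (simple_integral (n j) (\<tau> j) (\<eta> j) B t \<omega> - J s \<omega>))\<^sup>2) \<partial>M) \<longlonglongrightarrow> 0"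
      using I by simp
    have "(\<lambda>j. \<integral>\<^sup>+\<omega>. ennreal ((simple_integral (n j) (\<tau> j) (\<eta> j) B s \<omega> - J s \<omega>)\<^sup>2) \<partial>M) \<longlonglongrightarrow> 0"
      using Is by (subst power2_commute)
    then show "(\<lambda>j. \<integral>\<^sup>+\<omega>. ennreal ((simple_integral (n j) (\<tau> j) (\<eta> j) B t \<omega> - J s \<omega>
          - (simple_integral (n j) (\<tau> j) (\<eta> j) B t \<omega> - simple_integral (n j) (\<tau> j) (\<eta> j) B s \<omega>))\<^sup>2) \<partial>M) \<longlonglongrightarrow> 0"
      by simp
  qed (use st t in \<open>auto intro!: borel_measurable_diff Im D Jm\<close>)
  then show ?thesis using that[OF D U[of t]] t by auto
qed

text \<open>Tested against bounded \<open>F s\<close>-measurable \<open>\<phi>\<close>, these facts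
  say that the increment has conditional mean zero and the conditional second moment of the Ito
  isometry. They pass from simple processes to the limit because weighted integrals with a bounded
  weight converge under mean-square convergence.\<close>

lemma
  assumes ito: "\<And>t. 0 \<le> t \<Longrightarrow> has_ito_integral M F B H t (J t)"
    and Hm: "(\<lambda>x. H (max 0 (snd x)) (fst x)) \<in> borel_measurable (M \<Otimes>\<^sub>M lborel)"
    and st: "0 \<le> s" "s \<le> t"
    and \<phi>: "\<phi> \<in> borel_measurable (F s)" "\<And>\<omega>. \<omega> \<in> space M \<Longrightarrow> \<bar>\<phi> \<omega>\<bar> \<le> C"
  shows ito_increment_sq_int: "sq_int M (\<lambda>\<omega>. J t \<omega> - J s \<omega>)"
    and ito_increment_mean: "expectation (\<lambda>\<omega>. \<phi> \<omega> * (J t \<omega> - J s \<omega>)) = 0"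
    and ito_increment_square: "expectation (\<lambda>\<omega>. \<phi> \<omega> * (J t \<omega> - J s \<omega>)\<^sup>2) =
      expectation (\<lambda>\<omega>. \<phi> \<omega> * (LINT r|lborel. indicator {s<..t} r * (H r \<omega>)\<^sup>2))"
proof -
  let ?H = "\<lambda>x. indicator {0<..t} (snd x) * H (max 0 (snd x)) (fst x)"
  note [measurable] = Hm
  have \<phi>m [measurable]: "\<phi> \<in> borel_measurable M" using \<phi>(1) by (rule measurable_F)
  have Jm [measurable]: "J t \<in> borel_measurable M" if "0 \<le> t" for t
    using ito[OF that] by (simp add: has_ito_integral_def)
  obtain n \<tau> \<eta> where D: "\<And>j::nat. simple_data M F (n j) (\<tau> j) (\<eta> j)"
    and U: "(\<lambda>j. \<integral>\<^sup>+x. ennreal ((?H x - simple_strip t (n j) (\<tau> j) (\<eta> j) x)\<^sup>2) \<partial>(M \<Otimes>\<^sub>M lborel)) \<longlonglongrightarrow> 0"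
    and I: "(\<lambda>j. \<integral>\<^sup>+\<omega>. ennreal (((J t \<omega> - J s \<omega>) - (simple_integral (n j) (\<tau> j) (\<eta> j) B t \<omega> - simple_integral (n j) (\<tau> j) (\<eta> j) B s \<omega>))\<^sup>2) \<partial>M) \<longlonglongrightarrow> 0"
    using ito_approximation[OF ito Hm st] by blast
  have sI: "sq_int M (\<lambda>\<omega>. simple_integral (n j) (\<tau> j) (\<eta> j) B t \<omega> - simple_integral (n j) (\<tau> j) (\<eta> j) B s \<omega>)" for j
    by (intro simple_increment_sq_int D st)
  have Jd: "(\<lambda>\<omega>. J t \<omega> - J s \<omega>) \<in> borel_measurable M" using st by (intro borel_measurable_diff Jm) auto
  show "sq_int M (\<lambda>\<omega>. J t \<omega> - J s \<omega>)"
    by (rule L2_limit_weighted_square(1)[OF sI Jd \<phi>m I \<phi>(2)])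
  have "(\<lambda>j. expectation (\<lambda>\<omega>. \<phi> \<omega> * (simple_integral (n j) (\<tau> j) (\<eta> j) B t \<omega> - simple_integral (n j) (\<tau> j) (\<eta> j) B s \<omega>)))
     \<longlonglongrightarrow> expectation (\<lambda>\<omega>. \<phi> \<omega> * (J t \<omega> - J s \<omega>))"
    by (rule L2_limit_weighted[OF sI Jd \<phi>m I \<phi>(2)])
  moreover have "expectation (\<lambda>\<omega>. \<phi> \<omega> * (simple_integral (n j) (\<tau> j) (\<eta> j) B t \<omega> - simple_integral (n j) (\<tau> j) (\<eta> j) B s \<omega>)) = 0" for j
    by (rule simple_increment_mean[OF D st \<phi>])
  ultimately show "expectation (\<lambda>\<omega>. \<phi> \<omega> * (J t \<omega> - J s \<omega>)) = 0"
    by (simp add: LIMSEQ_const_iff)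
  have l1: "(\<lambda>j. expectation (\<lambda>\<omega>. \<phi> \<omega> * (simple_integral (n j) (\<tau> j) (\<eta> j) B t \<omega> - simple_integral (n j) (\<tau> j) (\<eta> j) B s \<omega>)\<^sup>2))
     \<longlonglongrightarrow> expectation (\<lambda>\<omega>. \<phi> \<omega> * (J t \<omega> - J s \<omega>)\<^sup>2)"
    by (rule L2_limit_weighted_square(2)[OF sI Jd \<phi>m I \<phi>(2)])
  have iso: "expectation (\<lambda>\<omega>. \<phi> \<omega> * (simple_integral (n j) (\<tau> j) (\<eta> j) B t \<omega> - simple_integral (n j) (\<tau> j) (\<eta> j) B s \<omega>)\<^sup>2)
    = (\<integral>x. \<phi> (fst x) * indicator {s<..t} (snd x) * (simple_strip t (n j) (\<tau> j) (\<eta> j) x)\<^sup>2 \<partial>(M \<Otimes>\<^sub>M lborel))" for j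
    unfolding power2_eq_square by (rule simple_isometry_strip[OF D D st \<phi>])
  have Hmm: "?H \<in> borel_measurable (M \<Otimes>\<^sub>M lborel)" by measurable
  have \<Phi>m: "(\<lambda>x. \<phi> (fst x) * indicator {s<..t} (snd x)) \<in> borel_measurable (M \<Otimes>\<^sub>M lborel)" by measurable
  have \<Phi>b: "\<bar>\<phi> (fst x) * indicator {s<..t} (snd x)\<bar> \<le> \<bar>C\<bar>" if "x \<in> space (M \<Otimes>\<^sub>M lborel)" for x
    using \<phi>(2)[of "fst x"] that by (auto simp: space_pair_measure indicator_def)
  have sU: "sq_int (M \<Otimes>\<^sub>M lborel) (simple_strip t (n j) (\<tau> j) (\<eta> j))" for j
    by (intro simple_strip_sq_int D)
  note L = L2_limit_weighted_square[OF sU Hmm \<Phi>m U \<Phi>b]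
  have "sq_int (M \<Otimes>\<^sub>M lborel) (\<lambda>x. \<phi> (fst x) * indicator {s<..t} (snd x) * ?H x)"
    by (rule sq_int_bounded_mult[OF L(1) \<Phi>m \<Phi>b])
  from sq_int_mult[OF this L(1)]
  have i: "integrable (M \<Otimes>\<^sub>M lborel) (\<lambda>x. \<phi> (fst x) * indicator {s<..t} (snd x) * (?H x)\<^sup>2)"
    by (simp add: power2_eq_square mult.assoc)
  have "expectation (\<lambda>\<omega>. \<phi> \<omega> * (J t \<omega> - J s \<omega>)\<^sup>2) = (\<integral>x. \<phi> (fst x) * indicator {s<..t} (snd x) * (?H x)\<^sup>2 \<partial>(M \<Otimes>\<^sub>M lborel))"
    using l1 L(2) unfolding iso by (rule LIMSEQ_unique)
  also have "\<dots> = (\<integral>\<omega>. (\<integral>r. \<phi> (fst (\<omega>, r)) * indicator {s<..t} (snd (\<omega>, r)) * (?H (\<omega>, r))\<^sup>2 \<partial>lborel) \<partial>M)"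
    by (rule time.integral_fst'[OF i, symmetric])
  also have "\<dots> = expectation (\<lambda>\<omega>. \<phi> \<omega> * (LINT r|lborel. indicator {s<..t} r * (H r \<omega>)\<^sup>2))"
    unfolding integral_mult_right_zero [symmetric]
    by (intro Bochner_Integration.integral_cong refl) (use st in \<open>auto simp: indicator_def max_def\<close>)
  finally show "expectation (\<lambda>\<omega>. \<phi> \<omega> * (J t \<omega> - J s \<omega>)\<^sup>2) =
      expectation (\<lambda>\<omega>. \<phi> \<omega> * (LINT r|lborel. indicator {s<..t} r * (H r \<omega>)\<^sup>2))" .
qed

end

section \<open>Riemann sums along a grid\<close>

definition grid :: "real \<Rightarrow> nat \<Rightarrow> nat \<Rightarrow> real" where
  "grid T n k = T * real k / real n"

lemma grid_0 [simp]: "grid T n 0 = 0"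
  and grid_n: "0 < n \<Longrightarrow> grid T n n = T"
  and grid_nonneg: "0 \<le> T \<Longrightarrow> 0 \<le> grid T n k"
  and grid_mono: "0 \<le> T \<Longrightarrow> k \<le> l \<Longrightarrow> grid T n k \<le> grid T n l"
  and grid_le: "0 \<le> T \<Longrightarrow> k \<le> n \<Longrightarrow> grid T n k \<le> T"
  and grid_Suc: "grid T n (Suc k) = grid T n k + T / real n"
proof -
  show "0 \<le> T \<Longrightarrow> k \<le> l \<Longrightarrow> grid T n k \<le> grid T n l"
    unfolding grid_def by (intro divide_right_mono mult_left_mono) auto
  show "0 \<le> T \<Longrightarrow> k \<le> n \<Longrightarrow> grid T n k \<le> T"
    unfolding grid_def by (cases "n = 0") (auto simp: divide_le_eq mult_left_mono)
qed (auto simp: grid_def field_simps add_divide_distrib)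

lemma grid_indicator:
  assumes "0 \<le> T" "0 < n"
  shows "(\<Sum>k<n. indicator {grid T n k<..grid T n (Suc k)} r) = (indicator {0<..T} r :: real)"
proof -
  have "(\<Sum>k<m. indicator {grid T n k<..grid T n (Suc k)} r) = (indicator {0<..grid T n m} r :: real)" for m
  proof (induction m)
    case (Suc m)
    have "grid T n m \<le> grid T n (Suc m)" "0 \<le> grid T n m" using assms by (auto intro: grid_mono grid_nonneg)
    then show ?case by (simp only: sum.lessThan_Suc Suc.IH) (auto simp: indicator_def)
  qed simp
  from this[of n] show ?thesis using assms by (simp add: grid_n)
qed

text \<open>Negative times are folded to \<open>0\<close>: processes are only constrained at times \<open>t \<ge> 0\<close>, and this makes
  them jointly measurable on the whole line.\<close>

definition incr_int :: "(real \<Rightarrow> real) \<Rightarrow> real \<Rightarrow> real \<Rightarrow> real" where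
  "incr_int g s t = (LINT r|lborel. indicator {s<..t} r * g (max 0 r))"

definition path_integrable :: "(real \<Rightarrow> real) \<Rightarrow> real \<Rightarrow> bool" where
  "path_integrable g T \<longleftrightarrow> integrable lborel (\<lambda>r. indicator {0<..T} r * g (max 0 r))"

lemma path_integrable_sub:
  assumes "path_integrable g T" "0 \<le> s" "t \<le> T"
  shows "integrable lborel (\<lambda>r. indicator {s<..t} r * g (max 0 r))"
proof -
  have "integrable lborel (\<lambda>r. indicator {s<..t} r *\<^sub>R (indicator {0<..T} r * g (max 0 r)))"
    using assms(1) unfolding path_integrable_def by (intro integrable_mult_indicator) auto
  moreover have "indicator {s<..t} r *\<^sub>R (indicator {0<..T} r * g (max 0 r)) = indicator {s<..t} r * g (max 0 r)" for r
    using assms by (auto simp: indicator_def)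
  ultimately show ?thesis by (simp only:)
qed

lemma path_integrable_abs:
  "path_integrable g T \<Longrightarrow> path_integrable (\<lambda>r. \<bar>g r\<bar>) T"
  unfolding path_integrable_def by (drule integrable_abs) (simp add: abs_mult)

lemma incr_int_abs_le:
  assumes "path_integrable g T" "0 \<le> s" "t \<le> T"
  shows "\<bar>incr_int g s t\<bar> \<le> incr_int (\<lambda>r. \<bar>g r\<bar>) s t"
  unfolding incr_int_def
  by (rule order_trans[OF integral_abs_bound]) (simp add: abs_mult)

lemma sum_incr_int:
  assumes g: "path_integrable g T" and n: "0 < n" and T: "0 \<le> T"
  shows "(\<Sum>k<n. incr_int g (grid T n k) (grid T n (Suc k))) = incr_int g 0 T"
proof -
  have "(\<Sum>k<n. incr_int g (grid T n k) (grid T n (Suc k)))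
     = (LINT r|lborel. (\<Sum>k<n. indicator {grid T n k<..grid T n (Suc k)} r * g (max 0 r)))"
    unfolding incr_int_def using T
    by (subst Bochner_Integration.integral_sum)
       (auto intro!: path_integrable_sub[OF g] grid_nonneg grid_le)
  then show ?thesis unfolding incr_int_def sum_distrib_right [symmetric] grid_indicator[OF T n] .
qed

lemma path_integrable_set_integrable:
  assumes "set_integrable lborel {0..T} g"
  shows "path_integrable g T"
proof -
  have "integrable lborel (\<lambda>r. indicator {0<..T} r *\<^sub>R (indicator {0..T} r *\<^sub>R g r))"
    using assms unfolding set_integrable_def by (rule integrable_mult_indicator[rotated]) simp
  moreover have "indicator {0<..T} r *\<^sub>R (indicator {0..T} r *\<^sub>R g r) = indicator {0<..T} r * g (max 0 r)" for r
    by (auto simp: indicator_def)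
  ultimately show ?thesis unfolding path_integrable_def by (simp only:)
qed

lemma incr_int_set_integral:
  assumes g: "set_integrable lborel {0..T} g" and st: "0 \<le> s" "s \<le> t" "t \<le> T"
  shows "incr_int g s t = set_lebesgue_integral lborel {0..t} g - set_lebesgue_integral lborel {0..s} g"
proof -
  have s: "set_integrable lborel {0..s} g" "set_integrable lborel {s<..t} g"
    using st by (auto intro!: set_integrable_subset[OF g])
  have U: "{0..t} = {0..s} \<union> {s<..t}" using st by auto
  have "set_lebesgue_integral lborel {0..t} g = set_lebesgue_integral lborel {0..s} g + set_lebesgue_integral lborel {s<..t} g"
    unfolding U using s by (intro set_integral_Un) auto
  moreover have "set_lebesgue_integral lborel {s<..t} g = incr_int g s t"
    unfolding incr_int_def set_lebesgue_integral_def using st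
    by (intro Bochner_Integration.integral_cong) (auto simp: indicator_def)
  ultimately show ?thesis by simp
qed

lemma set_integral_point: "set_lebesgue_integral lborel {x::real} (f :: real \<Rightarrow> real) = 0"
  unfolding set_lebesgue_integral_def
proof (rule integral_eq_zero_AE)
  show "AE r in lborel. indicator {x} r *\<^sub>R f r = 0"
    using AE_lborel_singleton[of x] by eventually_elim (simp add: indicator_def)
qed

lemma incr_int_from_0:
  assumes "set_integrable lborel {0..T} g" "0 \<le> T"
  shows "incr_int g 0 T = set_lebesgue_integral lborel {0..T} g"
  using incr_int_set_integral[OF assms(1), of 0 T] assms(2) by (simp add: set_integral_point)

text \<open>Uniform continuity on the compact interval, both of the path and of the indefinite
  integral of \<open>g\<close>, makes all increments small once the mesh is small.\<close>

lemma fine_grid: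
  assumes x: "continuous_on {0..T} x" and g: "set_integrable lborel {0..T} g" and T: "0 < T" and d: "0 < d"
  shows "\<forall>\<^sub>F n in sequentially. 0 < n \<and>
    (\<forall>k<n. (\<forall>r\<in>{grid T n k..grid T n (Suc k)}. \<bar>x r - x (grid T n k)\<bar> \<le> d) \<and>
       \<bar>incr_int g (grid T n k) (grid T n (Suc k))\<bar> \<le> (d::real))"
proof -
  define I where "I t = set_lebesgue_integral lborel {0..t} g" for t
  have "continuous_on {0..T} (\<lambda>t. integral {0..t} g)"
    using set_borel_integral_eq_integral(1)[OF g] by (rule indefinite_integral_continuous_1)
  moreover have "integral {0..t} g = I t" if "t \<in> {0..T}" for t
    unfolding I_def using that by (intro set_borel_integral_eq_integral(2)[symmetric] set_integrable_subset[OF g]) auto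
  ultimately have "continuous_on {0..T} I"
    by (subst continuous_on_cong[of _ _ _ "\<lambda>t. integral {0..t} g"]) auto
  then have "uniformly_continuous_on {0..T} I" "uniformly_continuous_on {0..T} x"
    using x by (auto intro: compact_uniformly_continuous)
  then obtain d1 d2 where d1: "0 < d1" "\<And>s t. s \<in> {0..T} \<Longrightarrow> t \<in> {0..T} \<Longrightarrow> dist t s < d1 \<Longrightarrow> dist (I t) (I s) < d"
    and d2: "0 < d2" "\<And>s t. s \<in> {0..T} \<Longrightarrow> t \<in> {0..T} \<Longrightarrow> dist t s < d2 \<Longrightarrow> dist (x t) (x s) < d"
    using d unfolding uniformly_continuous_on_def by metis
  have "(\<lambda>n. T * (1 / real n)) \<longlonglongrightarrow> T * 0" by (intro tendsto_intros lim_1_over_n)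
  then have "\<forall>\<^sub>F n in sequentially. T * (1 / real n) < min d1 d2"
    by (rule order_tendstoD) (use d1 d2 in auto)
  then show ?thesis using eventually_gt_at_top[of 0]
  proof eventually_elim
    case (elim n)
    have step: "T / real n < d1" "T / real n < d2" using elim by auto
    have "(\<forall>r\<in>{grid T n k..grid T n (Suc k)}. \<bar>x r - x (grid T n k)\<bar> \<le> d) \<and>
       \<bar>incr_int g (grid T n k) (grid T n (Suc k))\<bar> \<le> d" if k: "k < n" for k
    proof -
      have in_T: "grid T n k \<in> {0..T}" "grid T n (Suc k) \<in> {0..T}" "grid T n k \<le> grid T n (Suc k)"
        using T k by (auto intro: grid_nonneg grid_le grid_mono)
      have "\<bar>x r - x (grid T n k)\<bar> \<le> d" if "r \<in> {grid T n k..grid T n (Suc k)}" for r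
        using d2(2)[of "grid T n k" r] in_T that step by (auto simp: dist_real_def grid_Suc)
      moreover have "\<bar>incr_int g (grid T n k) (grid T n (Suc k))\<bar> \<le> d"
        using d1(2)[of "grid T n k" "grid T n (Suc k)"] in_T step T
        by (subst incr_int_set_integral[OF g]) (auto simp: dist_real_def grid_Suc I_def)
      ultimately show ?thesis by blast
    qed
    then show ?case using elim by blast
  qed
qed

lemma path_integrable_compose:
  fixes u x g :: "real \<Rightarrow> real"
  assumes x: "continuous_on {0..} x" and x01: "\<And>t. 0 \<le> t \<Longrightarrow> x t \<in> {0..1}"
    and gi: "path_integrable g T" and u: "continuous_on {0..1} u" and um: "u \<in> borel_measurable borel"
  shows "path_integrable (\<lambda>r. u (x r) * g r) T"
proof -
  have "continuous_on UNIV (\<lambda>r. x (max 0 r))"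
    by (rule continuous_on_compose2[OF x]) (auto intro!: continuous_intros)
  then have xm: "(\<lambda>r. x (max 0 r)) \<in> borel_measurable borel" by (rule borel_measurable_continuous_onI)
  have "bounded (u ` {0..1})" using u by (intro compact_imp_bounded compact_continuous_image) auto
  then have "\<exists>C. \<forall>y\<in>{0..1}. \<bar>u y\<bar> \<le> C" by (auto simp: bounded_iff)
  then obtain C where C: "\<And>y. y \<in> {0..1} \<Longrightarrow> \<bar>u y\<bar> \<le> C" by blast
  have C0: "0 \<le> C" using C[of 0] by auto
  show ?thesis
    unfolding path_integrable_def
  proof (rule Bochner_Integration.integrable_bound)
    show "integrable lborel (\<lambda>r. C * (indicator {0<..T} r * g (max 0 r)))"
      using gi by (auto simp: path_integrable_def)
    have "(\<lambda>r. u (x (max 0 r)) * (indicator {0<..T} r * g (max 0 r))) \<in> borel_measurable lborel"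
      using borel_measurable_times[OF measurable_compose[OF xm um]] borel_measurable_integrable[OF gi[unfolded path_integrable_def]]
      by simp
    then show "(\<lambda>r. indicator {0<..T} r * (u (x (max 0 r)) * g (max 0 r))) \<in> borel_measurable lborel"
      by (simp add: mult_ac)
    show "AE r in lborel. norm (indicator {0<..T} r * (u (x (max 0 r)) * g (max 0 r))) \<le> norm (C * (indicator {0<..T} r * g (max 0 r)))"
    proof (rule AE_I2)
      fix r
      have "\<bar>u (x (max 0 r))\<bar> \<le> \<bar>C\<bar>" using C[OF x01[of "max 0 r"]] by auto
      then show "norm (indicator {0<..T} r * (u (x (max 0 r)) * g (max 0 r))) \<le> norm (C * (indicator {0<..T} r * g (max 0 r)))"
        by (auto simp: abs_mult indicator_def intro!: mult_right_mono)
    qed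
  qed
qed

text \<open>Left-point sums against the signed measure with density \<open>g\<close>: the error is
  at most the oscillation of \<open>u\<close> along one step times the integral of
  \<open>\<bar>g\<bar>\<close>. The weights \<open>\<phi>\<close> stand for the cut-off of the
  Taylor expansion, which along a fixed path is eventually 1.\<close>

lemma riemann_sum_limit:
  fixes u x g :: "real \<Rightarrow> real"
  assumes x: "continuous_on {0..} x" and x01: "\<And>t. 0 \<le> t \<Longrightarrow> x t \<in> {0..1}"
    and g: "set_integrable lborel {0..T} g" and T: "0 < T"
    and u: "continuous_on {0..1} u" and um: "u \<in> borel_measurable borel"
    and \<phi>: "\<forall>\<^sub>F n in sequentially. \<forall>k<n. \<phi> n k = 1"
  shows "(\<lambda>n. \<Sum>k<n. \<phi> n k * (u (x (grid T n k)) * incr_int g (grid T n k) (grid T n (Suc k))))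
     \<longlonglongrightarrow> incr_int (\<lambda>r. u (x r) * g r) 0 T"
proof -
  have gi: "path_integrable g T" using g by (rule path_integrable_set_integrable)
  have ugi: "path_integrable (\<lambda>r. u (x r) * g r) T"
    using x x01 gi u um by (rule path_integrable_compose)
  define V where "V = incr_int (\<lambda>r. \<bar>g r\<bar>) 0 T"
  have V0: "0 \<le> V" unfolding V_def incr_int_def by (intro Bochner_Integration.integral_nonneg) auto
  have unif: "uniformly_continuous_on {0..1} u" using u by (auto intro: compact_uniformly_continuous)
  show ?thesis
  proof (rule tendstoI)
    fix e :: real assume e: "0 < e"
    \<comment> \<open>\<open>V + 1\<close> instead of \<open>V\<close> avoids a division by 0, and
      the half leaves room for a strict inequality.\<close>
    define e' where "e' = e / 2 / (V + 1)"
    have e': "0 < e'" using e V0 by (simp add: e'_def)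
    obtain d where d: "0 < d" "\<And>y z. y \<in> {0..1} \<Longrightarrow> z \<in> {0..1} \<Longrightarrow> dist z y < d \<Longrightarrow> dist (u z) (u y) < e'"
      using unif e' unfolding uniformly_continuous_on_def by metis
    have xT: "continuous_on {0..T} x" using x by (rule continuous_on_subset) auto
    have d2: "0 < d / 2" using d by simp
    show "\<forall>\<^sub>F n in sequentially. dist (\<Sum>k<n. \<phi> n k * (u (x (grid T n k)) * incr_int g (grid T n k) (grid T n (Suc k))))
        (incr_int (\<lambda>r. u (x r) * g r) 0 T) < e"
      using fine_grid[OF xT g T d2] \<phi>
    proof eventually_elim
      case (elim n)
      then have n: "0 < n" by simp
      have b: "\<bar>u (x (grid T n k)) * incr_int g (grid T n k) (grid T n (Suc k)) - incr_int (\<lambda>r. u (x r) * g r) (grid T n k) (grid T n (Suc k))\<bar>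
         \<le> e' * incr_int (\<lambda>r. \<bar>g r\<bar>) (grid T n k) (grid T n (Suc k))" if k: "k < n" for k
      proof -
        have s: "0 \<le> grid T n k" "grid T n (Suc k) \<le> T"
          using T k by (auto intro: grid_nonneg grid_le)
        note i = path_integrable_sub[OF _ s]
        have e: "u (x (grid T n k)) * incr_int g (grid T n k) (grid T n (Suc k)) - incr_int (\<lambda>r. u (x r) * g r) (grid T n k) (grid T n (Suc k))
          = (LINT r|lborel. u (x (grid T n k)) * (indicator {grid T n k<..grid T n (Suc k)} r * g (max 0 r))
               - indicator {grid T n k<..grid T n (Suc k)} r * (u (x (max 0 r)) * g (max 0 r)))"
          unfolding incr_int_def using i[OF gi] i[OF ugi] by simp
        have "\<bar>LINT r|lborel. u (x (grid T n k)) * (indicator {grid T n k<..grid T n (Suc k)} r * g (max 0 r))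
               - indicator {grid T n k<..grid T n (Suc k)} r * (u (x (max 0 r)) * g (max 0 r))\<bar> \<le> (LINT r|lborel. e' * (indicator {grid T n k<..grid T n (Suc k)} r * \<bar>g (max 0 r)\<bar>))"
        proof (rule order_trans[OF integral_abs_bound integral_mono])
          show "integrable lborel (\<lambda>r. \<bar>u (x (grid T n k)) * (indicator {grid T n k<..grid T n (Suc k)} r * g (max 0 r))
               - indicator {grid T n k<..grid T n (Suc k)} r * (u (x (max 0 r)) * g (max 0 r))\<bar>)"
            using i[OF gi] i[OF ugi] by auto
          show "integrable lborel (\<lambda>r. e' * (indicator {grid T n k<..grid T n (Suc k)} r * \<bar>g (max 0 r)\<bar>))"
            using i[OF path_integrable_abs[OF gi]] by auto
          fix r
          show "\<bar>u (x (grid T n k)) * (indicator {grid T n k<..grid T n (Suc k)} r * g (max 0 r))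
               - indicator {grid T n k<..grid T n (Suc k)} r * (u (x (max 0 r)) * g (max 0 r))\<bar>
             \<le> e' * (indicator {grid T n k<..grid T n (Suc k)} r * \<bar>g (max 0 r)\<bar>)"
          proof (cases "r \<in> {grid T n k<..grid T n (Suc k)}")
            case True
            then have r: "0 \<le> r" "max 0 r = r" "r \<in> {grid T n k..grid T n (Suc k)}" using s by auto
            have "\<bar>x r - x (grid T n k)\<bar> \<le> d / 2" using elim k r by blast
            then have "dist (x (grid T n k)) (x r) < d" using d(1) by (simp add: dist_real_def abs_minus_commute)
            then have "\<bar>u (x (grid T n k)) - u (x r)\<bar> \<le> e'"
              using d(2)[OF x01[OF r(1)] x01[OF s(1)]] by (simp add: dist_real_def)
            then have "\<bar>u (x (grid T n k)) - u (x r)\<bar> * \<bar>g r\<bar> \<le> e' * \<bar>g r\<bar>" by (intro mult_right_mono) auto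
            then show ?thesis using True r by (simp add: abs_mult [symmetric] left_diff_distrib)
          qed auto
        qed
        also have "\<dots> = e' * incr_int (\<lambda>r. \<bar>g r\<bar>) (grid T n k) (grid T n (Suc k))"
          unfolding incr_int_def by (rule integral_mult_right_zero)
        finally show ?thesis unfolding e .
      qed
      have "\<bar>(\<Sum>k<n. \<phi> n k * (u (x (grid T n k)) * incr_int g (grid T n k) (grid T n (Suc k)))) - incr_int (\<lambda>r. u (x r) * g r) 0 T\<bar>
        = \<bar>\<Sum>k<n. u (x (grid T n k)) * incr_int g (grid T n k) (grid T n (Suc k)) - incr_int (\<lambda>r. u (x r) * g r) (grid T n k) (grid T n (Suc k))\<bar>"
        using elim sum_incr_int[OF ugi n] T by (simp add: sum_subtractf)
      also have "\<dots> \<le> (\<Sum>k<n. e' * incr_int (\<lambda>r. \<bar>g r\<bar>) (grid T n k) (grid T n (Suc k)))"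
        by (intro order_trans[OF sum_abs] sum_mono b) auto
      also have "\<dots> = e' * V"
        unfolding V_def sum_distrib_left [symmetric] using sum_incr_int[OF path_integrable_abs[OF gi] n] T by simp
      also have "\<dots> < e"
      proof -
        have "e' * V \<le> e' * (V + 1)" using e' by simp
        also have "\<dots> = e / 2"
        proof -
          have "V + 1 \<noteq> 0" using V0 by simp
          then show ?thesis unfolding e'_def by (rule nonzero_eq_divide_eq[THEN iffD1, OF _ refl])
        qed
        finally show ?thesis using e by simp
      qed
      finally show ?case by (simp add: dist_real_def)
    qed
  qed
qed

section \<open>Dynkin's formula\<close>

text \<open>The bound \<open>A\<close> on the total variation of the drift integral is random and
  merely square integrable, because for the particles it is built from the noise; for the
  one-dimensional diffusion a constant serves.\<close>

locale bounded_ito_process = wiener M F B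
  for M :: "'w measure" and F :: "real \<Rightarrow> 'w measure" and B :: "real \<Rightarrow> 'w \<Rightarrow> real" +
  fixes X H G :: "real \<Rightarrow> 'w \<Rightarrow> real" and A :: "'w \<Rightarrow> real" and K T :: real
  assumes sd: "has_stochastic_differential M F B X H G"
    and X01: "\<And>t \<omega>. 0 \<le> t \<Longrightarrow> \<omega> \<in> space M \<Longrightarrow> X t \<omega> \<in> {0..1}"
    and H_bound: "\<And>t \<omega>. 0 \<le> t \<Longrightarrow> \<omega> \<in> space M \<Longrightarrow> \<bar>H t \<omega>\<bar> \<le> K"
    and H_measurable: "(\<lambda>x. H (max 0 (snd x)) (fst x)) \<in> borel_measurable (M \<Otimes>\<^sub>M lborel)"
    and G_measurable: "(\<lambda>x. G (max 0 (snd x)) (fst x)) \<in> borel_measurable (M \<Otimes>\<^sub>M lborel)"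
    and A_sq_int: "sq_int M A"
    and A_bound: "AE \<omega> in M. incr_int (\<lambda>r. \<bar>G r \<omega>\<bar>) 0 T \<le> A \<omega>"
    and T_pos: "0 < T"
begin

definition J :: "real \<Rightarrow> 'w \<Rightarrow> real" where
  "J t \<omega> = X t \<omega> - X 0 \<omega> - set_lebesgue_integral lborel {0..t} (\<lambda>s. G s \<omega>)"

text \<open>Integrability on all of \<open>[0, T]\<close> gives it on every subinterval, so a single
  null set is discarded for all grids at once.\<close>

definition nice :: "'w \<Rightarrow> bool" where
  "nice \<omega> \<longleftrightarrow> \<omega> \<in> space M \<and> set_integrable lborel {0..T} (\<lambda>s. G s \<omega>) \<and> incr_int (\<lambda>r. \<bar>G r \<omega>\<bar>) 0 T \<le> A \<omega>"

lemma AE_nice: "AE \<omega> in M. nice \<omega>"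
proof -
  have "AE \<omega> in M. set_integrable lborel {0..T} (\<lambda>s. G s \<omega>)"
    using sd T_pos by (auto simp: has_stochastic_differential_def)
  then show ?thesis using A_bound AE_space by eventually_elim (simp add: nice_def)
qed

lemma ito: "0 \<le> t \<Longrightarrow> has_ito_integral M F B H t (J t)"
  using sd by (simp add: has_stochastic_differential_def J_def [abs_def])

lemma X_adapted: "0 \<le> t \<Longrightarrow> X t \<in> borel_measurable (F t)"
  and X_continuous: "\<omega> \<in> space M \<Longrightarrow> continuous_on {0..} (\<lambda>t. X t \<omega>)"
  using sd by (auto simp: has_stochastic_differential_def adapted_continuous_def)

lemma X_measurable: "0 \<le> t \<Longrightarrow> X t \<in> borel_measurable M"
  using X_adapted measurable_F by blast

lemma J_increment:
  assumes "nice \<omega>" "0 \<le> s" "s \<le> t" "t \<le> T"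
  shows "X t \<omega> - X s \<omega> = J t \<omega> - J s \<omega> + incr_int (\<lambda>r. G r \<omega>) s t"
proof -
  have "incr_int (\<lambda>r. G r \<omega>) s t = set_lebesgue_integral lborel {0..t} (\<lambda>r. G r \<omega>) - set_lebesgue_integral lborel {0..s} (\<lambda>r. G r \<omega>)"
    using assms by (intro incr_int_set_integral[where T = T]) (auto simp: nice_def)
  then show ?thesis by (simp add: J_def)
qed

lemma incr_int_measurable:
  assumes [measurable]: "(\<lambda>x. g (max 0 (snd x)) (fst x)) \<in> borel_measurable (M \<Otimes>\<^sub>M lborel)"
  shows "(\<lambda>\<omega>. incr_int (\<lambda>r. g r \<omega>) s t) \<in> borel_measurable M"
proof -
  have "(\<lambda>x. indicator {s<..t} (snd x) * g (max 0 (snd x)) (fst x)) \<in> borel_measurable (M \<Otimes>\<^sub>M lborel)"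
    by measurable
  then have "(\<lambda>(\<omega>, r). indicator {s<..t} r * g (max 0 r) \<omega>) \<in> borel_measurable (M \<Otimes>\<^sub>M lborel)"
    by (simp add: split_def)
  then show ?thesis unfolding incr_int_def by (rule lborel.borel_measurable_lebesgue_integral)
qed

lemma H2_set_integrable:
  assumes "\<omega> \<in> space M" "0 \<le> t"
  shows "set_integrable lborel {0..t} (\<lambda>r. (H r \<omega>)\<^sup>2)" "path_integrable (\<lambda>r. (H r \<omega>)\<^sup>2) t"
    "0 \<le> incr_int (\<lambda>r. (H r \<omega>)\<^sup>2) s t" "0 \<le> s \<Longrightarrow> s \<le> t \<Longrightarrow> incr_int (\<lambda>r. (H r \<omega>)\<^sup>2) s t \<le> K\<^sup>2 * (t - s)"
proof -
  have m: "(\<lambda>r. H (max 0 r) \<omega>) \<in> borel_measurable lborel"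
    using measurable_compose[OF measurable_Pair1'[OF assms(1)] H_measurable] by simp
  have K: "(H (max 0 r) \<omega>)\<^sup>2 \<le> K\<^sup>2" for r
    using H_bound[of "max 0 r" \<omega>] assms(1)
    by (metis abs_ge_zero abs_le_square_iff abs_of_nonneg max.cobounded1 order_trans)
  have "set_integrable lborel {0..t} (\<lambda>r. (H (max 0 r) \<omega>)\<^sup>2)"
    unfolding set_integrable_def
  proof (rule Bochner_Integration.integrable_bound)
    show "integrable lborel (\<lambda>r. K\<^sup>2 * indicator {0..t} r)"
      using assms by (intro integrable_mult_right integrable_real_indicator) auto
    show "(\<lambda>r. indicator {0..t} r *\<^sub>R (H (max 0 r) \<omega>)\<^sup>2) \<in> borel_measurable lborel"
      using m by measurable
    show "AE r in lborel. norm (indicator {0..t} r *\<^sub>R (H (max 0 r) \<omega>)\<^sup>2) \<le> norm (K\<^sup>2 * indicator {0..t} r)"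
    proof (rule AE_I2)
      fix r show "norm (indicator {0..t} r *\<^sub>R (H (max 0 r) \<omega>)\<^sup>2) \<le> norm (K\<^sup>2 * indicator {0..t} r)"
        using K[of r] by (simp add: indicator_def max_def split: if_splits)
    qed
  qed
  then show s: "set_integrable lborel {0..t} (\<lambda>r. (H r \<omega>)\<^sup>2)"
    by (rule set_integrable_cong[THEN iffD1, rotated -1]) (auto simp: max_def)
  then show p: "path_integrable (\<lambda>r. (H r \<omega>)\<^sup>2) t" by (rule path_integrable_set_integrable)
  show "0 \<le> incr_int (\<lambda>r. (H r \<omega>)\<^sup>2) s t"
    unfolding incr_int_def by (intro Bochner_Integration.integral_nonneg) auto
  show "incr_int (\<lambda>r. (H r \<omega>)\<^sup>2) s t \<le> K\<^sup>2 * (t - s)" if st: "0 \<le> s" "s \<le> t"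
  proof -
    have "incr_int (\<lambda>r. (H r \<omega>)\<^sup>2) s t \<le> (LINT r|lborel. K\<^sup>2 * indicator {s<..t} r)"
      unfolding incr_int_def
    proof (rule integral_mono)
      show "integrable lborel (\<lambda>r. indicator {s<..t} r * (H (max 0 r) \<omega>)\<^sup>2)"
        using path_integrable_sub[OF p st(1), of t] by simp
      show "integrable lborel (\<lambda>r. K\<^sup>2 * indicator {s<..t} r)"
        using st by (intro integrable_mult_right integrable_real_indicator) auto
    qed (use K in \<open>auto simp: indicator_def\<close>)
    also have "\<dots> = K\<^sup>2 * (t - s)" using st by simp
    finally show ?thesis .
  qed
qed

text \<open>The product runs over \<open>j < k\<close> only: the weight of step \<open>k\<close> is
  known at the left end of that step and ignores whether step \<open>k\<close> itself is
  large.\<close>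

definition flag :: "nat \<Rightarrow> real \<Rightarrow> nat \<Rightarrow> 'w \<Rightarrow> real" where
  "flag n \<epsilon> k \<omega> = (\<Prod>j<k. if \<bar>X (grid T n (Suc j)) \<omega> - X (grid T n j) \<omega>\<bar> \<le> \<epsilon> then 1 else 0)"

lemma flag_cases: "flag n \<epsilon> k \<omega> = 0 \<or> flag n \<epsilon> k \<omega> = 1"
  by (induction k) (auto simp: flag_def)

lemma flag_adapted: "flag n \<epsilon> k \<in> borel_measurable (F (grid T n k))"
proof -
  have X: "X (grid T n j) \<in> borel_measurable (F (grid T n k))" if "j \<le> k" for j
    using T_pos that by (intro measurable_F_mono[OF X_adapted]) (auto intro: grid_nonneg grid_mono)
  have "(\<lambda>\<omega>. if \<bar>X (grid T n (Suc j)) \<omega> - X (grid T n j) \<omega>\<bar> \<le> \<epsilon> then 1 else 0 :: real) \<in> borel_measurable (F (grid T n k))"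
    if "j < k" for j
  proof -
    have [measurable]: "X (grid T n (Suc j)) \<in> borel_measurable (F (grid T n k))" "X (grid T n j) \<in> borel_measurable (F (grid T n k))"
      using X[of "Suc j"] X[of j] that by auto
    show ?thesis by measurable
  qed
  then show ?thesis unfolding flag_def by (intro borel_measurable_prod) auto
qed

lemma flag_eventually:
  assumes "nice \<omega>" "0 < \<epsilon>"
  shows "\<forall>\<^sub>F n in sequentially. \<forall>k\<le>n. flag n \<epsilon> k \<omega> = 1"
proof -
  have "continuous_on {0..T} (\<lambda>t. X t \<omega>)"
    using X_continuous[of \<omega>] assms by (auto simp: nice_def intro: continuous_on_subset)
  from fine_grid[OF this _ T_pos assms(2)] assms(1)
  have "\<forall>\<^sub>F n in sequentially. 0 < n \<and> (\<forall>k<n. (\<forall>r\<in>{grid T n k..grid T n (Suc k)}. \<bar>X r \<omega> - X (grid T n k) \<omega>\<bar> \<le> \<epsilon>) \<and>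
       \<bar>incr_int (\<lambda>r. G r \<omega>) (grid T n k) (grid T n (Suc k))\<bar> \<le> \<epsilon>)"
    by (auto simp: nice_def)
  then show ?thesis
  proof eventually_elim
    case (elim n)
    have "\<bar>X (grid T n (Suc j)) \<omega> - X (grid T n j) \<omega>\<bar> \<le> \<epsilon>" if "j < n" for j
      using elim that T_pos by (auto simp: grid_mono)
    then show ?case by (auto simp: flag_def intro!: prod.neutral)
  qed
qed

text \<open>The weights switch off for good after the first step larger than
  \<open>\<epsilon>\<close>. When this happens, cutting the telescoping sum short costs at most
  \<open>2 * C\<close>, and the remainder of the one large step at most \<open>C\<close>, as steps
  have length at most 1; together this is the term
  \<open>3 * C * (1 - flag n \<epsilon> n \<omega>)\<close>.\<close>

lemma Taylor_sum:
  assumes n: "0 < n" and \<omega>: "\<omega> \<in> space M" and \<epsilon>: "0 \<le> \<epsilon>"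
    and fC: "\<And>y. y \<in> {0..1} \<Longrightarrow> \<bar>f y :: real\<bar> \<le> C"
    and Taylor: "\<And>y z. y \<in> {0..1} \<Longrightarrow> z \<in> {0..1} \<Longrightarrow>
       \<bar>f z - f y - f1 y * (z - y) - f2 y / 2 * (z - y)\<^sup>2\<bar> \<le> C * \<bar>z - y\<bar> ^ 3"
  defines "x \<equiv> \<lambda>k. X (grid T n k) \<omega>"
  shows "\<bar>f (X T \<omega>) - f (X 0 \<omega>) - (\<Sum>k<n. flag n \<epsilon> k \<omega> * (f1 (x k) * (x (Suc k) - x k) + f2 (x k) / 2 * (x (Suc k) - x k)\<^sup>2))\<bar>
    \<le> 3 * C * (1 - flag n \<epsilon> n \<omega>) + C * \<epsilon> * (\<Sum>k<n. (x (Suc k) - x k)\<^sup>2)"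
proof -
  define p where "p k = flag n \<epsilon> k \<omega>" for k
  have p: "p k = 0 \<or> p k = 1" for k unfolding p_def by (rule flag_cases)
  have pS: "p (Suc k) = p k * (if \<bar>x (Suc k) - x k\<bar> \<le> \<epsilon> then 1 else 0)" for k
    by (simp add: p_def flag_def x_def)
  have x01: "x k \<in> {0..1}" for k unfolding x_def using T_pos \<omega> by (intro X01 grid_nonneg) auto
  have C0: "0 \<le> C" using fC[of 0] by auto
  have tel: "\<bar>f (x m) - f (x 0) - (\<Sum>k<m. p k * (f (x (Suc k)) - f (x k)))\<bar> \<le> 2 * C * (1 - p m)" for m
  proof -
    \<comment> \<open>After the weights have switched off, the sum is frozen at the value of
      \<open>f\<close> in some grid point \<open>x j\<close>; boundedness of \<open>f\<close> then
      controls the difference.\<close>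
    have "(p m = 1 \<longrightarrow> f (x 0) + (\<Sum>k<m. p k * (f (x (Suc k)) - f (x k))) = f (x m)) \<and>
          (\<exists>j. f (x 0) + (\<Sum>k<m. p k * (f (x (Suc k)) - f (x k))) = f (x j))"
    proof (induction m)
      case (Suc m)
      show ?case
      proof (cases "p m = 1")
        case True
        then have "f (x 0) + (\<Sum>k<Suc m. p k * (f (x (Suc k)) - f (x k))) = f (x (Suc m))"
          using Suc by simp
        then show ?thesis by blast
      next
        case False
        then have "p m = 0" using p by blast
        then show ?thesis using Suc by (simp add: pS)
      qed
    qed auto
    then obtain j where j: "f (x 0) + (\<Sum>k<m. p k * (f (x (Suc k)) - f (x k))) = f (x j)"
      and 1: "p m = 1 \<Longrightarrow> f (x 0) + (\<Sum>k<m. p k * (f (x (Suc k)) - f (x k))) = f (x m)" by blast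
    have "\<bar>f (x m)\<bar> \<le> C" "\<bar>f (x j)\<bar> \<le> C" using fC x01 by auto
    then show ?thesis using p[of m] 1 j by (auto simp: abs_le_iff)
  qed
  have step: "\<bar>p k * (f (x (Suc k)) - f (x k)) - p k * (f1 (x k) * (x (Suc k) - x k) + f2 (x k) / 2 * (x (Suc k) - x k)\<^sup>2)\<bar>
     \<le> C * (p k - p (Suc k)) + C * \<epsilon> * (x (Suc k) - x k)\<^sup>2" for k
  proof (cases "p k = 1")
    case True
    define D where "D = x (Suc k) - x k"
    have T: "\<bar>(f (x (Suc k)) - f (x k)) - (f1 (x k) * D + f2 (x k) / 2 * D\<^sup>2)\<bar> \<le> C * \<bar>D\<bar> ^ 3"
      using Taylor[OF x01[of k] x01[of "Suc k"]] by (simp add: D_def algebra_simps)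
    \<comment> \<open>A large step is paid for by the drop of \<open>p\<close> from 1 to 0, a small
      one by \<open>\<epsilon>\<close> times its square.\<close>
    have "\<bar>D\<bar> ^ 3 \<le> (1 - p (Suc k)) + \<epsilon> * D\<^sup>2"
    proof (cases "\<bar>D\<bar> \<le> \<epsilon>")
      case True
      have "\<bar>D\<bar> ^ 3 = \<bar>D\<bar> * D\<^sup>2" by (simp add: power3_eq_cube power2_eq_square abs_mult_self_eq mult.assoc)
      also have "\<dots> \<le> \<epsilon> * D\<^sup>2" using True by (intro mult_right_mono) auto
      finally show ?thesis using \<open>p k = 1\<close> True by (simp add: pS D_def)
    next
      case False
      have "\<bar>D\<bar> \<le> 1" using x01[of k] x01[of "Suc k"] by (auto simp: D_def abs_le_iff)
      then have "\<bar>D\<bar> ^ 3 \<le> 1" by (intro power_le_one) auto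
      then show ?thesis using False \<epsilon> by (simp add: pS D_def add_increasing2)
    qed
    then have "C * \<bar>D\<bar> ^ 3 \<le> C * ((1 - p (Suc k)) + \<epsilon> * D\<^sup>2)" using C0 by (intro mult_left_mono)
    then show ?thesis using T True by (simp add: D_def algebra_simps)
  next
    case False
    then have "p k = 0" using p by blast
    then show ?thesis using C0 \<epsilon> by (simp add: pS)
  qed
  have "\<bar>(\<Sum>k<n. p k * (f (x (Suc k)) - f (x k))) - (\<Sum>k<n. p k * (f1 (x k) * (x (Suc k) - x k) + f2 (x k) / 2 * (x (Suc k) - x k)\<^sup>2))\<bar>
     \<le> (\<Sum>k<n. C * (p k - p (Suc k)) + C * \<epsilon> * (x (Suc k) - x k)\<^sup>2)"
    unfolding sum_subtractf [symmetric] by (intro order_trans[OF sum_abs] sum_mono step)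
  also have "\<dots> = C * (1 - p n) + C * \<epsilon> * (\<Sum>k<n. (x (Suc k) - x k)\<^sup>2)"
  proof -
    have "(\<Sum>k<n. p k - p (Suc k)) = p 0 - p n" by (rule sum_lessThan_telescope')
    moreover have "p 0 = 1" by (simp add: p_def flag_def)
    ultimately show ?thesis by (simp add: sum.distrib sum_distrib_left [symmetric])
  qed
  finally have "\<bar>(\<Sum>k<n. p k * (f (x (Suc k)) - f (x k))) - (\<Sum>k<n. p k * (f1 (x k) * (x (Suc k) - x k) + f2 (x k) / 2 * (x (Suc k) - x k)\<^sup>2))\<bar>
     \<le> C * (1 - p n) + C * \<epsilon> * (\<Sum>k<n. (x (Suc k) - x k)\<^sup>2)" .
  then have "\<bar>f (x n) - f (x 0) - (\<Sum>k<n. p k * (f1 (x k) * (x (Suc k) - x k) + f2 (x k) / 2 * (x (Suc k) - x k)\<^sup>2))\<bar>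
    \<le> 2 * C * (1 - p n) + (C * (1 - p n) + C * \<epsilon> * (\<Sum>k<n. (x (Suc k) - x k)\<^sup>2))"
    using tel[of n] by linarith
  moreover have "x n = X T \<omega>" "x 0 = X 0 \<omega>" using n by (simp_all add: x_def grid_n)
  ultimately show ?thesis by (simp add: p_def algebra_simps)
qed

end

context bounded_ito_process
begin

section \<open>Increments along the grid and their quadratic variation\<close>

lemma ito_H2:
  assumes "0 \<le> s" shows "(LINT r|lborel. indicator {s<..t} r * (H r \<omega>)\<^sup>2) = incr_int (\<lambda>r. (H r \<omega>)\<^sup>2) s t"
  unfolding incr_int_def using assms by (intro Bochner_Integration.integral_cong) (auto simp: indicator_def)

lemma A_integrable: "integrable M A" "integrable M (\<lambda>\<omega>. (A \<omega>)\<^sup>2)"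
proof -
  show "integrable M (\<lambda>\<omega>. (A \<omega>)\<^sup>2)" using A_sq_int by (simp add: sq_int_def)
  then show "integrable M A" by (rule square_integrable_imp_integrable[OF sq_int_measurable[OF A_sq_int]])
qed

lemma G_nice:
  assumes "nice \<omega>" "0 < n"
  shows "(\<Sum>k<n. \<bar>incr_int (\<lambda>r. G r \<omega>) (grid T n k) (grid T n (Suc k))\<bar>) \<le> A \<omega>"
    and "0 \<le> A \<omega>" and "k < n \<Longrightarrow> \<bar>incr_int (\<lambda>r. G r \<omega>) (grid T n k) (grid T n (Suc k))\<bar> \<le> A \<omega>"
proof -
  have p: "path_integrable (\<lambda>r. G r \<omega>) T" using assms by (auto simp: nice_def intro: path_integrable_set_integrable)
  have "(\<Sum>k<n. \<bar>incr_int (\<lambda>r. G r \<omega>) (grid T n k) (grid T n (Suc k))\<bar>)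
    \<le> (\<Sum>k<n. incr_int (\<lambda>r. \<bar>G r \<omega>\<bar>) (grid T n k) (grid T n (Suc k)))"
    using T_pos by (intro sum_mono incr_int_abs_le[OF p]) (auto intro: grid_nonneg grid_le)
  also have "\<dots> = incr_int (\<lambda>r. \<bar>G r \<omega>\<bar>) 0 T"
    using T_pos by (intro sum_incr_int[OF path_integrable_abs[OF p] assms(2)]) simp
  also have "\<dots> \<le> A \<omega>" using assms by (simp add: nice_def)
  finally show *: "(\<Sum>k<n. \<bar>incr_int (\<lambda>r. G r \<omega>) (grid T n k) (grid T n (Suc k))\<bar>) \<le> A \<omega>" .
  show "0 \<le> A \<omega>" by (rule order_trans[OF _ *]) (auto intro: sum_nonneg)
  show "\<bar>incr_int (\<lambda>r. G r \<omega>) (grid T n k) (grid T n (Suc k))\<bar> \<le> A \<omega>" if "k < n"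
    using * that by (intro order_trans[OF member_le_sum[of k "{..<n}" "\<lambda>k. \<bar>incr_int (\<lambda>r. G r \<omega>) (grid T n k) (grid T n (Suc k))\<bar>"]]) auto
qed

definition dX :: "nat \<Rightarrow> nat \<Rightarrow> 'w \<Rightarrow> real" where
  "dX n k \<omega> = X (grid T n (Suc k)) \<omega> - X (grid T n k) \<omega>"

definition dG :: "nat \<Rightarrow> nat \<Rightarrow> 'w \<Rightarrow> real" where
  "dG n k \<omega> = incr_int (\<lambda>r. G r \<omega>) (grid T n k) (grid T n (Suc k))"

definition dH :: "nat \<Rightarrow> nat \<Rightarrow> 'w \<Rightarrow> real" where
  "dH n k \<omega> = incr_int (\<lambda>r. (H r \<omega>)\<^sup>2) (grid T n k) (grid T n (Suc k))"

definition dJ :: "nat \<Rightarrow> nat \<Rightarrow> 'w \<Rightarrow> real" where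
  "dJ n k \<omega> = J (grid T n (Suc k)) \<omega> - J (grid T n k) \<omega>"

lemma dX_eq: "nice \<omega> \<Longrightarrow> k < n \<Longrightarrow> dX n k \<omega> = dJ n k \<omega> + dG n k \<omega>"
  unfolding dX_def dJ_def dG_def using T_pos
  by (intro J_increment) (auto intro: grid_nonneg grid_mono grid_le)

lemma grid_order: "0 \<le> grid T n k" "grid T n k \<le> grid T n (Suc k)"
  using T_pos by (auto intro: grid_nonneg grid_mono)

lemma dX_measurable [measurable]: "dX n k \<in> borel_measurable M"
  unfolding dX_def by (intro borel_measurable_diff X_measurable grid_order order_trans[OF grid_order])

lemma dX_bound: "\<omega> \<in> space M \<Longrightarrow> \<bar>dX n k \<omega>\<bar> \<le> 1"
  unfolding dX_def using X01[OF grid_order(1)[of n k], of \<omega>] X01[OF grid_order(1)[of n "Suc k"], of \<omega>] by (auto simp: abs_le_iff)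

lemma dG_measurable [measurable]: "dG n k \<in> borel_measurable M"
  unfolding dG_def by (rule incr_int_measurable[OF G_measurable])

lemma dH_measurable [measurable]: "dH n k \<in> borel_measurable M"
proof -
  note [measurable] = H_measurable
  show ?thesis unfolding dH_def by (rule incr_int_measurable) measurable
qed

lemma dH_sum: "\<omega> \<in> space M \<Longrightarrow> 0 < n \<Longrightarrow> (\<Sum>k<n. dH n k \<omega>) \<le> K\<^sup>2 * T"
  unfolding dH_def using T_pos H2_set_integrable[of \<omega> T] H2_set_integrable(4)[of \<omega> T 0]
  by (subst sum_incr_int) auto

lemma dH_nonneg: "\<omega> \<in> space M \<Longrightarrow> 0 \<le> dH n k \<omega>"
  unfolding dH_def by (rule H2_set_integrable(3)[OF _ grid_order(1)])

lemma dJ_sq_int: "sq_int M (dJ n k)"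
  unfolding dJ_def
  by (rule ito_increment_sq_int[OF ito H_measurable grid_order, where \<phi> = "\<lambda>_. 0" and C = 0]) auto

lemma dH_integrable: "integrable M (dH n k)"
proof (rule integrable_const_bound[where B = "K\<^sup>2 * (grid T n (Suc k) - grid T n k)"])
  show "AE \<omega> in M. norm (dH n k \<omega>) \<le> K\<^sup>2 * (grid T n (Suc k) - grid T n k)"
  proof (rule AE_I2)
    fix \<omega> assume \<omega>: "\<omega> \<in> space M"
    then have "dH n k \<omega> \<le> K\<^sup>2 * (grid T n (Suc k) - grid T n k)"
      unfolding dH_def by (rule H2_set_integrable(4)[OF _ grid_order(1) grid_order])
    then show "norm (dH n k \<omega>) \<le> K\<^sup>2 * (grid T n (Suc k) - grid T n k)"
      using dH_nonneg[OF \<omega>, of n k] by simp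
  qed
qed simp

text \<open>Both \<open>dJ\<close> and \<open>(dJ)\<^sup>2 - dH\<close> are martingale differences;
  these are the two kinds of terms that must disappear from the expansion in expectation.\<close>

lemma weighted_increments:
  assumes \<phi>: "\<phi> \<in> borel_measurable (F (grid T n k))" "\<And>\<omega>. \<omega> \<in> space M \<Longrightarrow> \<bar>\<phi> \<omega>\<bar> \<le> C"
  shows "expectation (\<lambda>\<omega>. \<phi> \<omega> * dJ n k \<omega>) = 0" "integrable M (\<lambda>\<omega>. \<phi> \<omega> * dJ n k \<omega>)"
    "expectation (\<lambda>\<omega>. \<phi> \<omega> * ((dJ n k \<omega>)\<^sup>2 - dH n k \<omega>)) = 0" "integrable M (\<lambda>\<omega>. \<phi> \<omega> * ((dJ n k \<omega>)\<^sup>2 - dH n k \<omega>))"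
proof -
  note \<phi>M = measurable_F[OF \<phi>(1)]
  have s: "sq_int M (\<lambda>\<omega>. \<phi> \<omega> * dJ n k \<omega>)"
    by (rule sq_int_bounded_mult[OF dJ_sq_int \<phi>M \<phi>(2)])
  then show "integrable M (\<lambda>\<omega>. \<phi> \<omega> * dJ n k \<omega>)"
    unfolding sq_int_def by (blast intro: square_integrable_imp_integrable)
  show "expectation (\<lambda>\<omega>. \<phi> \<omega> * dJ n k \<omega>) = 0"
    unfolding dJ_def by (rule ito_increment_mean[OF ito H_measurable grid_order \<phi>])
  have i1: "integrable M (\<lambda>\<omega>. \<phi> \<omega> * (dJ n k \<omega>)\<^sup>2)"
    using sq_int_mult[OF s dJ_sq_int[of n k]] by (simp add: power2_eq_square mult.assoc)
  have i2: "integrable M (\<lambda>\<omega>. \<phi> \<omega> * dH n k \<omega>)"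
  proof (rule Bochner_Integration.integrable_bound)
    show "integrable M (\<lambda>\<omega>. C * dH n k \<omega>)" using dH_integrable by simp
    show "AE \<omega> in M. norm (\<phi> \<omega> * dH n k \<omega>) \<le> norm (C * dH n k \<omega>)"
      using \<phi>(2) by (intro AE_I2) (auto simp: abs_mult intro!: mult_right_mono intro: order_trans[OF _ abs_ge_self])
  qed (use \<phi>M in measurable)
  show "integrable M (\<lambda>\<omega>. \<phi> \<omega> * ((dJ n k \<omega>)\<^sup>2 - dH n k \<omega>))"
    using i1 i2 by (simp add: right_diff_distrib)
  have "expectation (\<lambda>\<omega>. \<phi> \<omega> * (dJ n k \<omega>)\<^sup>2) = expectation (\<lambda>\<omega>. \<phi> \<omega> * dH n k \<omega>)"
    unfolding dJ_def dH_def ito_H2[OF grid_order(1), symmetric]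
    by (rule ito_increment_square[OF ito H_measurable grid_order \<phi>])
  then show "expectation (\<lambda>\<omega>. \<phi> \<omega> * ((dJ n k \<omega>)\<^sup>2 - dH n k \<omega>)) = 0"
    using i1 i2 by (simp add: right_diff_distrib)
qed

lemma quadratic_variation_integrable: "integrable M (\<lambda>\<omega>. \<Sum>k<n. (dX n k \<omega>)\<^sup>2)"
proof (intro Bochner_Integration.integrable_sum integrable_const_bound[where B = 1] AE_I2)
  fix k \<omega> assume "\<omega> \<in> space M"
  then show "norm ((dX n k \<omega>)\<^sup>2) \<le> 1" using dX_bound[of \<omega> n k] by (simp add: abs_square_le_1)
qed simp

text \<open>The bound is uniform in \<open>n\<close>. The martingale part is controlled by the
  isometry and the bound on \<open>H\<close>; in the drift part
  \<open>(dG)\<^sup>2 \<le> A * \<bar>dG\<bar>\<close> sums to at most \<open>A\<^sup>2\<close>,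
  which is where the second moment of \<open>A\<close> enters.\<close>

lemma quadratic_variation_bound:
  assumes n: "0 < n"
  shows "expectation (\<lambda>\<omega>. \<Sum>k<n. (dX n k \<omega>)\<^sup>2) \<le> 2 * (K\<^sup>2 * T) + 2 * expectation (\<lambda>\<omega>. (A \<omega>)\<^sup>2)"
proof -
  have iJ: "integrable M (\<lambda>\<omega>. (dJ n k \<omega>)\<^sup>2)" for k using dJ_sq_int by (simp add: sq_int_def)
  have "expectation (\<lambda>\<omega>. \<Sum>k<n. (dX n k \<omega>)\<^sup>2) \<le> expectation (\<lambda>\<omega>. 2 * (\<Sum>k<n. (dJ n k \<omega>)\<^sup>2) + 2 * (A \<omega>)\<^sup>2)"
  proof (rule integral_mono_AE)
    show "integrable M (\<lambda>\<omega>. \<Sum>k<n. (dX n k \<omega>)\<^sup>2)" by (rule quadratic_variation_integrable)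
    show "integrable M (\<lambda>\<omega>. 2 * (\<Sum>k<n. (dJ n k \<omega>)\<^sup>2) + 2 * (A \<omega>)\<^sup>2)"
      using iJ A_integrable by auto
    show "AE \<omega> in M. (\<Sum>k<n. (dX n k \<omega>)\<^sup>2) \<le> 2 * (\<Sum>k<n. (dJ n k \<omega>)\<^sup>2) + 2 * (A \<omega>)\<^sup>2"
      using AE_nice
    proof eventually_elim
      case (elim \<omega>)
      have "(dX n k \<omega>)\<^sup>2 \<le> 2 * (dJ n k \<omega>)\<^sup>2 + 2 * (A \<omega> * \<bar>dG n k \<omega>\<bar>)" if k: "k < n" for k
      proof -
        have "(dX n k \<omega>)\<^sup>2 \<le> 2 * (dJ n k \<omega>)\<^sup>2 + 2 * (dG n k \<omega>)\<^sup>2"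
          unfolding dX_eq[OF elim k] using zero_le_power2[of "dJ n k \<omega> - dG n k \<omega>"]
          by (simp add: power2_eq_square algebra_simps)
        moreover have "(dG n k \<omega>)\<^sup>2 \<le> A \<omega> * \<bar>dG n k \<omega>\<bar>"
          using mult_right_mono[OF G_nice(3)[OF elim n k, folded dG_def], of "\<bar>dG n k \<omega>\<bar>"]
          by (simp add: power2_eq_square)
        ultimately show ?thesis by linarith
      qed
      then have "(\<Sum>k<n. (dX n k \<omega>)\<^sup>2) \<le> (\<Sum>k<n. 2 * (dJ n k \<omega>)\<^sup>2 + 2 * (A \<omega> * \<bar>dG n k \<omega>\<bar>))"
        by (intro sum_mono) auto
      also have "\<dots> = 2 * (\<Sum>k<n. (dJ n k \<omega>)\<^sup>2) + 2 * (A \<omega> * (\<Sum>k<n. \<bar>dG n k \<omega>\<bar>))"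
        by (simp add: sum.distrib sum_distrib_left)
      also have "A \<omega> * (\<Sum>k<n. \<bar>dG n k \<omega>\<bar>) \<le> A \<omega> * A \<omega>"
        using G_nice(1,2)[OF elim n] by (intro mult_left_mono) (auto simp: dG_def)
      finally show ?case by (simp add: power2_eq_square)
    qed
  qed
  also have "\<dots> = 2 * (\<Sum>k<n. expectation (\<lambda>\<omega>. (dJ n k \<omega>)\<^sup>2)) + 2 * expectation (\<lambda>\<omega>. (A \<omega>)\<^sup>2)"
    using iJ A_integrable by simp
  also have "(\<Sum>k<n. expectation (\<lambda>\<omega>. (dJ n k \<omega>)\<^sup>2)) = (\<Sum>k<n. expectation (dH n k))"
  proof (intro sum.cong refl)
    fix k
    show "expectation (\<lambda>\<omega>. (dJ n k \<omega>)\<^sup>2) = expectation (dH n k)"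
      using weighted_increments(3)[of "\<lambda>_. 1" n k 1] iJ dH_integrable by simp
  qed
  also have "\<dots> = expectation (\<lambda>\<omega>. \<Sum>k<n. dH n k \<omega>)" using dH_integrable by simp
  also have "\<dots> \<le> expectation (\<lambda>\<omega>. K\<^sup>2 * T)"
    using dH_integrable dH_sum[OF _ n] by (intro integral_mono) auto
  finally show ?thesis by (simp add: prob_space)
qed

end

context wiener
begin

text \<open>Time is rounded up to multiples of \<open>1 / (n + 1)\<close>: for each \<open>n\<close>
  only countably many times occur, and continuity of the paths gives the pointwise limit.\<close>

lemma adapted_continuous_jointly_measurable:
  assumes X: "adapted_continuous M F X"
  shows "(\<lambda>x. X (max 0 (snd x)) (fst x)) \<in> borel_measurable (M \<Otimes>\<^sub>M lborel)"
proof -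
  have X_measurable: "X t \<in> borel_measurable M" if "0 \<le> t" for t
    using X that measurable_F by (auto simp: adapted_continuous_def)
  have X_continuous: "continuous_on {0..} (\<lambda>t. X t \<omega>)" if "\<omega> \<in> space M" for \<omega>
    using X that by (auto simp: adapted_continuous_def)
  define r where "r n t = real_of_int \<lceil>real (Suc n) * max 0 t\<rceil> / real (Suc n)" for n t
  have r0: "0 \<le> r n t" for n t
  proof -
    have "0 \<le> real (Suc n) * max 0 t" by (intro mult_nonneg_nonneg) auto
    also have "\<dots> \<le> real_of_int \<lceil>real (Suc n) * max 0 t\<rceil>" by (rule le_of_int_ceiling)
    finally show ?thesis unfolding r_def by (intro divide_nonneg_nonneg) auto
  qed
  have rt: "(\<lambda>n. r n t) \<longlonglongrightarrow> max 0 t" for t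
  proof (rule tendsto_sandwich[OF _ _ tendsto_const])
    show "\<forall>\<^sub>F n in sequentially. max 0 t \<le> r n t"
    proof (intro always_eventually allI)
      fix n
      have "real (Suc n) * max 0 t \<le> real_of_int \<lceil>real (Suc n) * max 0 t\<rceil>" by (rule le_of_int_ceiling)
      then show "max 0 t \<le> r n t" unfolding r_def by (subst pos_le_divide_eq) (auto simp: mult.commute)
    qed
    show "\<forall>\<^sub>F n in sequentially. r n t \<le> max 0 t + 1 / real (Suc n)"
    proof (intro always_eventually allI)
      fix n
      have "real_of_int \<lceil>real (Suc n) * max 0 t\<rceil> \<le> real (Suc n) * max 0 t + 1" by linarith
      then show "r n t \<le> max 0 t + 1 / real (Suc n)"
        unfolding r_def by (subst pos_divide_le_eq) (auto simp: algebra_simps)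
    qed
    have "(\<lambda>n. max 0 t + 1 / real (Suc n)) \<longlonglongrightarrow> max 0 t + 0"
      by (intro tendsto_intros LIMSEQ_Suc lim_1_over_n)
    then show "(\<lambda>n. max 0 t + 1 / real (Suc n)) \<longlonglongrightarrow> max 0 t" by simp
  qed
  show ?thesis
  proof (rule borel_measurable_LIMSEQ_real)
    fix x assume "x \<in> space (M \<Otimes>\<^sub>M (lborel :: real measure))"
    then have "fst x \<in> space M" by (auto simp: space_pair_measure)
    then have c: "continuous_on {0..} (\<lambda>t. X t (fst x))" by (rule X_continuous)
    show "(\<lambda>n. X (r n (snd x)) (fst x)) \<longlonglongrightarrow> X (max 0 (snd x)) (fst x)"
      by (rule continuous_on_tendsto_compose[OF c rt]) (auto simp: r0)
  next
    fix n
    define q where "q k = real_of_int k / real (Suc n)" for k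
    have "(\<lambda>x. X (max 0 (q k)) (fst x)) \<in> borel_measurable (M \<Otimes>\<^sub>M lborel)" for k
      by (rule measurable_compose[OF measurable_fst X_measurable]) simp
    moreover have "(\<lambda>x. \<lceil>real (Suc n) * max 0 (snd x)\<rceil>) \<in> measurable (M \<Otimes>\<^sub>M (lborel :: real measure)) (count_space UNIV)"
      by measurable
    ultimately have "(\<lambda>x. X (max 0 (q \<lceil>real (Suc n) * max 0 (snd x)\<rceil>)) (fst x)) \<in> borel_measurable (M \<Otimes>\<^sub>M lborel)"
      by (rule measurable_compose_countable)
    then show "(\<lambda>x. X (r n (snd x)) (fst x)) \<in> borel_measurable (M \<Otimes>\<^sub>M lborel)"
      using r0 by (simp add: q_def r_def max_def)
  qed
qed

end

context bounded_ito_process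
begin

definition drift_sum :: "(real \<Rightarrow> real) \<Rightarrow> (real \<Rightarrow> real) \<Rightarrow> real \<Rightarrow> nat \<Rightarrow> 'w \<Rightarrow> real" where
  "drift_sum f1 f2 \<epsilon> n \<omega> = (\<Sum>k<n. flag n \<epsilon> k \<omega> * (f1 (X (grid T n k) \<omega>) * dG n k \<omega>))
     + (\<Sum>k<n. flag n \<epsilon> k \<omega> * (f2 (X (grid T n k) \<omega>) / 2 * dH n k \<omega>))"

definition drift_integral :: "(real \<Rightarrow> real) \<Rightarrow> (real \<Rightarrow> real) \<Rightarrow> 'w \<Rightarrow> real" where
  "drift_integral f1 f2 \<omega> = incr_int (\<lambda>r. f1 (X r \<omega>) * G r \<omega>) 0 T
     + incr_int (\<lambda>r. f2 (X r \<omega>) / 2 * (H r \<omega>)\<^sup>2) 0 T"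

text \<open>From \<open>dX = dJ + dG\<close> follows
  \<open>(dX)\<^sup>2 - (dJ)\<^sup>2 = dG * (2 * dX - dG)\<close>. The sum bounds what is lost when
  squared increments are replaced by those of the martingale part.\<close>

definition cross_variation :: "nat \<Rightarrow> 'w \<Rightarrow> real" where
  "cross_variation n \<omega> = (\<Sum>k<n. \<bar>dG n k \<omega>\<bar> * (2 * \<bar>dX n k \<omega>\<bar> + \<bar>dG n k \<omega>\<bar>))"

lemma flag_measurable [measurable]: "flag n \<epsilon> k \<in> borel_measurable M"
  by (rule measurable_F[OF flag_adapted])

lemma flag_range: "0 \<le> flag n \<epsilon> k \<omega>" "flag n \<epsilon> k \<omega> \<le> 1"
  using flag_cases[of n \<epsilon> k \<omega>] by auto

lemma X_compose_measurable:
  assumes "u \<in> borel_measurable borel"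
  shows "(\<lambda>\<omega>. u (X (grid T n k) \<omega>)) \<in> borel_measurable M"
  by (rule measurable_compose[OF X_measurable[OF grid_order(1)] assms])

lemma cross_variation_bound:
  assumes "nice \<omega>" "0 < n"
  shows "cross_variation n \<omega> \<le> 2 * A \<omega> + (A \<omega>)\<^sup>2" "0 \<le> cross_variation n \<omega>"
proof -
  note g = G_nice[OF assms, folded dG_def]
  have "cross_variation n \<omega> \<le> (\<Sum>k<n. \<bar>dG n k \<omega>\<bar> * (2 + A \<omega>))"
    unfolding cross_variation_def
  proof (intro sum_mono mult_left_mono)
    fix k assume "k \<in> {..<n}"
    then show "2 * \<bar>dX n k \<omega>\<bar> + \<bar>dG n k \<omega>\<bar> \<le> 2 + A \<omega>"
      using dX_bound[of \<omega> n k] g(3)[of k] assms by (simp add: nice_def)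
  qed simp
  also have "\<dots> = (\<Sum>k<n. \<bar>dG n k \<omega>\<bar>) * (2 + A \<omega>)" by (simp add: sum_distrib_right)
  also have "\<dots> \<le> A \<omega> * (2 + A \<omega>)" using g by (intro mult_right_mono) auto
  finally show "cross_variation n \<omega> \<le> 2 * A \<omega> + (A \<omega>)\<^sup>2" by (simp add: power2_eq_square algebra_simps)
  show "0 \<le> cross_variation n \<omega>" unfolding cross_variation_def by (intro sum_nonneg) auto
qed

lemma cross_variation_measurable [measurable]: "cross_variation n \<in> borel_measurable M"
  unfolding cross_variation_def by measurable

text \<open>Along a path the sum is at most the total variation of the drift integral times a
  multiple of the largest increment, which tends to 0; \<open>2 * A + A\<^sup>2\<close>
  dominates.\<close>

lemma cross_variation_limit: "(\<lambda>n. expectation (cross_variation n)) \<longlonglongrightarrow> 0"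
proof -
  have "(\<lambda>n. expectation (cross_variation (Suc n))) \<longlonglongrightarrow> expectation (\<lambda>_. 0)"
  proof (rule integral_dominated_convergence[where w = "\<lambda>\<omega>. 2 * A \<omega> + (A \<omega>)\<^sup>2"])
    show "integrable M (\<lambda>\<omega>. 2 * A \<omega> + (A \<omega>)\<^sup>2)" using A_integrable by simp
    show "AE \<omega> in M. norm (cross_variation (Suc n) \<omega>) \<le> 2 * A \<omega> + (A \<omega>)\<^sup>2" for n
      using AE_nice by eventually_elim (use cross_variation_bound in auto)
    show "AE \<omega> in M. (\<lambda>n. cross_variation (Suc n) \<omega>) \<longlonglongrightarrow> 0"
      using AE_nice
    proof eventually_elim
      case (elim \<omega>)
      have cont: "continuous_on {0..T} (\<lambda>t. X t \<omega>)"
        using X_continuous[of \<omega>] elim by (auto simp: nice_def intro: continuous_on_subset)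
      have gi: "set_integrable lborel {0..T} (\<lambda>s. G s \<omega>)" using elim by (simp add: nice_def)
      have A0: "0 \<le> A \<omega>" by (rule G_nice(2)[OF elim, of 1]) simp
      have "(\<lambda>n. cross_variation n \<omega>) \<longlonglongrightarrow> 0"
      proof (rule tendstoI)
        fix e :: real assume e: "0 < e"
        define d where "d = e / (3 * A \<omega> + 1)"
        have d: "0 < d" using e A0 by (simp add: d_def)
        have dA: "3 * d * A \<omega> < e"
        proof -
          have "d * (3 * A \<omega> + 1) = e" using A0 by (simp add: d_def)
          then show ?thesis using d by (simp add: algebra_simps)
        qed
        show "\<forall>\<^sub>F n in sequentially. dist (cross_variation n \<omega>) 0 < e"
          using fine_grid[OF cont gi T_pos d]
        proof eventually_elim
          case (elim n)
          then have n: "0 < n" by simp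
          note g = G_nice[OF \<open>nice \<omega>\<close> n, folded dG_def]
          have "cross_variation n \<omega> \<le> (\<Sum>k<n. \<bar>dG n k \<omega>\<bar> * (3 * d))"
            unfolding cross_variation_def
          proof (intro sum_mono mult_left_mono)
            fix k assume k: "k \<in> {..<n}"
            then have "\<bar>dX n k \<omega>\<bar> \<le> d" "\<bar>dG n k \<omega>\<bar> \<le> d"
              using elim grid_order by (auto simp: dX_def dG_def)
            then show "2 * \<bar>dX n k \<omega>\<bar> + \<bar>dG n k \<omega>\<bar> \<le> 3 * d" by linarith
          qed simp
          also have "\<dots> = (\<Sum>k<n. \<bar>dG n k \<omega>\<bar>) * (3 * d)" by (simp add: sum_distrib_right)
          also have "\<dots> \<le> A \<omega> * (3 * d)" using g d by (intro mult_right_mono) auto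
          finally show ?case using dA cross_variation_bound(2)[OF \<open>nice \<omega>\<close> n] by (simp add: mult_ac)
        qed
      qed
      then show ?case by (rule LIMSEQ_Suc)
    qed
  qed auto
  then show ?thesis by (subst (asm) filterlim_sequentially_Suc) simp
qed

lemma flag_limit:
  assumes "0 < \<epsilon>" shows "(\<lambda>n. expectation (\<lambda>\<omega>. 1 - flag n \<epsilon> n \<omega>)) \<longlonglongrightarrow> 0"
proof -
  have "(\<lambda>n. expectation (\<lambda>\<omega>. 1 - flag n \<epsilon> n \<omega>)) \<longlonglongrightarrow> expectation (\<lambda>_. 0)"
  proof (rule integral_dominated_convergence[where w = "\<lambda>\<omega>. 1"])
    show "AE \<omega> in M. norm (1 - flag n \<epsilon> n \<omega>) \<le> 1" for n
      using flag_range by auto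
    show "AE \<omega> in M. (\<lambda>n. 1 - flag n \<epsilon> n \<omega>) \<longlonglongrightarrow> 0"
      using AE_nice
    proof eventually_elim
      case (elim \<omega>)
      have "\<forall>\<^sub>F n in sequentially. 1 - flag n \<epsilon> n \<omega> = 0"
        using flag_eventually[OF elim assms] by eventually_elim auto
      then show ?case by (rule tendsto_eventually)
    qed
  qed auto
  then show ?thesis by simp
qed

lemma drift_sum_measurable:
  assumes "f1 \<in> borel_measurable borel" "f2 \<in> borel_measurable borel"
  shows "drift_sum f1 f2 \<epsilon> n \<in> borel_measurable M"
proof -
  note [measurable] = X_compose_measurable[OF assms(1)] X_compose_measurable[OF assms(2)]
  show ?thesis unfolding drift_sum_def by measurable
qed

lemma drift_sum_bound:
  assumes C: "\<And>y. y \<in> {0..1} \<Longrightarrow> \<bar>f1 y\<bar> \<le> C" "\<And>y. y \<in> {0..1} \<Longrightarrow> \<bar>f2 y\<bar> \<le> C"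
    and \<omega>: "nice \<omega>" and n: "0 < n"
  shows "\<bar>drift_sum f1 f2 \<epsilon> n \<omega>\<bar> \<le> C * A \<omega> + C * (K\<^sup>2 * T)"
proof -
  have sp: "\<omega> \<in> space M" using \<omega> by (simp add: nice_def)
  have x: "X (grid T n k) \<omega> \<in> {0..1}" for k by (intro X01 grid_order sp)
  have C0: "0 \<le> C" using C(1)[of 0] by auto
  have w: "\<bar>flag n \<epsilon> k \<omega> * (v * z)\<bar> \<le> C * \<bar>z\<bar>" if "\<bar>v\<bar> \<le> C" for v z k
  proof -
    have "\<bar>flag n \<epsilon> k \<omega> * (v * z)\<bar> \<le> \<bar>v * z\<bar>"
      using flag_cases[of n \<epsilon> k \<omega>] by auto
    also have "\<dots> \<le> C * \<bar>z\<bar>" unfolding abs_mult using that by (intro mult_right_mono) auto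
    finally show ?thesis .
  qed
  have "\<bar>\<Sum>k<n. flag n \<epsilon> k \<omega> * (f1 (X (grid T n k) \<omega>) * dG n k \<omega>)\<bar> \<le> (\<Sum>k<n. C * \<bar>dG n k \<omega>\<bar>)"
    by (intro order_trans[OF sum_abs] sum_mono w C x)
  also have "\<dots> \<le> C * A \<omega>" unfolding sum_distrib_left [symmetric]
    using G_nice(1)[OF \<omega> n, folded dG_def] C0 by (intro mult_left_mono)
  finally have 1: "\<bar>\<Sum>k<n. flag n \<epsilon> k \<omega> * (f1 (X (grid T n k) \<omega>) * dG n k \<omega>)\<bar> \<le> C * A \<omega>" .
  have "\<bar>\<Sum>k<n. flag n \<epsilon> k \<omega> * (f2 (X (grid T n k) \<omega>) / 2 * dH n k \<omega>)\<bar> \<le> (\<Sum>k<n. C * \<bar>dH n k \<omega>\<bar>)"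
  proof (intro order_trans[OF sum_abs] sum_mono w)
    fix k show "\<bar>f2 (X (grid T n k) \<omega>) / 2\<bar> \<le> C" using C(2)[OF x[of k]] C0 by simp
  qed
  also have "\<dots> = C * (\<Sum>k<n. dH n k \<omega>)"
    using dH_nonneg[OF sp] by (simp add: sum_distrib_left)
  also have "\<dots> \<le> C * (K\<^sup>2 * T)" using dH_sum[OF sp n] C0 by (intro mult_left_mono)
  finally show ?thesis using 1 unfolding drift_sum_def by linarith
qed

lemma drift_sum_limit:
  assumes m: "f1 \<in> borel_measurable borel" "f2 \<in> borel_measurable borel"
    and cont: "continuous_on {0..1} f1" "continuous_on {0..1} f2"
    and C: "\<And>y. y \<in> {0..1} \<Longrightarrow> \<bar>f1 y\<bar> \<le> C" "\<And>y. y \<in> {0..1} \<Longrightarrow> \<bar>f2 y\<bar> \<le> C"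
    and \<epsilon>: "0 < \<epsilon>" and L: "drift_integral f1 f2 \<in> borel_measurable M"
  shows "integrable M (drift_integral f1 f2)"
    and "(\<lambda>n. expectation (drift_sum f1 f2 \<epsilon> n)) \<longlonglongrightarrow> expectation (drift_integral f1 f2)"
proof -
  have w: "integrable M (\<lambda>\<omega>. C * A \<omega> + C * (K\<^sup>2 * T))" using A_integrable by simp
  have b: "AE \<omega> in M. norm (drift_sum f1 f2 \<epsilon> (Suc n) \<omega>) \<le> C * A \<omega> + C * (K\<^sup>2 * T)" for n
    using AE_nice by eventually_elim (use drift_sum_bound[OF C] in auto)
  have l: "AE \<omega> in M. (\<lambda>n. drift_sum f1 f2 \<epsilon> (Suc n) \<omega>) \<longlonglongrightarrow> drift_integral f1 f2 \<omega>"
    using AE_nice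
  proof eventually_elim
    case (elim \<omega>)
    have sp: "\<omega> \<in> space M" and gi: "set_integrable lborel {0..T} (\<lambda>s. G s \<omega>)" using elim by (auto simp: nice_def)
    have fl: "\<forall>\<^sub>F n in sequentially. \<forall>k<n. flag n \<epsilon> k \<omega> = 1"
      using flag_eventually[OF elim \<epsilon>] by eventually_elim auto
    have cf2: "continuous_on {0..1} (\<lambda>y. f2 y / 2)" using cont(2) by (intro continuous_intros) auto
    have mf2: "(\<lambda>y. f2 y / 2) \<in> borel_measurable borel" using m(2) by measurable
    have "(\<lambda>n. drift_sum f1 f2 \<epsilon> n \<omega>) \<longlonglongrightarrow> drift_integral f1 f2 \<omega>"
      unfolding drift_sum_def drift_integral_def dG_def dH_def using T_pos
      by (intro tendsto_add riemann_sum_limit[OF X_continuous[OF sp] X01[OF _ sp] gi T_pos cont(1) m(1) fl]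
        riemann_sum_limit[OF X_continuous[OF sp] X01[OF _ sp] H2_set_integrable(1)[OF sp] T_pos cf2 mf2 fl]) auto
    then show ?case by (rule LIMSEQ_Suc)
  qed
  show "integrable M (drift_integral f1 f2)"
    by (rule integrable_dominated_convergence[OF L drift_sum_measurable[OF m] w l b])
  have "(\<lambda>n. expectation (drift_sum f1 f2 \<epsilon> (Suc n))) \<longlonglongrightarrow> expectation (drift_integral f1 f2)"
    by (rule integral_dominated_convergence[OF L drift_sum_measurable[OF m] w l b])
  then show "(\<lambda>n. expectation (drift_sum f1 f2 \<epsilon> n)) \<longlonglongrightarrow> expectation (drift_integral f1 f2)"
    by (subst (asm) filterlim_sequentially_Suc)
qed

lemma X_jointly_measurable: "(\<lambda>x. X (max 0 (snd x)) (fst x)) \<in> borel_measurable (M \<Otimes>\<^sub>M lborel)"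
  using sd by (intro adapted_continuous_jointly_measurable) (simp add: has_stochastic_differential_def)

lemma drift_integral_eq:
  assumes m: "f1 \<in> borel_measurable borel" "f2 \<in> borel_measurable borel"
    and cont: "continuous_on {0..1} f1" "continuous_on {0..1} f2" and \<omega>: "nice \<omega>"
  shows "path_integrable (\<lambda>r. f1 (X r \<omega>) * G r \<omega> + f2 (X r \<omega>) / 2 * (H r \<omega>)\<^sup>2) T"
    and "drift_integral f1 f2 \<omega> = incr_int (\<lambda>r. f1 (X r \<omega>) * G r \<omega> + f2 (X r \<omega>) / 2 * (H r \<omega>)\<^sup>2) 0 T"
proof -
  have sp: "\<omega> \<in> space M" and gi: "path_integrable (\<lambda>s. G s \<omega>) T"
    using \<omega> by (auto simp: nice_def intro: path_integrable_set_integrable)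
  have cf2: "continuous_on {0..1} (\<lambda>y. f2 y / 2)" using cont(2) by (intro continuous_intros) auto
  have mf2: "(\<lambda>y. f2 y / 2) \<in> borel_measurable borel" using m(2) by measurable
  have i1: "path_integrable (\<lambda>r. f1 (X r \<omega>) * G r \<omega>) T"
    by (rule path_integrable_compose[OF X_continuous[OF sp] X01[OF _ sp] gi cont(1) m(1)])
  have i2: "path_integrable (\<lambda>r. f2 (X r \<omega>) / 2 * (H r \<omega>)\<^sup>2) T"
    using T_pos by (intro path_integrable_compose[OF X_continuous[OF sp] X01[OF _ sp] _ cf2 mf2] H2_set_integrable(2)[OF sp]) auto
  show "path_integrable (\<lambda>r. f1 (X r \<omega>) * G r \<omega> + f2 (X r \<omega>) / 2 * (H r \<omega>)\<^sup>2) T"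
    using i1 i2 by (simp add: path_integrable_def distrib_left)
  show "drift_integral f1 f2 \<omega> = incr_int (\<lambda>r. f1 (X r \<omega>) * G r \<omega> + f2 (X r \<omega>) / 2 * (H r \<omega>)\<^sup>2) 0 T"
    using i1 i2 by (simp add: drift_integral_def incr_int_def path_integrable_def distrib_left)
qed

lemma drift_integral_measurable:
  assumes [measurable]: "f1 \<in> borel_measurable borel" "f2 \<in> borel_measurable borel"
  shows "drift_integral f1 f2 \<in> borel_measurable M"
proof -
  note [measurable] = X_jointly_measurable H_measurable G_measurable
  show ?thesis unfolding drift_integral_def
    by (intro borel_measurable_add incr_int_measurable) measurable
qed

text \<open>Increments are Taylor expanded along a grid,
  but only up to the first step exceeding \<open>\<epsilon>\<close> (the factor \<open>flag\<close>); this keeps the weights adapted and makes the cubic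
  remainder \<open>\<epsilon>\<close> times the quadratic variation, so that no fourth moments are needed.\<close>

theorem dynkin:
  assumes m: "f \<in> borel_measurable borel" "f1 \<in> borel_measurable borel" "f2 \<in> borel_measurable borel"
    and cont: "continuous_on {0..1} f1" "continuous_on {0..1} f2"
    and C: "\<And>y. y \<in> {0..1} \<Longrightarrow> \<bar>f y\<bar> \<le> C" "\<And>y. y \<in> {0..1} \<Longrightarrow> \<bar>f1 y\<bar> \<le> C" "\<And>y. y \<in> {0..1} \<Longrightarrow> \<bar>f2 y\<bar> \<le> C"
    and Taylor: "\<And>y z. y \<in> {0..1} \<Longrightarrow> z \<in> {0..1} \<Longrightarrow>
       \<bar>f z - f y - f1 y * (z - y) - f2 y / 2 * (z - y)\<^sup>2\<bar> \<le> C * \<bar>z - y\<bar> ^ 3"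
  shows "integrable M (drift_integral f1 f2)"
    and "expectation (\<lambda>\<omega>. f (X T \<omega>)) - expectation (\<lambda>\<omega>. f (X 0 \<omega>)) = expectation (drift_integral f1 f2)"
proof -
  note L = drift_integral_measurable[OF m(2,3)]
  show "integrable M (drift_integral f1 f2)"
    by (rule drift_sum_limit(1)[OF m(2,3) cont C(2,3) zero_less_one L])
  have C0: "0 \<le> C" using C(1)[of 0] by auto
  have fi: "integrable M (\<lambda>\<omega>. f (X t \<omega>))" if "0 \<le> t" for t
    by (rule integrable_const_bound[where B = C])
       (use X01[OF that] C(1) in \<open>auto intro!: AE_I2 measurable_compose[OF X_measurable[OF that] m(1)]\<close>)
  define Q where "Q = 2 * (K\<^sup>2 * T) + 2 * expectation (\<lambda>\<omega>. (A \<omega>)\<^sup>2)"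
  define E where "E = expectation (\<lambda>\<omega>. f (X T \<omega>)) - expectation (\<lambda>\<omega>. f (X 0 \<omega>))"
  have est: "\<bar>E - expectation (drift_sum f1 f2 \<epsilon> n)\<bar>
      \<le> 3 * C * expectation (\<lambda>\<omega>. 1 - flag n \<epsilon> n \<omega>) + C * \<epsilon> * Q + C * expectation (cross_variation n)"
    if n: "0 < n" and \<epsilon>: "0 < \<epsilon>" for n \<epsilon>
  proof -
    let ?x = "\<lambda>k. X (grid T n k)"
    \<comment> \<open>\<open>M1\<close> and \<open>M2\<close> collect the martingale terms, namely
      weights known at the left end of a step times \<open>dJ\<close> or
      \<open>(dJ)\<^sup>2 - dH\<close>. Their expectations vanish, so subtracting them leaves the
      expectation of the remainder unchanged.\<close>
    define M1 where "M1 \<omega> = (\<Sum>k<n. (flag n \<epsilon> k \<omega> * f1 (?x k \<omega>)) * dJ n k \<omega>)" for \<omega>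
    define M2 where "M2 \<omega> = (\<Sum>k<n. (flag n \<epsilon> k \<omega> * (f2 (?x k \<omega>) / 2)) * ((dJ n k \<omega>)\<^sup>2 - dH n k \<omega>))" for \<omega>
    have bw: "\<bar>flag n \<epsilon> k \<omega> * v\<bar> \<le> C" if "\<bar>v\<bar> \<le> C" for k \<omega> v
      using flag_cases[of n \<epsilon> k \<omega>] that C0 by auto
    have x01: "?x k \<omega> \<in> {0..1}" if "\<omega> \<in> space M" for k \<omega> by (intro X01 grid_order that)
    have b1: "\<bar>flag n \<epsilon> k \<omega> * f1 (?x k \<omega>)\<bar> \<le> C" if "\<omega> \<in> space M" for k \<omega>
      by (intro bw C x01 that)
    have b2: "\<bar>flag n \<epsilon> k \<omega> * (f2 (?x k \<omega>) / 2)\<bar> \<le> C" if "\<omega> \<in> space M" for k \<omega>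
      using C(3)[OF x01[OF that, of k]] C0 by (intro bw) auto
    have F1: "(\<lambda>\<omega>. flag n \<epsilon> k \<omega> * f1 (?x k \<omega>)) \<in> borel_measurable (F (grid T n k))"
      and F2: "(\<lambda>\<omega>. flag n \<epsilon> k \<omega> * (f2 (?x k \<omega>) / 2)) \<in> borel_measurable (F (grid T n k))" for k
      by (intro borel_measurable_times borel_measurable_divide flag_adapted borel_measurable_const
          measurable_compose[OF X_adapted[OF grid_order(1)]] m)+
    have M1: "integrable M M1" "expectation M1 = 0"
      unfolding M1_def using weighted_increments(1,2)[OF F1 b1] by auto
    have M2: "integrable M M2" "expectation M2 = 0"
      unfolding M2_def using weighted_increments(3,4)[OF F2 b2] by auto
    have Ri: "integrable M (drift_sum f1 f2 \<epsilon> n)"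
    proof (rule Bochner_Integration.integrable_bound)
      show "integrable M (\<lambda>\<omega>. C * A \<omega> + C * (K\<^sup>2 * T))" using A_integrable by simp
      show "AE \<omega> in M. norm (drift_sum f1 f2 \<epsilon> n \<omega>) \<le> norm (C * A \<omega> + C * (K\<^sup>2 * T))"
        using AE_nice by eventually_elim (use drift_sum_bound[OF C(2,3) _ n] in \<open>auto intro: order_trans[OF _ abs_ge_self]\<close>)
    qed (rule drift_sum_measurable[OF m(2,3)])
    have ci: "integrable M (cross_variation n)"
    proof (rule Bochner_Integration.integrable_bound)
      show "integrable M (\<lambda>\<omega>. 2 * A \<omega> + (A \<omega>)\<^sup>2)" using A_integrable by simp
      show "AE \<omega> in M. norm (cross_variation n \<omega>) \<le> norm (2 * A \<omega> + (A \<omega>)\<^sup>2)"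
        using AE_nice by eventually_elim (use cross_variation_bound[OF _ n] in \<open>auto intro: order_trans[OF _ abs_ge_self]\<close>)
    qed simp
    note qi = quadratic_variation_integrable[of n]
    have gi: "integrable M (\<lambda>\<omega>. 1 - flag n \<epsilon> n \<omega>)"
      using flag_range by (intro integrable_const_bound[where B = 1]) auto
    define R where "R \<omega> = f (X T \<omega>) - f (X 0 \<omega>) - drift_sum f1 f2 \<epsilon> n \<omega> - M1 \<omega> - M2 \<omega>" for \<omega>
    define U where "U \<omega> = 3 * C * (1 - flag n \<epsilon> n \<omega>) + C * \<epsilon> * (\<Sum>k<n. (dX n k \<omega>)\<^sup>2) + C * cross_variation n \<omega>" for \<omega>
    have Ri': "integrable M R" unfolding R_def using fi T_pos Ri M1 M2 by auto
    have Ui: "integrable M U" unfolding U_def using qi ci gi by auto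
    have "AE \<omega> in M. \<bar>R \<omega>\<bar> \<le> U \<omega>"
      using AE_nice
    proof eventually_elim
      case (elim \<omega>)
      then have sp: "\<omega> \<in> space M" by (simp add: nice_def)
      define p where "p k = flag n \<epsilon> k \<omega>" for k
      \<comment> \<open>The second-order discrepancy between \<open>(dX)\<^sup>2\<close> and
        \<open>(dJ)\<^sup>2\<close>, bounded through \<open>cross_variation\<close>.\<close>
      define c where "c k = p k * (f2 (?x k \<omega>) / 2) * (dG n k \<omega> * (2 * dX n k \<omega> - dG n k \<omega>))" for k
      have "p k * (f1 (?x k \<omega>) * dX n k \<omega> + f2 (?x k \<omega>) / 2 * (dX n k \<omega>)\<^sup>2)
          = p k * (f1 (?x k \<omega>) * dG n k \<omega>) + p k * (f2 (?x k \<omega>) / 2 * dH n k \<omega>)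
            + (p k * f1 (?x k \<omega>)) * dJ n k \<omega> + (p k * (f2 (?x k \<omega>) / 2)) * ((dJ n k \<omega>)\<^sup>2 - dH n k \<omega>) + c k"
        if k: "k < n" for k
        unfolding c_def dX_eq[OF elim k] by (simp add: power2_eq_square algebra_simps)
      then have "(\<Sum>k<n. p k * (f1 (?x k \<omega>) * dX n k \<omega> + f2 (?x k \<omega>) / 2 * (dX n k \<omega>)\<^sup>2))
        = drift_sum f1 f2 \<epsilon> n \<omega> + M1 \<omega> + M2 \<omega> + (\<Sum>k<n. c k)"
        unfolding drift_sum_def M1_def M2_def p_def by (simp add: sum.distrib)
      then have R: "R \<omega> = (f (X T \<omega>) - f (X 0 \<omega>) - (\<Sum>k<n. p k * (f1 (?x k \<omega>) * dX n k \<omega> + f2 (?x k \<omega>) / 2 * (dX n k \<omega>)\<^sup>2)))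
          + (\<Sum>k<n. c k)"
        by (simp add: R_def)
      have "\<bar>f (X T \<omega>) - f (X 0 \<omega>) - (\<Sum>k<n. p k * (f1 (?x k \<omega>) * dX n k \<omega> + f2 (?x k \<omega>) / 2 * (dX n k \<omega>)\<^sup>2))\<bar>
        \<le> 3 * C * (1 - p n) + C * \<epsilon> * (\<Sum>k<n. (dX n k \<omega>)\<^sup>2)"
        unfolding p_def dX_def using \<epsilon> by (intro Taylor_sum[OF n sp _ C(1) Taylor]) auto
      moreover have "\<bar>\<Sum>k<n. c k\<bar> \<le> C * cross_variation n \<omega>"
        unfolding cross_variation_def sum_distrib_left
      proof (intro order_trans[OF sum_abs] sum_mono)
        fix k
        have "\<bar>dG n k \<omega> * (2 * dX n k \<omega> - dG n k \<omega>)\<bar> \<le> \<bar>dG n k \<omega>\<bar> * (2 * \<bar>dX n k \<omega>\<bar> + \<bar>dG n k \<omega>\<bar>)"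
          unfolding abs_mult by (intro mult_left_mono) auto
        then show "\<bar>c k\<bar> \<le> C * (\<bar>dG n k \<omega>\<bar> * (2 * \<bar>dX n k \<omega>\<bar> + \<bar>dG n k \<omega>\<bar>))"
          unfolding c_def abs_mult[of "p k * (f2 (?x k \<omega>) / 2)"] using b2[OF sp, of k] C0
          by (intro mult_mono) (auto simp: p_def)
      qed
      ultimately show ?case unfolding R U_def p_def by linarith
    qed
    then have "\<bar>expectation R\<bar> \<le> expectation U"
      by (intro order_trans[OF integral_abs_bound integral_mono_AE] integrable_abs Ri' Ui)
    moreover have "expectation R = E - expectation (drift_sum f1 f2 \<epsilon> n)"
      unfolding R_def E_def using fi T_pos Ri M1 M2 by simp
    moreover have "expectation U = 3 * C * expectation (\<lambda>\<omega>. 1 - flag n \<epsilon> n \<omega>)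
        + C * \<epsilon> * expectation (\<lambda>\<omega>. \<Sum>k<n. (dX n k \<omega>)\<^sup>2) + C * expectation (cross_variation n)"
    proof -
      have "expectation U = expectation (\<lambda>\<omega>. 3 * C * (1 - flag n \<epsilon> n \<omega>)) + expectation (\<lambda>\<omega>. C * \<epsilon> * (\<Sum>k<n. (dX n k \<omega>)\<^sup>2))
         + expectation (\<lambda>\<omega>. C * cross_variation n \<omega>)"
        unfolding U_def using qi ci gi by (subst Bochner_Integration.integral_add; (intro Bochner_Integration.integrable_add integrable_mult_right)?)+ auto
      then show ?thesis by (simp only: integral_mult_right_zero)
    qed
    moreover have "C * \<epsilon> * expectation (\<lambda>\<omega>. \<Sum>k<n. (dX n k \<omega>)\<^sup>2) \<le> C * \<epsilon> * Q"
      using quadratic_variation_bound[OF n] C0 \<epsilon> unfolding Q_def by (intro mult_left_mono) auto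
    ultimately show ?thesis by linarith
  qed
  \<comment> \<open>With \<open>\<epsilon>\<close> fixed, letting \<open>n\<close> tend to infinity
    removes the large steps and the cross terms; only afterwards does \<open>\<epsilon>\<close> go
    to 0.\<close>
  have lim: "\<bar>E - expectation (drift_integral f1 f2)\<bar> \<le> C * \<epsilon> * Q" if \<epsilon>: "0 < \<epsilon>" for \<epsilon>
  proof (rule LIMSEQ_le)
    show "(\<lambda>n. \<bar>E - expectation (drift_sum f1 f2 \<epsilon> n)\<bar>) \<longlonglongrightarrow> \<bar>E - expectation (drift_integral f1 f2)\<bar>"
      by (intro tendsto_intros drift_sum_limit(2)[OF m(2,3) cont C(2,3) \<epsilon> L])
    have "(\<lambda>n. 3 * C * expectation (\<lambda>\<omega>. 1 - flag n \<epsilon> n \<omega>) + C * \<epsilon> * Q + C * expectation (cross_variation n))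
      \<longlonglongrightarrow> 3 * C * 0 + C * \<epsilon> * Q + C * 0"
      by (intro tendsto_intros flag_limit cross_variation_limit \<epsilon>)
    then show "(\<lambda>n. 3 * C * expectation (\<lambda>\<omega>. 1 - flag n \<epsilon> n \<omega>) + C * \<epsilon> * Q + C * expectation (cross_variation n))
      \<longlonglongrightarrow> C * \<epsilon> * Q" by simp
    show "\<exists>N. \<forall>n\<ge>N. \<bar>E - expectation (drift_sum f1 f2 \<epsilon> n)\<bar>
      \<le> 3 * C * expectation (\<lambda>\<omega>. 1 - flag n \<epsilon> n \<omega>) + C * \<epsilon> * Q + C * expectation (cross_variation n)"
      using est[OF _ \<epsilon>] by (intro exI[of _ 1]) auto
  qed
  have "\<bar>E - expectation (drift_integral f1 f2)\<bar> \<le> 0"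
  proof (rule LIMSEQ_le_const)
    have "(\<lambda>n. C * (1 / real (Suc n)) * Q) \<longlonglongrightarrow> C * 0 * Q"
      by (intro tendsto_intros LIMSEQ_Suc lim_1_over_n)
    then show "(\<lambda>n. C * (1 / real (Suc n)) * Q) \<longlonglongrightarrow> 0" by simp
    show "\<exists>N. \<forall>n\<ge>N. \<bar>E - expectation (drift_integral f1 f2)\<bar> \<le> C * (1 / real (Suc n)) * Q"
      using lim[of "1 / real (Suc _)"] by auto
  qed
  then show "expectation (\<lambda>\<omega>. f (X T \<omega>)) - expectation (\<lambda>\<omega>. f (X 0 \<omega>)) = expectation (drift_integral f1 f2)"
    by (simp add: E_def)
qed

end

section \<open>Moments of the Jacobi diffusion\<close>

text \<open>The remainder satisfies
  \<open>R (Suc n) = z * R n + n * (n - 1) / 2 * y ^ (n - 2) * d ^ 3\<close>, and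
  \<open>n ^ 3 + n ^ 2 \<le> (n + 1) ^ 3\<close> closes the induction. Truncated exponents do no
  harm because their coefficients vanish.\<close>

lemma power_Taylor:
  fixes y z :: real
  assumes "y \<in> {0..1}" "z \<in> {0..1}"
  shows "\<bar>z ^ n - y ^ n - (real n * y ^ (n - 1)) * (z - y) - (real n * real (n - 1) * y ^ (n - 2)) / 2 * (z - y)\<^sup>2\<bar>
    \<le> real n ^ 3 * \<bar>z - y\<bar> ^ 3"
proof (induction n)
  case (Suc n)
  define d where "d = z - y"
  define R where "R n = z ^ n - y ^ n - (real n * y ^ (n - 1)) * d - (real n * real (n - 1) * y ^ (n - 2)) / 2 * d\<^sup>2" for n
  have z: "z = y + d" by (simp add: d_def)
  have y1: "real n * y ^ n = y * (real n * y ^ (n - 1))" by (cases n) auto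
  have y2: "real n * real (n - 1) * y ^ (n - 1) = y * (real n * real (n - 1) * y ^ (n - 2))"
    by (cases n; cases "n - 1") auto
  have r1: "real (Suc n) * y ^ n = real n * y ^ n + y ^ n" by (simp add: algebra_simps)
  have r2: "real (Suc n) * real n * y ^ (n - 1) = real n * real (n - 1) * y ^ (n - 1) + 2 * (real n * y ^ (n - 1))"
    by (cases n) (auto simp: algebra_simps)
  have "R (Suc n) = z * z ^ n - y * y ^ n - (real n * y ^ n + y ^ n) * d
      - (real n * real (n - 1) * y ^ (n - 1) + 2 * (real n * y ^ (n - 1))) / 2 * d\<^sup>2"
    unfolding R_def using r1 r2 by simp
  also have "\<dots> = z * R n + (real n * real (n - 1) * y ^ (n - 2)) / 2 * d ^ 3"
    unfolding y1 y2 R_def unfolding z by (simp add: power2_eq_square power3_eq_cube field_simps)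
  finally have e: "R (Suc n) = z * R n + (real n * real (n - 1) * y ^ (n - 2)) / 2 * d ^ 3" .
  have b1: "\<bar>z * R n\<bar> \<le> real n ^ 3 * \<bar>d\<bar> ^ 3"
  proof -
    have "\<bar>z * R n\<bar> \<le> \<bar>R n\<bar>" unfolding abs_mult using assms by (intro mult_left_le_one_le) auto
    also have "\<dots> \<le> real n ^ 3 * \<bar>d\<bar> ^ 3" using Suc unfolding R_def d_def .
    finally show ?thesis .
  qed
  have b2: "\<bar>(real n * real (n - 1) * y ^ (n - 2)) / 2 * d ^ 3\<bar> \<le> real n ^ 2 * \<bar>d\<bar> ^ 3"
  proof -
    have yp: "0 \<le> y ^ (n - 2)" "y ^ (n - 2) \<le> 1" using assms by (auto intro: power_le_one)
    have "real n * real (n - 1) * y ^ (n - 2) \<le> real n * real n * 1"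
      using yp by (intro mult_mono) auto
    moreover have "0 \<le> real n * real (n - 1) * y ^ (n - 2)" using yp by simp
    ultimately have "\<bar>(real n * real (n - 1) * y ^ (n - 2)) / 2\<bar> \<le> real n ^ 2"
      by (simp add: power2_eq_square)
    then show ?thesis unfolding abs_mult power_abs by (intro mult_right_mono) auto
  qed
  have "\<bar>R (Suc n)\<bar> \<le> real n ^ 3 * \<bar>d\<bar> ^ 3 + real n ^ 2 * \<bar>d\<bar> ^ 3"
    unfolding e using b1 b2 by linarith
  also have "\<dots> = (real n ^ 3 + real n ^ 2) * \<bar>d\<bar> ^ 3" by (simp add: algebra_simps)
  also have "\<dots> \<le> real (Suc n) ^ 3 * \<bar>d\<bar> ^ 3"
  proof (rule mult_right_mono)
    show "real n ^ 3 + real n ^ 2 \<le> real (Suc n) ^ 3"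
      by (simp add: power2_eq_square power3_eq_cube algebra_simps)
  qed simp
  finally show ?case by (simp add: R_def d_def)
qed simp

lemma has_derivative_if_incr_int:
  fixes u R :: "real \<Rightarrow> real"
  assumes R: "continuous_on {0..T} R"
    and u: "\<And>t. 0 < t \<Longrightarrow> t \<le> T \<Longrightarrow> u t - u 0 = incr_int R 0 t" and t: "t \<in> {0..T}"
  shows "(u has_real_derivative R t) (at t within {0..T})"
proof -
  have d: "((\<lambda>x. u 0 + integral {0..x} R) has_real_derivative R t) (at t within {0..T})"
    using integral_has_real_derivative[OF R t] by (auto intro!: derivative_eq_intros)
  have i: "u x = u 0 + integral {0..x} R" if x: "x \<in> {0..T}" for x
  proof (cases "x = 0")
    case False
    have s: "set_integrable lborel {0..x} R"
      by (rule borel_integrable_atLeastAtMost') (rule continuous_on_subset[OF R], use x in auto)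
    have "incr_int R 0 x = set_lebesgue_integral lborel {0..x} R"
      using s x by (intro incr_int_from_0) auto
    also have "set_lebesgue_integral lborel {0..x} R = integral {0..x} R"
      using s by (rule set_borel_integral_eq_integral)
    finally show ?thesis using u[of x] x False by simp
  qed simp
  show ?thesis
    by (rule has_field_derivative_transform_within[OF d zero_less_one t]) (rule i[symmetric])
qed

context wiener
begin

lemma continuous_moment:
  assumes X: "adapted_continuous M F X" and X01: "\<And>t \<omega>. 0 \<le> t \<Longrightarrow> \<omega> \<in> space M \<Longrightarrow> X t \<omega> \<in> {0..1}"
  shows "continuous_on {0..} (\<lambda>t. expectation (\<lambda>\<omega>. X t \<omega> ^ n))"
proof (rule continuous_on_sequentiallyI)
  fix u a assume u: "\<forall>n. u n \<in> {0..}" and a: "a \<in> {0..}" and lim: "u \<longlonglongrightarrow> (a :: real)"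
  have m: "X t \<in> borel_measurable M" if "0 \<le> t" for t
    using X that measurable_F by (auto simp: adapted_continuous_def)
  have p: "(\<lambda>\<omega>. X t \<omega> ^ n) \<in> borel_measurable M" if "0 \<le> t" for t using m[OF that] by measurable
  show "(\<lambda>k. expectation (\<lambda>\<omega>. X (u k) \<omega> ^ n)) \<longlonglongrightarrow> expectation (\<lambda>\<omega>. X a \<omega> ^ n)"
  proof (rule integral_dominated_convergence[where w = "\<lambda>_. 1"])
    show "AE \<omega> in M. (\<lambda>k. X (u k) \<omega> ^ n) \<longlonglongrightarrow> X a \<omega> ^ n"
    proof (rule AE_I2)
      fix \<omega> assume "\<omega> \<in> space M"
      then have c: "continuous_on {0..} (\<lambda>t. X t \<omega>)" using X by (simp add: adapted_continuous_def)
      show "(\<lambda>k. X (u k) \<omega> ^ n) \<longlonglongrightarrow> X a \<omega> ^ n"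
        using u a by (intro tendsto_power continuous_on_tendsto_compose[OF c lim]) auto
    qed
    show "AE \<omega> in M. norm (X (u k) \<omega> ^ n) \<le> 1" for k
      using X01[of "u k"] u by (intro AE_I2) (auto simp: power_abs intro!: power_le_one)
  qed (use p u a in auto)
qed

end

context bounded_ito_process
begin

lemma power_dynkin:
  fixes n :: nat
  defines "f1 \<equiv> \<lambda>y. real (Suc n) * y ^ n" and "f2 \<equiv> \<lambda>y. real (Suc n) * real n * y ^ (n - 1)"
  shows "integrable M (drift_integral f1 f2)"
    and "expectation (\<lambda>\<omega>. X T \<omega> ^ Suc n) - expectation (\<lambda>\<omega>. X 0 \<omega> ^ Suc n) = expectation (drift_integral f1 f2)"
proof -
  have p: "\<bar>y ^ k\<bar> \<le> 1" if "y \<in> {0..1}" for y :: real and k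
    using that by (auto simp: power_abs intro!: power_le_one)
  have n1: "1 \<le> real (Suc n) ^ 3" "real (Suc n) \<le> real (Suc n) ^ 3" "real (Suc n) * real n \<le> real (Suc n) ^ 3"
    by (auto simp: power3_eq_cube algebra_simps)
  have C0: "\<bar>y ^ Suc n\<bar> \<le> real (Suc n) ^ 3" if "y \<in> {0..1}" for y :: real
    using p[OF that, of "Suc n"] n1 by linarith
  have C1: "\<bar>f1 y\<bar> \<le> real (Suc n) ^ 3" if "y \<in> {0..1}" for y
  proof -
    have "\<bar>f1 y\<bar> \<le> real (Suc n) * 1" unfolding f1_def abs_mult using p[OF that, of n] by (intro mult_mono) auto
    then show ?thesis using n1(2) by (metis mult.right_neutral order_trans)
  qed
  have C2: "\<bar>f2 y\<bar> \<le> real (Suc n) ^ 3" if "y \<in> {0..1}" for y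
  proof -
    have "\<bar>f2 y\<bar> \<le> (real (Suc n) * real n) * 1" unfolding f2_def abs_mult using p[OF that, of "n - 1"] by (intro mult_mono) auto
    then show ?thesis using n1(3) by (metis mult.right_neutral order_trans)
  qed
  have T: "\<bar>z ^ Suc n - y ^ Suc n - f1 y * (z - y) - f2 y / 2 * (z - y)\<^sup>2\<bar> \<le> real (Suc n) ^ 3 * \<bar>z - y\<bar> ^ 3"
    if "y \<in> {0..1}" "z \<in> {0..1}" for y z
    using power_Taylor[OF that, of "Suc n"] by (simp add: f1_def f2_def)
  note D = dynkin[where f = "\<lambda>y. y ^ Suc n", OF _ _ _ _ _ C0 C1 C2 T]
  show "integrable M (drift_integral f1 f2)"
    by (rule D) (auto simp: f1_def f2_def intro!: continuous_intros)
  show "expectation (\<lambda>\<omega>. X T \<omega> ^ Suc n) - expectation (\<lambda>\<omega>. X 0 \<omega> ^ Suc n) = expectation (drift_integral f1 f2)"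
    by (rule D) (auto simp: f1_def f2_def intro!: continuous_intros)
qed

end

lemma jacobi_diffusion_le_1:
  fixes y :: real
  assumes "y \<in> {0..1}" shows "\<bar>sqrt (2 * y * (1 - y))\<bar> \<le> 1"
proof -
  have "0 \<le> (2 * y - 1)\<^sup>2" by simp
  then have "2 * y * (1 - y) \<le> 1" by (simp add: power2_eq_square algebra_simps)
  moreover have "0 \<le> 2 * y * (1 - y)" using assms by simp
  ultimately show ?thesis by simp
qed

text \<open>The generator maps \<open>y ^ Suc n\<close> to \<open>p * y ^ n - q * y ^ Suc n\<close>:
  the drift contributes \<open>Suc n\<close> times its own coefficients, and half the second
  derivative times \<open>2 * y * (1 - y)\<close> adds \<open>Suc n * n\<close> to both
  \<open>p\<close> and \<open>q\<close>. Dynkin's formula and Fubini's theorem give the integrated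
  equation, and continuity of the moments its differential form.\<close>

lemma (in wiener) jacobi_moment_equation:
  fixes a b c T :: real
  assumes sd: "has_stochastic_differential M F B Y (\<lambda>t \<omega>. sqrt (2 * Y t \<omega> * (1 - Y t \<omega>)))
           (\<lambda>t \<omega>. (a + c + 1) - (a + b + 2 * c + 2) * Y t \<omega>)"
    and Y01: "\<And>t \<omega>. 0 \<le> t \<Longrightarrow> \<omega> \<in> space M \<Longrightarrow> Y t \<omega> \<in> {0..1}"
    and t: "t \<in> {0..T}"
  defines "y \<equiv> \<lambda>t n. expectation (\<lambda>\<omega>. Y t \<omega> ^ n)"
  shows "((\<lambda>t. y t (Suc n)) has_real_derivative
        real (Suc n) * (a + c + real n + 1) * y t n
        - real (Suc n) * (a + b + 2 * c + real n + 2) * y t (Suc n)) (at t within {0..T})"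
proof (rule has_derivative_if_incr_int[OF _ _ t])
  have ac: "adapted_continuous M F Y" using sd by (simp add: has_stochastic_differential_def)
  note [measurable] = adapted_continuous_jointly_measurable[OF ac]
  have "continuous_on {0..T} (\<lambda>t. y t k)" for k
    unfolding y_def by (rule continuous_on_subset[OF continuous_moment[OF ac Y01]]) auto
  then show "continuous_on {0..T} (\<lambda>t. real (Suc n) * (a + c + real n + 1) * y t n
        - real (Suc n) * (a + b + 2 * c + real n + 2) * y t (Suc n))"
    by (intro continuous_intros)
  \<comment> \<open>From here on \<open>T\<close> is the upper limit of the integrated equation, an
    arbitrary positive time.\<close>
  fix T :: real assume T: "0 < T"
  define G where "G t \<omega> = (a + c + 1) - (a + b + 2 * c + 2) * Y t \<omega>" for t \<omega>
  define D where "D = \<bar>a + c + 1\<bar> + \<bar>a + b + 2 * c + 2\<bar>"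
  have Gb: "\<bar>G t \<omega>\<bar> \<le> D" if "0 \<le> t" "\<omega> \<in> space M" for t \<omega>
  proof -
    have "\<bar>(a + b + 2 * c + 2) * Y t \<omega>\<bar> \<le> \<bar>a + b + 2 * c + 2\<bar>"
      unfolding abs_mult using Y01[OF that] by (intro mult_left_le) auto
    then show ?thesis unfolding G_def D_def by linarith
  qed
  have Gm [measurable]: "(\<lambda>x. G (max 0 (snd x)) (fst x)) \<in> borel_measurable (M \<Otimes>\<^sub>M lborel)"
    unfolding G_def by measurable
  interpret bounded_ito_process M F B Y "\<lambda>t \<omega>. sqrt (2 * Y t \<omega> * (1 - Y t \<omega>))" G "\<lambda>_. D * T" 1 T
  proof
    show "has_stochastic_differential M F B Y (\<lambda>t \<omega>. sqrt (2 * Y t \<omega> * (1 - Y t \<omega>))) G"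
      unfolding G_def [abs_def] by (rule sd)
    show "\<bar>sqrt (2 * Y t \<omega> * (1 - Y t \<omega>))\<bar> \<le> 1" if "0 \<le> t" "\<omega> \<in> space M" for t \<omega>
      by (rule jacobi_diffusion_le_1[OF Y01[OF that]])
    show "sq_int M (\<lambda>_. D * T)" by (simp add: sq_int_def)
    show "AE \<omega> in M. incr_int (\<lambda>r. \<bar>G r \<omega>\<bar>) 0 T \<le> D * T"
    proof (rule AE_I2)
      fix \<omega> assume \<omega>: "\<omega> \<in> space M"
      have m: "(\<lambda>r. G (max 0 r) \<omega>) \<in> borel_measurable lborel"
        using measurable_compose[OF measurable_Pair1'[OF \<omega>] Gm] by simp
      have i: "integrable lborel (\<lambda>r. D * indicator {0<..T} r)"
        using T by (intro integrable_mult_right integrable_real_indicator) auto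
      have "incr_int (\<lambda>r. \<bar>G r \<omega>\<bar>) 0 T \<le> (LINT r|lborel. D * indicator {0<..T} r)"
        unfolding incr_int_def
      proof (rule integral_mono[OF _ i])
        show "integrable lborel (\<lambda>r. indicator {0<..T} r * \<bar>G (max 0 r) \<omega>\<bar>)"
        proof (rule Bochner_Integration.integrable_bound[OF i])
          show "AE r in lborel. norm (indicator {0<..T} r * \<bar>G (max 0 r) \<omega>\<bar>) \<le> norm (D * indicator {0<..T} r)"
            using Gb \<omega> by (intro AE_I2) (auto simp: abs_mult indicator_def max_def intro: order_trans[OF Gb abs_ge_self])
        qed (use m in simp)
        show "indicator {0<..T} r * \<bar>G (max 0 r) \<omega>\<bar> \<le> D * indicator {0<..T} r" for r
          using Gb[of "max 0 r" \<omega>] \<omega> by (auto simp: indicator_def)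
      qed
      then show "incr_int (\<lambda>r. \<bar>G r \<omega>\<bar>) 0 T \<le> D * T" using T by simp
    qed
  qed (use Y01 T in \<open>auto intro: Gm\<close>)
  define p where "p = real (Suc n) * (a + c + real n + 1)"
  define q where "q = real (Suc n) * (a + b + 2 * c + real n + 2)"
  let ?f1 = "\<lambda>y. real (Suc n) * y ^ n" and ?f2 = "\<lambda>y. real (Suc n) * real n * y ^ (n - 1)"
  have Ym: "Y (max 0 r) \<in> borel_measurable M" for r by (rule X_measurable) simp
  have Yr: "(\<lambda>r. Y (max 0 r) \<omega>) \<in> borel_measurable lborel" if "\<omega> \<in> space M" for \<omega>
    using measurable_compose[OF measurable_Pair1'[OF that] X_jointly_measurable] by simp
  have Yb: "\<bar>Y (max 0 r) \<omega> ^ k\<bar> \<le> 1" if "\<omega> \<in> space M" for r \<omega> k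
    using Y01[of "max 0 r" \<omega>] that by (auto simp: power_abs intro!: power_le_one)
  have Yb': "\<bar>Y r \<omega> ^ k\<bar> \<le> 1" if "\<omega> \<in> space M" "0 \<le> r" for r \<omega> k
    using Yb[OF that(1), of r k] that(2) by (simp add: max_def)
  define S where "S k x = indicator {0<..T} (snd x) * Y (max 0 (snd x)) (fst x) ^ k" for k x
  have Si: "integrable (M \<Otimes>\<^sub>M lborel) (S k)" for k
  proof -
    have "sq_int (M \<Otimes>\<^sub>M lborel) (\<lambda>x. indicator {0<..T} (snd x) :: real)"
      by (rule sq_int_strip[where C = 1 and s = 0 and t = T]) auto
    moreover have "sq_int (M \<Otimes>\<^sub>M lborel) (S k)"
      unfolding S_def by (rule sq_int_strip[where C = 1 and s = 0 and t = T]) (use Yb' in \<open>auto simp: indicator_def\<close>)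
    ultimately have "integrable (M \<Otimes>\<^sub>M lborel) (\<lambda>x. indicator {0<..T} (snd x) * S k x)" by (rule sq_int_mult)
    moreover have "indicator {0<..T} (snd x) * S k x = S k x" for x by (simp add: S_def indicator_def)
    ultimately show ?thesis by (simp only:)
  qed
  have e: "drift_integral ?f1 ?f2 \<omega> = p * (LINT r|lborel. S n (\<omega>, r)) - q * (LINT r|lborel. S (Suc n) (\<omega>, r))"
    if \<omega>: "\<omega> \<in> space M" for \<omega>
  proof -
    have i0: "integrable lborel (indicator {0<..T} :: real \<Rightarrow> real)" using T by (intro integrable_real_indicator) auto
    have iS: "integrable lborel (\<lambda>r. S k (\<omega>, r))" for k
    proof (rule Bochner_Integration.integrable_bound[OF i0])
      show "(\<lambda>r. S k (\<omega>, r)) \<in> borel_measurable lborel" unfolding S_def using Yr[OF \<omega>] by simp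
      show "AE r in lborel. norm (S k (\<omega>, r)) \<le> norm (indicator {0<..T} r :: real)"
        using Yb'[OF \<omega>] by (intro AE_I2) (auto simp: S_def indicator_def)
    qed
    have s2: "(sqrt (2 * Y (max 0 r) \<omega> * (1 - Y (max 0 r) \<omega>)))\<^sup>2 = 2 * Y (max 0 r) \<omega> * (1 - Y (max 0 r) \<omega>)" for r
      using Y01[of "max 0 r" \<omega>] \<omega> by (intro real_sqrt_pow2) simp
    have 1: "indicator {0<..T} r * (?f1 (Y (max 0 r) \<omega>) * G (max 0 r) \<omega>)
        = real (Suc n) * (a + c + 1) * S n (\<omega>, r) - real (Suc n) * (a + b + 2 * c + 2) * S (Suc n) (\<omega>, r)" for r
      by (simp add: S_def G_def algebra_simps)
    have 2: "indicator {0<..T} r * (?f2 (Y (max 0 r) \<omega>) / 2 * (2 * Y (max 0 r) \<omega> * (1 - Y (max 0 r) \<omega>)))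
        = real (Suc n) * real n * S n (\<omega>, r) - real (Suc n) * real n * S (Suc n) (\<omega>, r)" for r
    proof (cases n)
      case (Suc k)
      have "i * (l * v ^ k / 2 * (2 * v * (1 - v))) = l * (i * v ^ Suc k) - l * (i * v ^ Suc (Suc k))" for i l v :: real
        by (simp add: field_simps)
      then show ?thesis unfolding S_def Suc fst_conv snd_conv diff_Suc_1 .
    qed simp
    have "drift_integral ?f1 ?f2 \<omega> = (real (Suc n) * (a + c + 1) * (LINT r|lborel. S n (\<omega>, r))
         - real (Suc n) * (a + b + 2 * c + 2) * (LINT r|lborel. S (Suc n) (\<omega>, r)))
       + (real (Suc n) * real n * (LINT r|lborel. S n (\<omega>, r)) - real (Suc n) * real n * (LINT r|lborel. S (Suc n) (\<omega>, r)))"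
      unfolding drift_integral_def incr_int_def s2 1 2 using iS by simp
    then show ?thesis by (simp add: p_def q_def algebra_simps)
  qed
  have Sy: "(\<integral>r. expectation (\<lambda>\<omega>. S k (\<omega>, r)) \<partial>lborel) = (LINT r|lborel. indicator {0<..T} r * y (max 0 r) k)" for k
    by (simp add: S_def y_def)
  have Sint: "integrable lborel (\<lambda>r. indicator {0<..T} r * y (max 0 r) k)" for k
  proof -
    have "integrable (M \<Otimes>\<^sub>M lborel) (\<lambda>(\<omega>, r). S k (\<omega>, r))" using Si[of k] by (simp add: split_def)
    from time.integrable_snd[OF this] show ?thesis by (simp add: S_def y_def)
  qed
  have "y T (Suc n) - y 0 (Suc n) = expectation (drift_integral ?f1 ?f2)"
    unfolding y_def by (rule power_dynkin(2))
  also have "\<dots> = expectation (\<lambda>\<omega>. p * (LINT r|lborel. S n (\<omega>, r)) - q * (LINT r|lborel. S (Suc n) (\<omega>, r)))"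
    by (intro Bochner_Integration.integral_cong refl e)
  also have "\<dots> = p * expectation (\<lambda>\<omega>. LINT r|lborel. S n (\<omega>, r)) - q * expectation (\<lambda>\<omega>. LINT r|lborel. S (Suc n) (\<omega>, r))"
    using time.integrable_fst'[OF Si] by simp
  also have "\<dots> = p * (LINT r|lborel. indicator {0<..T} r * y (max 0 r) n) - q * (LINT r|lborel. indicator {0<..T} r * y (max 0 r) (Suc n))"
    using time.Fubini_integral[of "\<lambda>\<omega> r. S n (\<omega>, r)"] time.Fubini_integral[of "\<lambda>\<omega> r. S (Suc n) (\<omega>, r)"] Si
    by (simp add: Sy)
  also have "\<dots> = incr_int (\<lambda>t. p * y t n - q * y t (Suc n)) 0 T"
    unfolding incr_int_def using Sint by (simp add: right_diff_distrib mult.left_commute)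
  finally show "y T (Suc n) - y 0 (Suc n) = incr_int (\<lambda>t. real (Suc n) * (a + c + real n + 1) * y t n
        - real (Suc n) * (a + b + 2 * c + real n + 2) * y t (Suc n)) 0 T"
    unfolding p_def q_def .
qed

section \<open>Moments of the beta Jacobi process\<close>

lemma sum_offdiagonal_swap:
  fixes g :: "'a \<Rightarrow> 'a \<Rightarrow> real"
  assumes "finite S"
  shows "(\<Sum>i\<in>S. \<Sum>j\<in>S - {i}. g i j) = (\<Sum>i\<in>S. \<Sum>j\<in>S - {i}. g j i)"
proof -
  have e: "(\<Sum>j\<in>S - {i}. h j) = (\<Sum>j\<in>S. if i = j then 0 else h j)" for i and h :: "'a \<Rightarrow> real"
    using assms by (intro sum.mono_neutral_cong_left) auto
  have "(\<Sum>i\<in>S. \<Sum>j\<in>S - {i}. g i j) = (\<Sum>j\<in>S. \<Sum>i\<in>S. if i = j then 0 else g i j)"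
    unfolding e by (rule sum.swap)
  also have "\<dots> = (\<Sum>i\<in>S. \<Sum>j\<in>S - {i}. g j i)"
    unfolding e by (intro sum.cong refl) auto
  finally show ?thesis .
qed

lemma sum_offdiagonal_symmetrize:
  fixes g :: "'a \<Rightarrow> 'a \<Rightarrow> real"
  assumes "finite S"
  shows "2 * (\<Sum>i\<in>S. \<Sum>j\<in>S - {i}. g i j) = (\<Sum>i\<in>S. \<Sum>j\<in>S - {i}. g i j + g j i)"
  using sum_offdiagonal_swap[OF assms, of g] by (simp add: sum.distrib)

text \<open>Why the singular drift is harmless: the repulsion terms of the particles \<open>k, ..., N\<close> among themselves cancel up to bounded
  terms, while those coming from the particles below \<open>k\<close> are nonnegative. Hence every single repulsion
  term is controlled by a sum of drifts, whose time integrals are square integrable by the equation.\<close>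

lemma beta_jacobi_drift_dominated:
  fixes x :: "nat \<Rightarrow> real" and a b \<beta> :: real
  assumes x01: "\<And>i. i \<in> {1..N} \<Longrightarrow> x i \<in> {0..1}"
    and ord: "\<And>i j. i \<in> {1..N} \<Longrightarrow> j \<in> {1..N} \<Longrightarrow> i \<le> j \<Longrightarrow> x i \<le> x j"
    and \<beta>: "0 \<le> \<beta>" and i: "i \<in> {1..N}"
  defines "D \<equiv> \<bar>a + 1\<bar> + \<bar>a + b + 2\<bar>" and "\<kappa> \<equiv> \<beta> / 2"
  shows "\<bar>beta_jacobi_drift N a b \<beta> x i\<bar> \<le>
    D + real N * (real N * (real N * D + \<kappa> * (real N * real N)) + 2 * \<kappa>)
      + real N * (\<Sum>k\<in>{1..N}. \<Sum>i\<in>{k..N}. beta_jacobi_drift N a b \<beta> x i)"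
proof -
  define s where "s i j = 2 * x i * (1 - x i) / (x i - x j)" for i j
  define base where "base i = a + 1 - (a + b + 2) * x i" for i
  define G where "G i = beta_jacobi_drift N a b \<beta> x i" for i
  have G: "G i = base i + \<kappa> * (\<Sum>j\<in>{1..N} - {i}. s i j)" for i
    by (simp add: G_def base_def \<kappa>_def s_def beta_jacobi_drift_def)
  have \<kappa>: "0 \<le> \<kappa>" using \<beta> by (simp add: \<kappa>_def)
  have D0: "0 \<le> D" by (simp add: D_def)
  have base: "\<bar>base i\<bar> \<le> D" if "i \<in> {1..N}" for i
  proof -
    have "\<bar>(a + b + 2) * x i\<bar> \<le> \<bar>a + b + 2\<bar>"
      unfolding abs_mult using x01[OF that] by (intro mult_left_le) auto
    then show ?thesis unfolding base_def D_def by linarith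
  qed
  have s_pos: "0 \<le> s i j" if "i \<in> {1..N}" "j \<in> {1..N}" "j < i" for i j
    using x01[OF that(1)] ord[OF that(2,1)] that(3) by (auto simp: s_def)
  \<comment> \<open>The singularities within a pair cancel: the sum is
    \<open>2 * (1 - x i - x j)\<close>, or 0 for equal positions by the convention on division by
    0.\<close>
  have s_sym: "\<bar>s i j + s j i\<bar> \<le> 2" if "i \<in> {1..N}" "j \<in> {1..N}" for i j
  proof (cases "x i = x j")
    case False
    have "s j i = - (2 * x j * (1 - x j)) / (x i - x j)"
      unfolding s_def by (metis minus_diff_eq minus_divide_left minus_divide_right)
    then have "s i j + s j i = (2 * x i * (1 - x i) - 2 * x j * (1 - x j)) / (x i - x j)"
      unfolding s_def by (simp add: diff_divide_distrib)
    also have "2 * x i * (1 - x i) - 2 * x j * (1 - x j) = 2 * (1 - x i - x j) * (x i - x j)"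
      by (simp add: algebra_simps)
    finally have "s i j + s j i = 2 * (1 - x i - x j)" using False by simp
    then show ?thesis using x01[OF that(1)] x01[OF that(2)] by (auto simp: abs_le_iff)
  qed (simp add: s_def)
  define S where "S k = (\<Sum>i\<in>{k..N}. G i)" for k
  \<comment> \<open>The added constant absorbs the linear part of the drifts and the cancelled
    internal repulsion, so that \<open>E k\<close> dominates the nonnegative push that particles
    below \<open>k\<close> exert on the others.\<close>
  define E where "E k = S k + (real N * D + \<kappa> * (real N * real N))" for k
  have E': "\<kappa> * (\<Sum>i\<in>{k..N}. \<Sum>j\<in>{1..<k}. s i j) \<le> E k" if k: "k \<in> {1..N}" for k
  proof -
    have "(\<Sum>i\<in>{k..N}. \<Sum>j\<in>{1..N} - {i}. s i j) = (\<Sum>i\<in>{k..N}. (\<Sum>j\<in>{1..<k}. s i j) + (\<Sum>j\<in>{k..N} - {i}. s i j))"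
    proof (intro sum.cong refl)
      fix i assume i: "i \<in> {k..N}"
      have U: "{1..N} - {i} = {1..<k} \<union> ({k..N} - {i})" using k i by auto
      show "(\<Sum>j\<in>{1..N} - {i}. s i j) = (\<Sum>j\<in>{1..<k}. s i j) + (\<Sum>j\<in>{k..N} - {i}. s i j)"
        unfolding U by (rule sum.union_disjoint) auto
    qed
    then have split: "(\<Sum>i\<in>{k..N}. \<Sum>j\<in>{1..N} - {i}. s i j)
        = (\<Sum>i\<in>{k..N}. \<Sum>j\<in>{1..<k}. s i j) + (\<Sum>i\<in>{k..N}. \<Sum>j\<in>{k..N} - {i}. s i j)"
      by (simp add: sum.distrib)
    have "- (2 * (real N * real N)) \<le> (\<Sum>i\<in>{k..N}. \<Sum>j\<in>{k..N} - {i}. s i j + s j i)"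
    proof -
      have "\<bar>\<Sum>i\<in>{k..N}. \<Sum>j\<in>{k..N} - {i}. s i j + s j i\<bar> \<le> (\<Sum>i\<in>{k..N}. \<Sum>j\<in>{k..N} - {i}. 2)"
        using k by (intro order_trans[OF sum_abs] sum_mono s_sym) auto
      also have "\<dots> \<le> (\<Sum>i\<in>{k..N}. real N * 2)"
      proof (intro sum_mono)
        fix i
        have "card ({k..N} - {i}) \<le> card {1..N}" using k by (intro card_mono) auto
        then show "(\<Sum>j\<in>{k..N} - {i}. 2) \<le> real N * 2" by simp
      qed
      also have "\<dots> = real (card {k..N}) * (real N * 2)" by simp
      also have "\<dots> \<le> real N * (real N * 2)" using k by (intro mult_right_mono) auto
      finally show ?thesis by linarith
    qed
    then have off: "- (real N * real N) \<le> (\<Sum>i\<in>{k..N}. \<Sum>j\<in>{k..N} - {i}. s i j)"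
      unfolding sum_offdiagonal_symmetrize[OF finite_atLeastAtMost, symmetric] by linarith
    have "(\<Sum>i\<in>{k..N}. \<Sum>j\<in>{1..<k}. s i j) - real N * real N \<le> (\<Sum>i\<in>{k..N}. \<Sum>j\<in>{1..N} - {i}. s i j)"
      using split off by linarith
    then have "\<kappa> * ((\<Sum>i\<in>{k..N}. \<Sum>j\<in>{1..<k}. s i j) - real N * real N) \<le> \<kappa> * (\<Sum>i\<in>{k..N}. \<Sum>j\<in>{1..N} - {i}. s i j)"
      using \<kappa> by (intro mult_left_mono)
    moreover have "- (real N * D) \<le> (\<Sum>i\<in>{k..N}. base i)"
    proof -
      have "\<bar>\<Sum>i\<in>{k..N}. base i\<bar> \<le> (\<Sum>i\<in>{k..N}. D)"
        using k by (intro order_trans[OF sum_abs] sum_mono base) auto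
      also have "\<dots> = real (card {k..N}) * D" by simp
      also have "\<dots> \<le> real N * D" using k D0 by (intro mult_right_mono) auto
      finally show ?thesis by linarith
    qed
    moreover have "S k = (\<Sum>i\<in>{k..N}. base i) + \<kappa> * (\<Sum>i\<in>{k..N}. \<Sum>j\<in>{1..N} - {i}. s i j)"
      by (simp add: S_def G sum.distrib sum_distrib_left)
    ultimately show ?thesis unfolding E_def by (simp add: right_diff_distrib)
  qed
  have E0: "0 \<le> E k" if k: "k \<in> {1..N}" for k
  proof -
    have "0 \<le> \<kappa> * (\<Sum>i\<in>{k..N}. \<Sum>j\<in>{1..<k}. s i j)"
      using k \<kappa> by (intro mult_nonneg_nonneg sum_nonneg s_pos) auto
    then show ?thesis using E'[OF k] by linarith
  qed
  have E: "\<kappa> * s k j \<le> E k" if k: "k \<in> {1..N}" and j: "j \<in> {1..<k}" for k j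
  proof -
    have "s k j \<le> (\<Sum>j\<in>{1..<k}. s k j)"
      using k j by (intro member_le_sum s_pos) auto
    also have "\<dots> \<le> (\<Sum>i\<in>{k..N}. \<Sum>j\<in>{1..<k}. s i j)"
      using k by (intro member_le_sum[where f = "\<lambda>i. \<Sum>j\<in>{1..<k}. s i j"] sum_nonneg s_pos) auto
    finally have "\<kappa> * s k j \<le> \<kappa> * (\<Sum>i\<in>{k..N}. \<Sum>j\<in>{1..<k}. s i j)" using \<kappa> by (rule mult_left_mono)
    then show ?thesis using E'[OF k] by linarith
  qed
  \<comment> \<open>Every \<open>E k\<close> is nonnegative, so their sum bounds each of them and
    thereby all repulsion terms at once.\<close>
  define Z where "Z = (\<Sum>k\<in>{1..N}. E k)"
  have EZ: "E k \<le> Z" if "k \<in> {1..N}" for k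
    unfolding Z_def using that E0 by (intro member_le_sum) auto
  have Z0: "0 \<le> Z" unfolding Z_def using E0 by (intro sum_nonneg)
  have sb: "\<kappa> * \<bar>s i j\<bar> \<le> Z + 2 * \<kappa>" if j: "j \<in> {1..N} - {i}" for j
  proof (cases "j < i")
    case True
    then have "\<kappa> * s i j \<le> Z" using E[of i j] EZ[OF i] i j by auto
    then show ?thesis using s_pos[of i j] True i j \<kappa> by simp
  next
    \<comment> \<open>For \<open>j > i\<close> the term is compared with its mirror image
      \<open>s j i\<close>, at a cost of 2.\<close>
    case False
    then have "\<kappa> * s j i \<le> Z" using E[of j i] EZ[of j] i j by auto
    moreover have "0 \<le> s j i" using s_pos[of j i] False i j by auto
    then have "\<bar>s i j\<bar> \<le> s j i + 2" using s_sym[of i j] i j by auto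
    then have "\<kappa> * \<bar>s i j\<bar> \<le> \<kappa> * (s j i + 2)" using \<kappa> by (intro mult_left_mono)
    ultimately show ?thesis by (simp add: algebra_simps)
  qed
  have "\<bar>G i\<bar> \<le> \<bar>base i\<bar> + \<bar>\<kappa> * (\<Sum>j\<in>{1..N} - {i}. s i j)\<bar>" unfolding G by (rule abs_triangle_ineq)
  also have "\<bar>\<kappa> * (\<Sum>j\<in>{1..N} - {i}. s i j)\<bar> = \<bar>\<Sum>j\<in>{1..N} - {i}. \<kappa> * s i j\<bar>" by (simp add: sum_distrib_left)
  also have "\<dots> \<le> (\<Sum>j\<in>{1..N} - {i}. Z + 2 * \<kappa>)"
    using sb \<kappa> by (intro order_trans[OF sum_abs] sum_mono) (auto simp: abs_mult)
  also have "\<dots> \<le> real N * (Z + 2 * \<kappa>)"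
    using Z0 \<kappa> i by (auto intro!: mult_right_mono)
  also have "\<bar>base i\<bar> \<le> D" using base i by auto
  finally have "\<bar>G i\<bar> \<le> D + real N * (Z + 2 * \<kappa>)" by simp
  also have "Z = (\<Sum>k\<in>{1..N}. S k) + real N * (real N * D + \<kappa> * (real N * real N))"
    by (simp add: Z_def E_def sum.distrib)
  finally show ?thesis unfolding S_def G_def by (simp add: algebra_simps)
qed

section \<open>The generator on power sums\<close>

definition power_mean :: "nat \<Rightarrow> (nat \<Rightarrow> real) \<Rightarrow> nat \<Rightarrow> real" where
  "power_mean N x k = (\<Sum>i\<in>{1..N}. x i ^ k) / real N"

text \<open>Symmetrization turns the repulsion into difference quotients of powers, that is, into
  the complete homogeneous polynomials \<open>h n\<close> and \<open>h (Suc n)\<close> of two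
  positions. Summed over all pairs these are convolutions of power sums; the diagonal pairs, which
  the drift lacks, have to be subtracted and produce the term of order \<open>1 / N\<close>.\<close>

lemma beta_jacobi_generator_power_sum:
  fixes x :: "nat \<Rightarrow> real"
  assumes N: "1 \<le> N" and inj: "\<And>i j. i \<in> {1..N} \<Longrightarrow> j \<in> {1..N} \<Longrightarrow> i \<noteq> j \<Longrightarrow> x i \<noteq> x j"
  defines "p \<equiv> power_mean N x"
  shows "(\<Sum>i\<in>{1..N}. real (Suc n) * x i ^ n * beta_jacobi_drift N a b (2 * c / real N) x i
      + real (Suc n) * real n * x i ^ (n - 1) / 2 * (2 * x i * (1 - x i)))
    = real N * (moment_rhs a b c n p - c * real (Suc n) / real N * (real (Suc n) * p n - real (n + 2) * p (Suc n)))"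
proof -
  have N0: "real N \<noteq> 0" using N by simp
  have pN: "(\<Sum>i\<in>{1..N}. x i ^ k) = real N * p k" for k
    using N0 by (simp add: p_def power_mean_def)
  define h where "h m y z = (\<Sum>k\<le>m. y ^ k * z ^ (m - k))" for m :: nat and y z :: real
  have h: "(y ^ Suc m - z ^ Suc m) / (y - z) = h m y z" if "y \<noteq> z" for m and y z :: real
    using that diff_power_eq_sum[of y m z] by (simp add: h_def lessThan_Suc_atMost del: power_Suc)
  have hd: "h m y y = real (Suc m) * y ^ m" for m y
  proof -
    have "h m y y = (\<Sum>k\<le>m. y ^ m)" unfolding h_def by (intro sum.cong refl) (simp flip: power_add)
    then show ?thesis by simp
  qed
  have hsum: "(\<Sum>i\<in>{1..N}. \<Sum>j\<in>{1..N}. h m (x i) (x j)) = (real N)\<^sup>2 * (\<Sum>k\<le>m. p k * p (m - k))" for m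
  proof -
    have "(\<Sum>i\<in>{1..N}. \<Sum>j\<in>{1..N}. h m (x i) (x j)) = (\<Sum>k\<le>m. \<Sum>i\<in>{1..N}. \<Sum>j\<in>{1..N}. x i ^ k * x j ^ (m - k))"
      unfolding h_def by (subst sum.swap, subst (2) sum.swap) (rule refl)
    also have "\<dots> = (\<Sum>k\<le>m. (\<Sum>i\<in>{1..N}. x i ^ k) * (\<Sum>j\<in>{1..N}. x j ^ (m - k)))"
      by (simp add: sum_product)
    finally show ?thesis unfolding pN by (simp add: sum_distrib_left power2_eq_square mult_ac)
  qed
  have hoff: "(\<Sum>i\<in>{1..N}. \<Sum>j\<in>{1..N} - {i}. h m (x i) (x j))
      = (real N)\<^sup>2 * (\<Sum>k\<le>m. p k * p (m - k)) - real (Suc m) * (real N * p m)" for m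
  proof -
    have "(\<Sum>i\<in>{1..N}. \<Sum>j\<in>{1..N} - {i}. h m (x i) (x j))
      = (\<Sum>i\<in>{1..N}. (\<Sum>j\<in>{1..N}. h m (x i) (x j)) - h m (x i) (x i))"
      by (intro sum.cong refl) (simp add: sum_diff1)
    also have "\<dots> = (\<Sum>i\<in>{1..N}. \<Sum>j\<in>{1..N}. h m (x i) (x j)) - (\<Sum>i\<in>{1..N}. h m (x i) (x i))"
      by (rule sum_subtractf)
    also have "(\<Sum>i\<in>{1..N}. h m (x i) (x i)) = real (Suc m) * (\<Sum>i\<in>{1..N}. x i ^ m)"
      unfolding hd by (simp add: sum_distrib_left)
    finally show ?thesis unfolding hsum pN .
  qed
  define g where "g i j = x i ^ n * (2 * x i * (1 - x i) / (x i - x j))" for i j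
  have gs: "g i j + g j i = 2 * (h n (x i) (x j) - h (Suc n) (x i) (x j))"
    if "i \<in> {1..N}" "j \<in> {1..N} - {i}" for i j
  proof -
    have ne: "x i \<noteq> x j" using inj[of i j] that by auto
    have "g j i = - (x j ^ n * (2 * x j * (1 - x j))) / (x i - x j)"
      unfolding g_def times_divide_eq_right by (metis minus_diff_eq minus_divide_left minus_divide_right)
    then have "g i j + g j i = (x i ^ n * (2 * x i * (1 - x i)) - x j ^ n * (2 * x j * (1 - x j))) / (x i - x j)"
      unfolding g_def by (simp add: diff_divide_distrib)
    also have "x i ^ n * (2 * x i * (1 - x i)) - x j ^ n * (2 * x j * (1 - x j))
       = 2 * ((x i ^ Suc n - x j ^ Suc n) - (x i ^ Suc (Suc n) - x j ^ Suc (Suc n)))"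
      by (simp add: algebra_simps)
    finally show ?thesis unfolding h[OF ne, symmetric] by (simp only: diff_divide_distrib times_divide_eq_right [symmetric])
  qed
  have "2 * (\<Sum>i\<in>{1..N}. \<Sum>j\<in>{1..N} - {i}. g i j) = (\<Sum>i\<in>{1..N}. \<Sum>j\<in>{1..N} - {i}. 2 * (h n (x i) (x j) - h (Suc n) (x i) (x j)))"
    unfolding sum_offdiagonal_symmetrize[OF finite_atLeastAtMost] by (intro sum.cong refl gs)
  then have gsum: "(\<Sum>i\<in>{1..N}. \<Sum>j\<in>{1..N} - {i}. g i j)
      = ((real N)\<^sup>2 * (\<Sum>k\<le>n. p k * p (n - k)) - real (Suc n) * (real N * p n))
      - ((real N)\<^sup>2 * (\<Sum>k\<le>Suc n. p k * p (Suc n - k)) - real (Suc (Suc n)) * (real N * p (Suc n)))"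
    unfolding hoff [symmetric] by (simp add: sum_subtractf sum_distrib_left [symmetric])
  have p0: "p 0 = 1" using N0 by (simp add: p_def power_mean_def)
  \<comment> \<open>The extreme terms \<open>k = 0\<close> and \<open>k = Suc n\<close> contain
    \<open>p 0 = 1\<close>; their contribution \<open>2 * p (Suc n)\<close> is the source of the
    \<open>2 * c\<close> in the linear coefficient of \<open>moment_rhs\<close>.\<close>
  have conv: "(\<Sum>k\<le>Suc n. p k * p (Suc n - k)) = 2 * p (Suc n) + (\<Sum>i<n. p (Suc i) * p (n - i))"
  proof -
    have "(\<Sum>k\<le>Suc n. p k * p (Suc n - k)) = p (Suc n) + (\<Sum>k\<le>n. p (Suc k) * p (n - k))"
      by (subst sum.atMost_Suc_shift) (simp add: p0)
    also have "(\<Sum>k\<le>n. p (Suc k) * p (n - k)) = (\<Sum>k<n. p (Suc k) * p (n - k)) + p (Suc n)"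
      unfolding lessThan_Suc_atMost [symmetric] by (simp add: p0)
    finally show ?thesis by simp
  qed
  have summand: "real (Suc n) * x i ^ n * beta_jacobi_drift N a b (2 * c / real N) x i
      + real (Suc n) * real n * x i ^ (n - 1) / 2 * (2 * x i * (1 - x i))
     = real (Suc n) * (a + real n + 1) * x i ^ n - real (Suc n) * (a + b + real n + 2) * x i ^ Suc n
       + real (Suc n) * (c / real N) * (\<Sum>j\<in>{1..N} - {i}. g i j)" for i
  proof -
    have 1: "real (Suc n) * real n * x i ^ (n - 1) / 2 * (2 * x i * (1 - x i))
       = real (Suc n) * real n * x i ^ n - real (Suc n) * real n * x i ^ Suc n"
      by (cases n) (simp_all add: field_simps)
    have 2: "(\<Sum>j\<in>{1..N} - {i}. g i j) = x i ^ n * (\<Sum>j\<in>{1..N} - {i}. 2 * x i * (1 - x i) / (x i - x j))"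
      by (simp add: g_def sum_distrib_left)
    define \<sigma> where "\<sigma> = (\<Sum>j\<in>{1..N} - {i}. 2 * x i * (1 - x i) / (x i - x j))"
    have 3: "beta_jacobi_drift N a b (2 * c / real N) x i = a + 1 - (a + b + 2) * x i + c / real N * \<sigma>"
      by (simp add: beta_jacobi_drift_def \<sigma>_def)
    define q where "q = x i ^ n"
    define k where "k = c / real N"
    have 4: "x i ^ Suc n = x i * q" by (simp add: q_def)
    show ?thesis unfolding 1 2 3 \<sigma>_def[symmetric] 4 q_def[symmetric] k_def[symmetric]
      by (simp add: algebra_simps)
  qed
  have "(\<Sum>i\<in>{1..N}. real (Suc n) * x i ^ n * beta_jacobi_drift N a b (2 * c / real N) x i
      + real (Suc n) * real n * x i ^ (n - 1) / 2 * (2 * x i * (1 - x i)))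
    = real (Suc n) * (a + real n + 1) * (real N * p n) - real (Suc n) * (a + b + real n + 2) * (real N * p (Suc n))
       + real (Suc n) * (c / real N) * (\<Sum>i\<in>{1..N}. \<Sum>j\<in>{1..N} - {i}. g i j)"
    unfolding summand pN [symmetric] by (simp add: sum.distrib sum_subtractf sum_distrib_left)
  also have "\<dots> = real N * (moment_rhs a b c n p - c * real (Suc n) / real N * (real (Suc n) * p n - real (n + 2) * p (Suc n)))"
    unfolding gsum conv moment_rhs_def using N0 by (simp add: field_simps power2_eq_square)
  finally show ?thesis .
qed

lemma incr_int_sum:
  assumes "\<And>i. i \<in> I \<Longrightarrow> path_integrable (g i) T"
  shows "path_integrable (\<lambda>r. \<Sum>i\<in>I. g i r) T" "incr_int (\<lambda>r. \<Sum>i\<in>I. g i r) 0 T = (\<Sum>i\<in>I. incr_int (g i) 0 T)"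
  using assms by (auto simp: path_integrable_def incr_int_def sum_distrib_left)

lemma path_integrable_const: "0 \<le> T \<Longrightarrow> path_integrable (\<lambda>_. C) T"
  and incr_int_const: "0 \<le> T \<Longrightarrow> incr_int (\<lambda>_. C) 0 T = C * T"
proof -
  have "0 \<le> T \<Longrightarrow> integrable lborel (\<lambda>r. indicator {0<..T} r * C)"
    by (intro integrable_mult_left integrable_real_indicator) auto
  then show "0 \<le> T \<Longrightarrow> path_integrable (\<lambda>_. C) T" by (simp add: path_integrable_def)
  show "0 \<le> T \<Longrightarrow> incr_int (\<lambda>_. C) 0 T = C * T" by (simp add: incr_int_def mult.commute)
qed

lemma incr_int_mono:
  assumes "path_integrable g T" "path_integrable h T" "\<And>r. 0 < r \<Longrightarrow> r \<le> T \<Longrightarrow> g r \<le> h r"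
  shows "incr_int g 0 T \<le> incr_int h 0 T"
  unfolding incr_int_def
proof (rule integral_mono)
  show "indicator {0<..T} r * g (max 0 r) \<le> indicator {0<..T} r * h (max 0 r)" for r
    using assms(3)[of r] by (auto simp: indicator_def)
qed (use assms in \<open>auto simp: path_integrable_def\<close>)

lemma incr_int_linear:
  assumes "path_integrable g T" "path_integrable h T"
  shows "path_integrable (\<lambda>r. c * g r + d * h r) T"
    "incr_int (\<lambda>r. c * g r + d * h r) 0 T = c * incr_int g 0 T + d * incr_int h 0 T"
  using assms by (auto simp: path_integrable_def incr_int_def distrib_left mult.left_commute)

lemma incr_int_cong_AE:
  assumes g: "path_integrable g T" and h: "path_integrable h T"
    and e: "AE r in lborel. 0 \<le> r \<longrightarrow> g r = h r"
  shows "incr_int g 0 T = incr_int h 0 T"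
  unfolding incr_int_def
proof (rule integral_cong_AE)
  show "AE r in lborel. indicator {0<..T} r * g (max 0 r) = indicator {0<..T} r * h (max 0 r)"
    using e by eventually_elim (auto simp: indicator_def)
qed (use g h in \<open>auto simp: path_integrable_def intro: borel_measurable_integrable\<close>)

lemma path_integrable_continuous:
  assumes "continuous_on {0..T} g" shows "path_integrable g T"
  using borel_integrable_atLeastAtMost'[OF assms] by (rule path_integrable_set_integrable)

lemma power_mean_range:
  assumes "1 \<le> N" "\<And>i. i \<in> {1..N} \<Longrightarrow> x i \<in> {0..1}"
  shows "power_mean N x k \<in> {0..1}"
proof -
  have "0 \<le> (\<Sum>i\<in>{1..N}. x i ^ k)" using assms(2) by (intro sum_nonneg) auto
  moreover have "(\<Sum>i\<in>{1..N}. x i ^ k) \<le> (\<Sum>i\<in>{1..N}. 1)" using assms(2) by (intro sum_mono power_le_one) auto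
  ultimately show ?thesis using assms(1) by (auto simp: power_mean_def divide_le_eq)
qed

locale beta_jacobi =
  fixes M :: "'w measure" and F :: "real \<Rightarrow> 'w measure" and N :: nat and a b c :: real
    and W \<Lambda> :: "nat \<Rightarrow> real \<Rightarrow> 'w \<Rightarrow> real"
  assumes filt: "filtered_prob_space M F"
    and process: "beta_jacobi_process M F N a b (2 * c / real N) W \<Lambda>"
    and N: "1 \<le> N" and c: "0 < c"
begin

sublocale prob_space M
  using filt by (simp add: filtered_prob_space_def)

abbreviation \<beta> :: real where "\<beta> \<equiv> 2 * c / real N"

definition H :: "nat \<Rightarrow> real \<Rightarrow> 'w \<Rightarrow> real" where
  "H i t \<omega> = sqrt (2 * \<Lambda> i t \<omega> * (1 - \<Lambda> i t \<omega>))"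

definition G :: "nat \<Rightarrow> real \<Rightarrow> 'w \<Rightarrow> real" where
  "G i t \<omega> = beta_jacobi_drift N a b \<beta> (\<lambda>j. \<Lambda> j t \<omega>) i"

lemma sd: "i \<in> {1..N} \<Longrightarrow> has_stochastic_differential M F (W i) (\<Lambda> i) (H i) (G i)"
  using process by (simp add: beta_jacobi_process_def H_def [abs_def] G_def [abs_def])

lemma \<Lambda>01: "i \<in> {1..N} \<Longrightarrow> 0 \<le> t \<Longrightarrow> \<omega> \<in> space M \<Longrightarrow> \<Lambda> i t \<omega> \<in> {0..1}"
  using process by (simp add: beta_jacobi_process_def)

lemma \<Lambda>_ordered: "i \<in> {1..N} \<Longrightarrow> j \<in> {1..N} \<Longrightarrow> i \<le> j \<Longrightarrow> 0 \<le> t \<Longrightarrow> \<omega> \<in> space M \<Longrightarrow> \<Lambda> i t \<omega> \<le> \<Lambda> j t \<omega>"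
  using process by (simp add: beta_jacobi_process_def)

lemma adapted: "i \<in> {1..N} \<Longrightarrow> adapted_continuous M F (\<Lambda> i)"
  using sd by (simp add: has_stochastic_differential_def)

lemma wiener_i: "i \<in> {1..N} \<Longrightarrow> wiener M F (W i)"
  using process by (intro wiener_component[OF filt]) (auto simp: beta_jacobi_process_def)

lemma \<Lambda>_joint: "i \<in> {1..N} \<Longrightarrow> (\<lambda>x. \<Lambda> i (max 0 (snd x)) (fst x)) \<in> borel_measurable (M \<Otimes>\<^sub>M lborel)"
  using wiener.adapted_continuous_jointly_measurable[OF wiener_i adapted] .

lemma \<Lambda>_measurable: "i \<in> {1..N} \<Longrightarrow> 0 \<le> t \<Longrightarrow> \<Lambda> i t \<in> borel_measurable M"
  using wiener.measurable_F[OF wiener_i, of i "\<Lambda> i t" t] adapted[of i] by (auto simp: adapted_continuous_def)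

lemma \<Lambda>_continuous: "i \<in> {1..N} \<Longrightarrow> \<omega> \<in> space M \<Longrightarrow> continuous_on {0..} (\<lambda>t. \<Lambda> i t \<omega>)"
  using adapted by (simp add: adapted_continuous_def)

lemma H_joint: "i \<in> {1..N} \<Longrightarrow> (\<lambda>x. H i (max 0 (snd x)) (fst x)) \<in> borel_measurable (M \<Otimes>\<^sub>M lborel)"
proof -
  assume "i \<in> {1..N}"
  note [measurable] = \<Lambda>_joint[OF this]
  show ?thesis unfolding H_def by measurable
qed

lemma G_joint: "i \<in> {1..N} \<Longrightarrow> (\<lambda>x. G i (max 0 (snd x)) (fst x)) \<in> borel_measurable (M \<Otimes>\<^sub>M lborel)"
  unfolding G_def beta_jacobi_drift_def
  by (intro borel_measurable_add borel_measurable_sum borel_measurable_divide borel_measurable_times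
      borel_measurable_diff borel_measurable_const \<Lambda>_joint) auto

text \<open>The stochastic integral of \<open>H i\<close> against \<open>W i\<close> over
  \<open>[0, T]\<close>, expressed through the equation. Its square integrability comes from the Ito
  integral itself and is what later controls the drift.\<close>

definition noise :: "real \<Rightarrow> nat \<Rightarrow> 'w \<Rightarrow> real" where
  "noise T i \<omega> = \<Lambda> i T \<omega> - \<Lambda> i 0 \<omega> - set_lebesgue_integral lborel {0..T} (\<lambda>s. G i s \<omega>)"

lemma noise_sq_int:
  assumes i: "i \<in> {1..N}" and T: "0 \<le> T"
  shows "sq_int M (noise T i)"
proof -
  interpret w: wiener M F "W i" by (rule wiener_i[OF i])
  have ito: "has_ito_integral M F (W i) (H i) t (noise t i)" if "0 \<le> t" for t
    using sd[OF i] that by (simp add: has_stochastic_differential_def noise_def [abs_def])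
  have "sq_int M (\<lambda>\<omega>. noise T i \<omega> - noise 0 i \<omega>)"
    by (rule w.ito_increment_sq_int[OF ito H_joint[OF i] order_refl T, where \<phi> = "\<lambda>_. 0" and C = 0]) auto
  moreover have "noise 0 i \<omega> = 0" for \<omega> by (simp add: noise_def set_integral_point)
  ultimately show ?thesis by simp
qed

text \<open>The additive constant of \<open>beta_jacobi_drift_dominated\<close>.\<close>

definition drift_bound :: real where
  "drift_bound = (let D = \<bar>a + 1\<bar> + \<bar>a + b + 2\<bar> in
     D + real N * (real N * (real N * D + \<beta> / 2 * (real N * real N)) + 2 * (\<beta> / 2)))"

text \<open>Obtained by integrating \<open>beta_jacobi_drift_dominated\<close> over time: the
  integral of drift \<open>l\<close> is \<open>\<Lambda> l T - \<Lambda> l 0 - noise T l\<close>,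
  hence at most \<open>1 + \<bar>noise T l\<bar>\<close>. One factor \<open>N\<close> is already
  present in that estimate, the other counts the outer summation index \<open>k\<close>.\<close>

definition A :: "real \<Rightarrow> 'w \<Rightarrow> real" where
  "A T \<omega> = drift_bound * T + real N * (real N * (\<Sum>l\<in>{1..N}. 1 + \<bar>noise T l \<omega>\<bar>))"

lemma AE_integrable:
  assumes "0 \<le> T" shows "AE \<omega> in M. \<omega> \<in> space M \<and> (\<forall>i\<in>{1..N}. set_integrable lborel {0..T} (\<lambda>s. G i s \<omega>))"
proof -
  have "AE \<omega> in M. \<forall>i\<in>{1..N}. set_integrable lborel {0..T} (\<lambda>s. G i s \<omega>)"
    using sd assms by (intro AE_finite_allI) (auto simp: has_stochastic_differential_def)
  then show ?thesis using AE_space by eventually_elim blast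
qed

text \<open>The absolute value of a singular drift is traded for a sum of signed drifts, whose
  integrals the equation evaluates.\<close>

lemma drift_abs_integral:
  assumes \<omega>: "\<omega> \<in> space M" and gi: "\<And>i. i \<in> {1..N} \<Longrightarrow> set_integrable lborel {0..T} (\<lambda>s. G i s \<omega>)"
    and T: "0 < T" and i: "i \<in> {1..N}"
  shows "incr_int (\<lambda>r. \<bar>G i r \<omega>\<bar>) 0 T \<le> A T \<omega>"
proof -
  have p: "path_integrable (\<lambda>s. G i s \<omega>) T" if "i \<in> {1..N}" for i
    using gi[OF that] by (rule path_integrable_set_integrable)
  let ?S = "\<lambda>r. \<Sum>k\<in>{1..N}. \<Sum>l\<in>{k..N}. G l r \<omega>"
  have pl: "path_integrable (\<lambda>r. \<Sum>l\<in>{k..N}. G l r \<omega>) T" if "k \<in> {1..N}" for k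
    using that by (intro incr_int_sum(1) p) auto
  have pS: "path_integrable ?S T" by (intro incr_int_sum(1) pl)
  have "\<bar>G i r \<omega>\<bar> \<le> drift_bound * 1 + real N * ?S r" if "0 < r" for r
    using beta_jacobi_drift_dominated[of N "\<lambda>j. \<Lambda> j r \<omega>" \<beta> i a b] \<Lambda>01[OF _ _ \<omega>, of _ r] \<Lambda>_ordered[OF _ _ _ _ \<omega>, of _ _ r] that i c
    by (simp add: G_def drift_bound_def Let_def)
  then have "incr_int (\<lambda>r. \<bar>G i r \<omega>\<bar>) 0 T \<le> incr_int (\<lambda>r. drift_bound * 1 + real N * ?S r) 0 T"
    using T by (intro incr_int_mono path_integrable_abs p i incr_int_linear(1) path_integrable_const pS) auto
  also have "\<dots> = drift_bound * T + real N * incr_int ?S 0 T"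
    using T incr_int_linear(2)[OF path_integrable_const pS, of drift_bound 1 "real N"] incr_int_const[of T 1] by simp
  also have "incr_int ?S 0 T = (\<Sum>k\<in>{1..N}. incr_int (\<lambda>r. \<Sum>l\<in>{k..N}. G l r \<omega>) 0 T)"
    by (rule incr_int_sum(2)[OF pl])
  also have "\<dots> = (\<Sum>k\<in>{1..N}. \<Sum>l\<in>{k..N}. incr_int (\<lambda>r. G l r \<omega>) 0 T)"
    by (intro sum.cong refl incr_int_sum(2) p) auto
  also have "\<dots> \<le> (\<Sum>k\<in>{1..N}. \<Sum>l\<in>{1..N}. 1 + \<bar>noise T l \<omega>\<bar>)"
  proof (rule sum_mono)
    fix k assume k: "k \<in> {1..N}"
    have "incr_int (\<lambda>r. G l r \<omega>) 0 T \<le> 1 + \<bar>noise T l \<omega>\<bar>" if l: "l \<in> {1..N}" for l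
    proof -
      have "incr_int (\<lambda>r. G l r \<omega>) 0 T = \<Lambda> l T \<omega> - \<Lambda> l 0 \<omega> - noise T l \<omega>"
        using incr_int_from_0[OF gi[OF l]] T by (simp add: noise_def)
      moreover have "\<Lambda> l T \<omega> \<le> 1" "0 \<le> \<Lambda> l 0 \<omega>" using \<Lambda>01[OF l _ \<omega>] T by auto
      ultimately show ?thesis by linarith
    qed
    then have "(\<Sum>l\<in>{k..N}. incr_int (\<lambda>r. G l r \<omega>) 0 T) \<le> (\<Sum>l\<in>{k..N}. 1 + \<bar>noise T l \<omega>\<bar>)"
      using k by (intro sum_mono) auto
    also have "\<dots> \<le> (\<Sum>l\<in>{1..N}. 1 + \<bar>noise T l \<omega>\<bar>)" using k by (intro sum_mono2) auto
    finally show "(\<Sum>l\<in>{k..N}. incr_int (\<lambda>r. G l r \<omega>) 0 T) \<le> (\<Sum>l\<in>{1..N}. 1 + \<bar>noise T l \<omega>\<bar>)" .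
  qed
  finally show ?thesis by (simp add: A_def mult_left_mono)
qed

lemma component:
  assumes i: "i \<in> {1..N}" and T: "0 < T"
  shows "bounded_ito_process M F (W i) (\<Lambda> i) (H i) (G i) (A T) 1 T"
proof -
  interpret w: wiener M F "W i" by (rule wiener_i[OF i])
  show ?thesis
  proof
    show "\<bar>H i t \<omega>\<bar> \<le> 1" if "0 \<le> t" "\<omega> \<in> space M" for t \<omega>
      unfolding H_def by (rule jacobi_diffusion_le_1[OF \<Lambda>01[OF i that]])
    have const: "sq_int M (\<lambda>_. C)" for C :: real by (simp add: sq_int_def)
    show "sq_int M (A T)"
      unfolding A_def using T
      by (intro sq_int_add const sq_int_cmult sq_int_sum sq_int_abs noise_sq_int) auto
    show "AE \<omega> in M. incr_int (\<lambda>r. \<bar>G i r \<omega>\<bar>) 0 T \<le> A T \<omega>"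
      using AE_integrable[OF less_imp_le[OF T]] by eventually_elim (use drift_abs_integral T i in blast)
  qed (use i T \<Lambda>01[OF i] in \<open>auto intro: sd H_joint G_joint\<close>)
qed

lemma \<Lambda>_distinct:
  "AE \<omega> in M. AE t in lborel. 0 \<le> t \<longrightarrow> (\<forall>i\<in>{1..N}. \<forall>j\<in>{1..N}. i \<noteq> j \<longrightarrow> \<Lambda> i t \<omega> \<noteq> \<Lambda> j t \<omega>)"
proof -
  have "AE \<omega> in M. \<forall>i\<in>{1..N}. \<forall>j\<in>{1..N}. i \<noteq> j \<longrightarrow> (AE t in lborel. 0 \<le> t \<longrightarrow> \<Lambda> i t \<omega> \<noteq> \<Lambda> j t \<omega>)"
  proof (intro AE_finite_allI)
    fix i j assume ij: "i \<in> {1..N}" "j \<in> {1..N}"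
    show "AE \<omega> in M. i \<noteq> j \<longrightarrow> (AE t in lborel. 0 \<le> t \<longrightarrow> \<Lambda> i t \<omega> \<noteq> \<Lambda> j t \<omega>)"
      using process ij by (cases "i = j") (auto simp: beta_jacobi_process_def)
  qed auto
  then show ?thesis
  proof eventually_elim
    case (elim \<omega>)
    have "AE t in lborel. \<forall>i\<in>{1..N}. \<forall>j\<in>{1..N}. i \<noteq> j \<longrightarrow> 0 \<le> t \<longrightarrow> \<Lambda> i t \<omega> \<noteq> \<Lambda> j t \<omega>"
    proof (intro AE_finite_allI)
      fix i j assume ij: "i \<in> {1..N}" "j \<in> {1..N}"
      show "AE t in lborel. i \<noteq> j \<longrightarrow> 0 \<le> t \<longrightarrow> \<Lambda> i t \<omega> \<noteq> \<Lambda> j t \<omega>"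
        using elim ij by (cases "i = j") auto
    qed auto
    then show ?case by eventually_elim blast
  qed
qed

definition p :: "'w \<Rightarrow> real \<Rightarrow> nat \<Rightarrow> real" where
  "p \<omega> t = power_mean N (\<lambda>i. \<Lambda> i t \<omega>)"

text \<open>The correction of order \<open>1 / N\<close> stems from the diagonal terms \<open>i = j\<close>, which are absent from the drift.\<close>

definition corrected_rhs :: "nat \<Rightarrow> (nat \<Rightarrow> real) \<Rightarrow> real" where
  "corrected_rhs n q = moment_rhs a b c n q - c * real (Suc n) / real N * (real (Suc n) * q n - real (n + 2) * q (Suc n))"

lemma p_range: "0 \<le> t \<Longrightarrow> \<omega> \<in> space M \<Longrightarrow> p \<omega> t k \<in> {0..1}"
  unfolding p_def by (intro power_mean_range N \<Lambda>01)

lemma p_continuous: "\<omega> \<in> space M \<Longrightarrow> continuous_on {0..} (\<lambda>t. p \<omega> t k)"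
  unfolding p_def power_mean_def using N by (intro continuous_intros \<Lambda>_continuous) auto

lemma p_joint: "(\<lambda>x. p (fst x) (max 0 (snd x)) k) \<in> borel_measurable (M \<Otimes>\<^sub>M lborel)"
  unfolding p_def power_mean_def
  by (intro borel_measurable_divide borel_measurable_sum borel_measurable_power \<Lambda>_joint borel_measurable_const)

lemma corrected_rhs_joint: "(\<lambda>x. corrected_rhs n (p (fst x) (max 0 (snd x)))) \<in> borel_measurable (M \<Otimes>\<^sub>M lborel)"
  unfolding corrected_rhs_def moment_rhs_def
  by (intro borel_measurable_add borel_measurable_diff borel_measurable_sum borel_measurable_times p_joint borel_measurable_const)

lemma corrected_rhs_continuous: "\<omega> \<in> space M \<Longrightarrow> continuous_on {0..T} (\<lambda>t. corrected_rhs n (p \<omega> t))"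
  unfolding corrected_rhs_def moment_rhs_def
  by (intro continuous_intros continuous_on_subset[OF p_continuous]) auto

text \<open>The failure of the integrated moment equation along one path. For \<open>T > 0\<close>
  it is almost surely \<open>1 / N\<close> times the sum over the particles of the martingale parts
  of \<open>\<Lambda> i ^ Suc n\<close>.\<close>

definition defect :: "real \<Rightarrow> nat \<Rightarrow> 'w \<Rightarrow> real" where
  "defect T n \<omega> = p \<omega> T (Suc n) - p \<omega> 0 (Suc n) - incr_int (\<lambda>t. corrected_rhs n (p \<omega> t)) 0 T"

text \<open>Dynkin's formula is summed over the particles. The generator identity holds where the
  positions are distinct, which on almost every path is the case at almost every time, and this is
  enough under the time integral.\<close>

lemma defect_expectation:
  assumes T: "0 < T"
  shows "integrable M (defect T n)" "expectation (defect T n) = 0"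
proof -
  let ?f1 = "\<lambda>y :: real. real (Suc n) * y ^ n" and ?f2 = "\<lambda>y :: real. real (Suc n) * real n * y ^ (n - 1)"
  define DI where "DI i \<omega> = incr_int (\<lambda>r. ?f1 (\<Lambda> i r \<omega>) * G i r \<omega>) 0 T + incr_int (\<lambda>r. ?f2 (\<Lambda> i r \<omega>) / 2 * (H i r \<omega>)\<^sup>2) 0 T" for i \<omega>
  define R where "R i \<omega> r = ?f1 (\<Lambda> i r \<omega>) * G i r \<omega> + ?f2 (\<Lambda> i r \<omega>) / 2 * (H i r \<omega>)\<^sup>2" for i \<omega> r
  have DI: "bounded_ito_process.drift_integral (\<Lambda> i) (H i) (G i) T ?f1 ?f2 = DI i" if "i \<in> {1..N}" for i
    by (rule ext) (simp add: bounded_ito_process.drift_integral_def[OF component[OF that T]] DI_def)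
  have DIi: "integrable M (DI i)" "expectation (\<lambda>\<omega>. \<Lambda> i T \<omega> ^ Suc n) - expectation (\<lambda>\<omega>. \<Lambda> i 0 \<omega> ^ Suc n) = expectation (DI i)"
    if "i \<in> {1..N}" for i
    using bounded_ito_process.power_dynkin[OF component[OF that T], of n] unfolding DI[OF that] by auto
  have pi: "integrable M (\<lambda>\<omega>. \<Lambda> i t \<omega> ^ Suc n)" if "i \<in> {1..N}" "0 \<le> t" for i t
  proof (rule integrable_const_bound[where B = 1])
    show "AE \<omega> in M. norm (\<Lambda> i t \<omega> ^ Suc n) \<le> 1"
      using \<Lambda>01[OF that] by (intro AE_I2) (auto simp: power_abs simp del: power_Suc intro!: power_le_one)
    show "(\<lambda>\<omega>. \<Lambda> i t \<omega> ^ Suc n) \<in> borel_measurable M" using \<Lambda>_measurable[OF that] by measurable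
  qed
  define V where "V \<omega> = (\<Sum>i\<in>{1..N}. (\<Lambda> i T \<omega> ^ Suc n - \<Lambda> i 0 \<omega> ^ Suc n - DI i \<omega>)) / real N" for \<omega>
  have term_i: "integrable M (\<lambda>\<omega>. \<Lambda> i T \<omega> ^ Suc n - \<Lambda> i 0 \<omega> ^ Suc n - DI i \<omega>)" if "i \<in> {1..N}" for i
    using T by (intro Bochner_Integration.integrable_diff pi DIi that) auto
  have Vi: "integrable M V"
    unfolding V_def by (intro integrable_divide Bochner_Integration.integrable_sum term_i)
  have V0: "expectation V = 0"
  proof -
    have "expectation (\<lambda>\<omega>. \<Lambda> i T \<omega> ^ Suc n - \<Lambda> i 0 \<omega> ^ Suc n - DI i \<omega>) = 0" if "i \<in> {1..N}" for i
    proof -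
      have "expectation (\<lambda>\<omega>. \<Lambda> i T \<omega> ^ Suc n - \<Lambda> i 0 \<omega> ^ Suc n - DI i \<omega>)
        = expectation (\<lambda>\<omega>. \<Lambda> i T \<omega> ^ Suc n) - expectation (\<lambda>\<omega>. \<Lambda> i 0 \<omega> ^ Suc n) - expectation (DI i)"
        using pi[OF that] DIi(1)[OF that] T by (simp del: power_Suc)
      then show ?thesis using DIi(2)[OF that] by simp
    qed
    then have "expectation (\<lambda>\<omega>. \<Sum>i\<in>{1..N}. (\<Lambda> i T \<omega> ^ Suc n - \<Lambda> i 0 \<omega> ^ Suc n - DI i \<omega>)) = 0"
      by (subst Bochner_Integration.integral_sum[OF term_i]) auto
    then show ?thesis unfolding V_def by simp
  qed
  have niceAE: "AE \<omega> in M. \<forall>i\<in>{1..N}. bounded_ito_process.nice M (G i) (A T) T \<omega>"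
    using bounded_ito_process.AE_nice[OF component[OF _ T]] by (intro AE_finite_allI) auto
  have VAE: "AE \<omega> in M. V \<omega> = defect T n \<omega>"
    using niceAE \<Lambda>_distinct AE_space
  proof eventually_elim
    case (elim \<omega>)
    have R1: "path_integrable (R i \<omega>) T" "DI i \<omega> = incr_int (R i \<omega>) 0 T" if i: "i \<in> {1..N}" for i
    proof -
      have nice: "bounded_ito_process.nice M (G i) (A T) T \<omega>" using elim i by blast
      note D = bounded_ito_process.drift_integral_eq[OF component[OF i T] _ _ _ _ nice, where ?f1.0 = ?f1 and ?f2.0 = ?f2, unfolded DI[OF i]]
      show "path_integrable (R i \<omega>) T" unfolding R_def by (rule D) (auto intro!: continuous_intros)
      show "DI i \<omega> = incr_int (R i \<omega>) 0 T" unfolding R_def by (rule D) (auto intro!: continuous_intros)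
    qed
    have sum: "(\<Sum>i\<in>{1..N}. DI i \<omega>) = incr_int (\<lambda>r. \<Sum>i\<in>{1..N}. R i \<omega> r) 0 T"
      using R1 by (subst incr_int_sum(2)) auto
    have rc: "path_integrable (\<lambda>t. corrected_rhs n (p \<omega> t)) T"
      by (rule path_integrable_continuous[OF corrected_rhs_continuous[OF elim(3)]])
    \<comment> \<open>The zero summand brings the factor \<open>N\<close> into the two-term shape of
      \<open>incr_int_linear\<close>.\<close>
    have rc1: "path_integrable (\<lambda>t. real N * corrected_rhs n (p \<omega> t) + 0 * corrected_rhs n (p \<omega> t)) T"
      by (rule incr_int_linear(1)[OF rc rc])
    have "AE r in lborel. 0 \<le> r \<longrightarrow> (\<Sum>i\<in>{1..N}. R i \<omega> r) = real N * corrected_rhs n (p \<omega> r) + 0 * corrected_rhs n (p \<omega> r)"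
      using elim(2)
    proof eventually_elim
      case (elim r)
      show ?case
      proof
        assume r: "0 \<le> r"
        have sq: "(H i r \<omega>)\<^sup>2 = 2 * \<Lambda> i r \<omega> * (1 - \<Lambda> i r \<omega>)" if "i \<in> {1..N}" for i
          unfolding H_def using \<Lambda>01[OF that r \<open>\<omega> \<in> space M\<close>] by (intro real_sqrt_pow2) simp
        have "(\<Sum>i\<in>{1..N}. R i \<omega> r) = (\<Sum>i\<in>{1..N}. real (Suc n) * \<Lambda> i r \<omega> ^ n * beta_jacobi_drift N a b \<beta> (\<lambda>j. \<Lambda> j r \<omega>) i
            + real (Suc n) * real n * \<Lambda> i r \<omega> ^ (n - 1) / 2 * (2 * \<Lambda> i r \<omega> * (1 - \<Lambda> i r \<omega>)))"
          by (intro sum.cong refl) (simp only: R_def sq G_def)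
        also have "\<dots> = real N * corrected_rhs n (p \<omega> r)"
          unfolding corrected_rhs_def p_def using elim r
          by (intro beta_jacobi_generator_power_sum[OF N, of "\<lambda>j. \<Lambda> j r \<omega>"]) auto
        finally show "(\<Sum>i\<in>{1..N}. R i \<omega> r) = real N * corrected_rhs n (p \<omega> r) + 0 * corrected_rhs n (p \<omega> r)" by simp
      qed
    qed
    then have "incr_int (\<lambda>r. \<Sum>i\<in>{1..N}. R i \<omega> r) 0 T = incr_int (\<lambda>t. real N * corrected_rhs n (p \<omega> t) + 0 * corrected_rhs n (p \<omega> t)) 0 T"
      using R1 by (intro incr_int_cong_AE incr_int_sum(1) rc1) auto
    also have "\<dots> = real N * incr_int (\<lambda>t. corrected_rhs n (p \<omega> t)) 0 T + 0 * incr_int (\<lambda>t. corrected_rhs n (p \<omega> t)) 0 T"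
      by (rule incr_int_linear(2)[OF rc rc])
    finally have "(\<Sum>i\<in>{1..N}. DI i \<omega>) = real N * incr_int (\<lambda>t. corrected_rhs n (p \<omega> t)) 0 T"
      using sum by simp
    then have "V \<omega> = ((\<Sum>i\<in>{1..N}. \<Lambda> i T \<omega> ^ Suc n) - (\<Sum>i\<in>{1..N}. \<Lambda> i 0 \<omega> ^ Suc n)
        - real N * incr_int (\<lambda>t. corrected_rhs n (p \<omega> t)) 0 T) / real N"
      unfolding V_def sum_subtractf by simp
    also have "\<dots> = defect T n \<omega>"
      using N by (simp add: defect_def p_def power_mean_def diff_divide_distrib)
    finally show ?case .
  qed
  have dm: "defect T n \<in> borel_measurable M"
  proof -
    have "(\<lambda>\<omega>. p \<omega> t (Suc n)) \<in> borel_measurable M" if "0 \<le> t" for t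
      unfolding p_def power_mean_def using that
      by (intro borel_measurable_divide borel_measurable_sum borel_measurable_power \<Lambda>_measurable borel_measurable_const)
    moreover have "(\<lambda>\<omega>. incr_int (\<lambda>t. corrected_rhs n (p \<omega> t)) 0 T) \<in> borel_measurable M"
      using bounded_ito_process.incr_int_measurable[OF component[of 1 T], of "\<lambda>t \<omega>. corrected_rhs n (p \<omega> t)"]
        corrected_rhs_joint N T by simp
    ultimately show ?thesis unfolding defect_def [abs_def] using T by (intro borel_measurable_diff) auto
  qed
  show "integrable M (defect T n)"
    using Vi by (rule integrable_cong_AE_imp[OF _ dm]) (use VAE in \<open>auto elim: eventually_mono\<close>)
  show "expectation (defect T n) = 0"
    using integral_cong_AE[OF borel_measurable_integrable[OF Vi] dm VAE] V0 by simp
qed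

end

section \<open>The limit of many particles\<close>

text \<open>\<open>moment_rhs\<close> is a quadratic polynomial in finitely many moments, hence
  Lipschitz where these are bounded by 1; each product of two moments changes by at most
  \<open>2 * \<delta>\<close>.\<close>

lemma moment_rhs_lipschitz:
  fixes a b c :: real
  obtains C where "0 \<le> C" "\<And>p m \<delta>. 0 \<le> \<delta> \<Longrightarrow> (\<And>k. k \<le> Suc n \<Longrightarrow> \<bar>p k\<bar> \<le> 1 \<and> \<bar>m k\<bar> \<le> 1 \<and> \<bar>p k - m k\<bar> \<le> \<delta>) \<Longrightarrow>
     \<bar>moment_rhs a b c n p - moment_rhs a b c n m\<bar> \<le> C * \<delta>"
proof -
  define A1 where "A1 = real (Suc n) * (2 * c + a + b + real n + 2)"
  define A2 where "A2 = real (Suc n) * (a + real n + 1)"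
  define A3 where "A3 = c * real (Suc n)"
  define C where "C = \<bar>A1\<bar> + \<bar>A2\<bar> + \<bar>A3\<bar> * (real (Suc n) * 2) + \<bar>A3\<bar> * (real n * 2)"
  have "\<bar>moment_rhs a b c n p - moment_rhs a b c n m\<bar> \<le> C * \<delta>"
    if d: "0 \<le> \<delta>" and k: "\<And>k. k \<le> Suc n \<Longrightarrow> \<bar>p k\<bar> \<le> 1 \<and> \<bar>m k\<bar> \<le> 1 \<and> \<bar>p k - m k\<bar> \<le> \<delta>" for p m \<delta>
  proof -
    have prod: "\<bar>p i * p j - m i * m j\<bar> \<le> 2 * \<delta>" if "i \<le> Suc n" "j \<le> Suc n" for i j
    proof -
      have "p i * p j - m i * m j = (p i - m i) * p j + m i * (p j - m j)" by (simp add: algebra_simps)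
      also have "\<bar>\<dots>\<bar> \<le> \<bar>p i - m i\<bar> * \<bar>p j\<bar> + \<bar>m i\<bar> * \<bar>p j - m j\<bar>"
        by (rule order_trans[OF abs_triangle_ineq]) (simp add: abs_mult)
      also have "\<dots> \<le> \<delta> * 1 + 1 * \<delta>"
        using k[OF that(1)] k[OF that(2)] d by (intro add_mono mult_mono) auto
      finally show ?thesis by simp
    qed
    have 3: "\<bar>(\<Sum>i\<le>n. p i * p (n - i)) - (\<Sum>i\<le>n. m i * m (n - i))\<bar> \<le> real (Suc n) * (2 * \<delta>)"
    proof -
      have "\<bar>\<Sum>i\<le>n. p i * p (n - i) - m i * m (n - i)\<bar> \<le> (\<Sum>i\<le>n. 2 * \<delta>)"
        by (intro order_trans[OF sum_abs] sum_mono prod) auto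
      then show ?thesis by (simp add: sum_subtractf)
    qed
    have 4: "\<bar>(\<Sum>i<n. p (Suc i) * p (n - i)) - (\<Sum>i<n. m (Suc i) * m (n - i))\<bar> \<le> real n * (2 * \<delta>)"
    proof -
      have "\<bar>\<Sum>i<n. p (Suc i) * p (n - i) - m (Suc i) * m (n - i)\<bar> \<le> (\<Sum>i<n. 2 * \<delta>)"
        by (intro order_trans[OF sum_abs] sum_mono prod) auto
      then show ?thesis by (simp add: sum_subtractf)
    qed
    define s3 where "s3 = (\<Sum>i\<le>n. p i * p (n - i)) - (\<Sum>i\<le>n. m i * m (n - i))"
    define s4 where "s4 = (\<Sum>i<n. p (Suc i) * p (n - i)) - (\<Sum>i<n. m (Suc i) * m (n - i))"
    have "moment_rhs a b c n p - moment_rhs a b c n m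
      = - (A1 * (p (Suc n) - m (Suc n))) + A2 * (p n - m n) + A3 * s3 - A3 * s4"
      unfolding moment_rhs_def A1_def A2_def A3_def s3_def s4_def by (simp add: algebra_simps)
    also have "\<bar>\<dots>\<bar> \<le> \<bar>A1\<bar> * \<bar>p (Suc n) - m (Suc n)\<bar> + \<bar>A2\<bar> * \<bar>p n - m n\<bar> + \<bar>A3\<bar> * \<bar>s3\<bar> + \<bar>A3\<bar> * \<bar>s4\<bar>"
      unfolding abs_mult [symmetric] by linarith
    also have "\<dots> \<le> \<bar>A1\<bar> * \<delta> + \<bar>A2\<bar> * \<delta> + \<bar>A3\<bar> * (real (Suc n) * (2 * \<delta>)) + \<bar>A3\<bar> * (real n * (2 * \<delta>))"
      using k[of n] k[of "Suc n"] 3 4 unfolding s3_def s4_def by (intro add_mono mult_left_mono) auto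
    also have "\<dots> = C * \<delta>" by (simp add: C_def algebra_simps)
    finally show ?thesis .
  qed
  moreover have "0 \<le> C" by (simp add: C_def)
  ultimately show ?thesis using that by blast
qed

text \<open>A non-integrable function has integral 0, so the bound covers it as well, and the
  supremum in \<open>bl_dist\<close> is seen to be finite without a measurability check.\<close>

lemma prob_space_integral_abs_le_1:
  fixes f :: "'a \<Rightarrow> real"
  assumes "prob_space M" "\<And>x. \<bar>f x\<bar> \<le> 1"
  shows "\<bar>integral\<^sup>L M f\<bar> \<le> 1"
proof (cases "integrable M f")
  case True
  interpret prob_space M by fact
  have "\<bar>integral\<^sup>L M f\<bar> \<le> (\<integral>x. \<bar>f x\<bar> \<partial>M)" by (rule integral_abs_bound)
  also have "\<dots> \<le> (\<integral>x. 1 \<partial>M)" using True assms(2) by (intro integral_mono) auto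
  finally show ?thesis by (simp add: prob_space)
qed (simp add: not_integrable_integral_eq)

section \<open>Empirical moments and the bounded Lipschitz distance\<close>

lemma measurable_uniform_count_measure: "x \<in> borel_measurable (uniform_count_measure A)" if "finite A"
  by (auto simp: measurable_def space_uniform_count_measure sets_uniform_count_measure)

lemma empirical_measure_integral:
  assumes f: "f \<in> borel_measurable borel"
  shows "integral\<^sup>L (empirical_measure N x) f = (\<Sum>i\<in>{1..N}. f (x i)) / real N"
  unfolding empirical_measure_def
  using integral_distr[OF measurable_uniform_count_measure f, of "{1..N}" x]
  by (simp add: integral_uniform_count_measure)

lemma empirical_measure_prob_space: "1 \<le> N \<Longrightarrow> prob_space (empirical_measure N x)"
  unfolding empirical_measure_def
  by (intro prob_space.prob_space_distr prob_space_uniform_count_measure measurable_uniform_count_measure) auto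

text \<open>Nonconstant powers are unbounded on the line, while the test functions of
  \<open>bl_dist\<close> and \<open>continuous_measure_path\<close> are bounded and live on all of
  it. Composing with this retraction repairs the mismatch and preserves the moments of measures
  carried by the unit interval.\<close>

definition clamp01 :: "real \<Rightarrow> real" where "clamp01 u = max 0 (min 1 u)"

lemma clamp01: "u \<in> {0..1} \<Longrightarrow> clamp01 u = u" "clamp01 u \<in> {0..1}" "\<bar>clamp01 u - clamp01 v\<bar> \<le> \<bar>u - v\<bar>"
  by (auto simp: clamp01_def max_def min_def)

lemma continuous_clamp01 [continuous_intros]: "continuous_on S clamp01"
  unfolding clamp01_def [abs_def] by (intro continuous_intros)

lemma prob_measure_on_unit_AE: "prob_measure_on_unit \<mu> \<Longrightarrow> AE u in \<mu>. u \<in> {0..1}"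
  using prob_space.AE_prob_1[of \<mu> "{0..1}"] unfolding prob_measure_on_unit_def by blast

lemma clamp01_moment:
  assumes "prob_measure_on_unit \<mu>"
  shows "(LINT u|\<mu>. clamp01 u ^ k) = (LINT u|\<mu>. u ^ k)"
proof -
  have [measurable_cong]: "sets \<mu> = sets borel" using assms by (simp add: prob_measure_on_unit_def)
  have [measurable]: "clamp01 \<in> borel_measurable borel" by (intro borel_measurable_continuous_onI continuous_intros)
  show ?thesis
  proof (rule integral_cong_AE)
    show "AE u in \<mu>. clamp01 u ^ k = u ^ k"
      using prob_measure_on_unit_AE[OF assms] by eventually_elim (simp only: clamp01(1))
  qed auto
qed

lemma unit_moment_range:
  assumes "prob_measure_on_unit \<mu>" shows "(LINT u|\<mu>. u ^ k) \<in> {0..1}"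
proof -
  have p: "prob_space \<mu>" using assms by (simp add: prob_measure_on_unit_def)
  have "0 \<le> clamp01 u ^ k" for u using clamp01(2)[of u] by simp
  then have "0 \<le> (LINT u|\<mu>. clamp01 u ^ k)" by (rule Bochner_Integration.integral_nonneg)
  moreover have "\<bar>clamp01 u ^ k\<bar> \<le> 1" for u
    using clamp01(2)[of u] by (auto simp: power_abs intro!: power_le_one)
  then have "\<bar>LINT u|\<mu>. clamp01 u ^ k\<bar> \<le> 1" by (rule prob_space_integral_abs_le_1[OF p])
  ultimately show ?thesis unfolding clamp01_moment[OF assms] by auto
qed

text \<open>Dividing the clamped power by \<open>k\<close> makes it 1-Lipschitz and bounded by 1,
  hence an admissible test function; multiplying back gives the factor \<open>k\<close>. For
  \<open>k = 0\<close> both moments are 1.\<close>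

lemma power_mean_bl_dist:
  assumes N: "1 \<le> N" and x01: "\<And>i. i \<in> {1..N} \<Longrightarrow> x i \<in> {0..1}" and \<mu>: "prob_measure_on_unit \<mu>"
  shows "\<bar>power_mean N x k - (LINT u|\<mu>. u ^ k)\<bar> \<le> real k * bl_dist (empirical_measure N x) \<mu>"
proof (cases "k = 0")
  case True
  interpret prob_space \<mu> using \<mu> by (simp add: prob_measure_on_unit_def)
  show ?thesis using True N by (simp add: power_mean_def prob_space)
next
  case False
  let ?e = "empirical_measure N x"
  have p\<mu>: "prob_space \<mu>" using \<mu> by (simp add: prob_measure_on_unit_def)
  define f where "f u = clamp01 u ^ k / real k" for u
  define L where "L = {f :: real \<Rightarrow> real. 1-lipschitz_on UNIV f \<and> (\<forall>x. \<bar>f x\<bar> \<le> 1)}"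
  have fm: "f \<in> borel_measurable borel"
    unfolding f_def by (intro borel_measurable_continuous_onI continuous_intros) (use False in auto)
  have c1: "\<bar>clamp01 u\<bar> \<le> 1" for u using clamp01(2)[of u] by auto
  have fL: "f \<in> L"
  proof -
    have "dist (f u) (f v) \<le> 1 * dist u v" for u v
    proof -
      have "\<bar>clamp01 u ^ k - clamp01 v ^ k\<bar> \<le> real k * \<bar>clamp01 u - clamp01 v\<bar>"
        using norm_power_diff[of "clamp01 u" "clamp01 v" k] c1 by simp
      also have "\<dots> \<le> real k * \<bar>u - v\<bar>" using clamp01(3) by (intro mult_left_mono) auto
      finally show ?thesis using False by (simp add: f_def dist_real_def diff_divide_distrib [symmetric] divide_le_eq mult.commute)
    qed
    moreover have "\<bar>f u\<bar> \<le> 1" for u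
    proof -
      have "\<bar>clamp01 u ^ k\<bar> \<le> 1" using c1[of u] by (simp add: power_abs power_le_one)
      then show ?thesis using False by (simp add: f_def divide_le_eq)
    qed
    ultimately show ?thesis by (auto simp: L_def lipschitz_on_def)
  qed
  have "\<bar>integral\<^sup>L ?e f - integral\<^sup>L \<mu> f\<bar> \<le> bl_dist ?e \<mu>"
    unfolding bl_dist_def L_def [symmetric]
  proof (rule cSUP_upper[OF fL])
    show "bdd_above ((\<lambda>f. \<bar>integral\<^sup>L ?e f - integral\<^sup>L \<mu> f\<bar>) ` L)"
    proof (rule bdd_aboveI2)
      fix g assume "g \<in> L"
      then have "\<bar>integral\<^sup>L ?e g\<bar> \<le> 1" "\<bar>integral\<^sup>L \<mu> g\<bar> \<le> 1"
        by (auto simp: L_def intro!: prob_space_integral_abs_le_1 p\<mu> empirical_measure_prob_space N)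
      then show "\<bar>integral\<^sup>L ?e g - integral\<^sup>L \<mu> g\<bar> \<le> 2" by linarith
    qed
  qed
  moreover have "integral\<^sup>L ?e f = power_mean N x k / real k"
    unfolding empirical_measure_integral[OF fm] power_mean_def f_def
    using x01 by (simp add: clamp01 sum_divide_distrib [symmetric] mult.commute)
  moreover have "integral\<^sup>L \<mu> f = (LINT u|\<mu>. u ^ k) / real k"
    unfolding f_def clamp01_moment[OF \<mu>, symmetric] by simp
  ultimately have "\<bar>(power_mean N x k - (LINT u|\<mu>. u ^ k)) / real k\<bar> \<le> bl_dist ?e \<mu>"
    by (simp add: diff_divide_distrib)
  then show ?thesis using False by (simp add: divide_le_eq mult.commute)
qed

context beta_jacobi
begin

text \<open>The end points contribute \<open>2 * \<delta>\<close> and the Lipschitz bound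
  \<open>C * T * \<delta>\<close>. The last term comes from the diagonal correction in
  \<open>corrected_rhs\<close>, where \<open>2 * n + 3\<close> is the sum of its two coefficients
  \<open>n + 1\<close> and \<open>n + 2\<close>.\<close>

lemma defect_close:
  assumes \<omega>: "\<omega> \<in> space M" and T: "0 < T" and \<delta>: "0 \<le> \<delta>"
    and m: "\<And>k. continuous_on {0..T} (\<lambda>t. m t k)" "\<And>t k. t \<in> {0..T} \<Longrightarrow> m t k \<in> {0..1}"
    and close: "\<And>t k. t \<in> {0..T} \<Longrightarrow> k \<le> Suc n \<Longrightarrow> \<bar>p \<omega> t k - m t k\<bar> \<le> \<delta>"
    and C: "\<And>p m \<delta>. 0 \<le> \<delta> \<Longrightarrow> (\<And>k. k \<le> Suc n \<Longrightarrow> \<bar>p k\<bar> \<le> 1 \<and> \<bar>m k\<bar> \<le> 1 \<and> \<bar>p k - m k\<bar> \<le> \<delta>) \<Longrightarrow>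
     \<bar>moment_rhs a b c n p - moment_rhs a b c n m\<bar> \<le> C * \<delta>"
  shows "\<bar>defect T n \<omega> - (m T (Suc n) - m 0 (Suc n) - incr_int (\<lambda>t. moment_rhs a b c n (m t)) 0 T)\<bar>
    \<le> (2 + C * T) * \<delta> + c * real (Suc n) * real (2 * n + 3) * T / real N"
proof -
  define K where "K = c * real (Suc n) * real (2 * n + 3) / real N"
  have rc: "path_integrable (\<lambda>t. corrected_rhs n (p \<omega> t)) T"
    by (rule path_integrable_continuous[OF corrected_rhs_continuous[OF \<omega>]])
  have rm: "path_integrable (\<lambda>t. moment_rhs a b c n (m t)) T"
    unfolding moment_rhs_def by (intro path_integrable_continuous continuous_intros m)
  have pc: "path_integrable (\<lambda>_. C * \<delta> + K) T" using T by (intro path_integrable_const) auto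
  have b: "\<bar>corrected_rhs n (p \<omega> t) - moment_rhs a b c n (m t)\<bar> \<le> C * \<delta> + K" if t: "0 < t" "t \<le> T" for t
  proof -
    have tT: "t \<in> {0..T}" using t by auto
    have "\<bar>moment_rhs a b c n (p \<omega> t) - moment_rhs a b c n (m t)\<bar> \<le> C * \<delta>"
      using p_range[of t \<omega>] m(2)[OF tT] close[OF tT] \<omega> t by (intro C[OF \<delta>]) auto
    moreover have "\<bar>c * real (Suc n) / real N * (real (Suc n) * p \<omega> t n - real (n + 2) * p \<omega> t (Suc n))\<bar> \<le> K"
    proof -
      have "\<bar>real (Suc n) * p \<omega> t n\<bar> \<le> real (Suc n) * 1" "\<bar>real (n + 2) * p \<omega> t (Suc n)\<bar> \<le> real (n + 2) * 1"
        unfolding abs_mult using p_range[of t \<omega>] \<omega> t by (intro mult_mono; auto)+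
      then have "\<bar>real (Suc n) * p \<omega> t n - real (n + 2) * p \<omega> t (Suc n)\<bar> \<le> real (2 * n + 3)" by simp
      then have "\<bar>c * real (Suc n) / real N\<bar> * \<bar>real (Suc n) * p \<omega> t n - real (n + 2) * p \<omega> t (Suc n)\<bar>
          \<le> \<bar>c * real (Suc n) / real N\<bar> * real (2 * n + 3)" by (intro mult_left_mono) auto
      also have "\<dots> = K" using c by (simp add: K_def abs_mult)
      finally show ?thesis by (simp only: abs_mult)
    qed
    ultimately show ?thesis unfolding corrected_rhs_def by linarith
  qed
  have d1: "incr_int (\<lambda>t. corrected_rhs n (p \<omega> t)) 0 T - incr_int (\<lambda>t. moment_rhs a b c n (m t)) 0 T \<le> (C * \<delta> + K) * T"
  proof -
    have "incr_int (\<lambda>t. corrected_rhs n (p \<omega> t)) 0 T \<le> incr_int (\<lambda>t. 1 * moment_rhs a b c n (m t) + 1 * (C * \<delta> + K)) 0 T"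
      using b by (intro incr_int_mono[OF rc incr_int_linear(1)[OF rm pc]]) fastforce
    then show ?thesis using incr_int_linear(2)[OF rm pc, of 1 1] incr_int_const[of T "C * \<delta> + K"] T by simp
  qed
  have d2: "incr_int (\<lambda>t. moment_rhs a b c n (m t)) 0 T - incr_int (\<lambda>t. corrected_rhs n (p \<omega> t)) 0 T \<le> (C * \<delta> + K) * T"
  proof -
    have "incr_int (\<lambda>t. moment_rhs a b c n (m t)) 0 T \<le> incr_int (\<lambda>t. 1 * corrected_rhs n (p \<omega> t) + 1 * (C * \<delta> + K)) 0 T"
      using b by (intro incr_int_mono[OF rm incr_int_linear(1)[OF rc pc]]) fastforce
    then show ?thesis using incr_int_linear(2)[OF rc pc, of 1 1] incr_int_const[of T "C * \<delta> + K"] T by simp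
  qed
  have "\<bar>p \<omega> T (Suc n) - m T (Suc n)\<bar> \<le> \<delta>" "\<bar>p \<omega> 0 (Suc n) - m 0 (Suc n)\<bar> \<le> \<delta>"
    using close[of T "Suc n"] close[of 0 "Suc n"] T by auto
  then have "\<bar>defect T n \<omega> - (m T (Suc n) - m 0 (Suc n) - incr_int (\<lambda>t. moment_rhs a b c n (m t)) 0 T)\<bar>
    \<le> 2 * \<delta> + (C * \<delta> + K) * T"
    using d1 d2 unfolding defect_def by linarith
  also have "\<dots> = (2 + C * T) * \<delta> + c * real (Suc n) * real (2 * n + 3) * T / real N"
    by (simp add: K_def algebra_simps)
  finally show ?thesis .
qed

text \<open>Off the bad event the moments up to order \<open>Suc n\<close> are within
  \<open>(n + 1) * \<epsilon>\<close> of their limits, on it within 1; taking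
  \<open>\<delta>\<close> to be \<open>(n + 1) * \<epsilon>\<close> plus an indicator covers both.
  Since the defect has mean 0, expectation bounds the deterministic quantity, and adding the
  probability of the bad event makes the factor \<open>n + 2\<close>.\<close>

lemma moment_defect_bound:
  assumes T: "0 < T" and \<epsilon>: "0 < \<epsilon>" and \<mu>: "\<And>t. t \<in> {0..T} \<Longrightarrow> prob_measure_on_unit (\<mu> t)"
    and cont: "\<And>k. continuous_on {0..T} (\<lambda>t. LINT u|\<mu> t. u ^ k)"
    and C0: "0 \<le> C"
    and C: "\<And>p m \<delta>. 0 \<le> \<delta> \<Longrightarrow> (\<And>k. k \<le> Suc n \<Longrightarrow> \<bar>p k\<bar> \<le> 1 \<and> \<bar>m k\<bar> \<le> 1 \<and> \<bar>p k - m k\<bar> \<le> \<delta>) \<Longrightarrow>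
     \<bar>moment_rhs a b c n p - moment_rhs a b c n m\<bar> \<le> C * \<delta>"
    and out: "outer_measure_of M {\<omega> \<in> space M. \<exists>t\<in>{0..T}. bl_dist (empirical_measure N (\<lambda>i. \<Lambda> i t \<omega>)) (\<mu> t) > \<epsilon>} < ennreal \<epsilon>"
  defines "m \<equiv> \<lambda>t k. LINT u|\<mu> t. u ^ k"
  shows "\<bar>m T (Suc n) - m 0 (Suc n) - incr_int (\<lambda>t. moment_rhs a b c n (m t)) 0 T\<bar>
    \<le> (2 + C * T) * real (n + 2) * \<epsilon> + c * real (Suc n) * real (2 * n + 3) * T / real N"
proof -
  let ?bad = "{\<omega> \<in> space M. \<exists>t\<in>{0..T}. bl_dist (empirical_measure N (\<lambda>i. \<Lambda> i t \<omega>)) (\<mu> t) > \<epsilon>}"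
  define z where "z = m T (Suc n) - m 0 (Suc n) - incr_int (\<lambda>t. moment_rhs a b c n (m t)) 0 T"
  define K where "K = c * real (Suc n) * real (2 * n + 3) * T / real N"
  \<comment> \<open>A measurable superset of the same outer measure replaces the bad set, whose
    measurability is not established.\<close>
  obtain U where U: "U \<in> sets M" "?bad \<subseteq> U" "outer_measure_of M ?bad = emeasure M U"
    using outer_measure_of_attain[of ?bad M] by auto
  have PU: "prob U \<le> \<epsilon>"
    using out \<epsilon> unfolding U(3) emeasure_eq_measure by (simp add: ennreal_less_iff)
  have mr: "m t k \<in> {0..1}" if "t \<in> {0..T}" for t k
    unfolding m_def by (rule unit_moment_range[OF \<mu>[OF that]])
  have bound: "\<bar>defect T n \<omega> - z\<bar> \<le> (2 + C * T) * (real (Suc n) * \<epsilon> + indicator U \<omega>) + K" if \<omega>: "\<omega> \<in> space M" for \<omega>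
    unfolding z_def K_def
  proof (rule defect_close[OF \<omega> T _ _ mr _ C])
    show "0 \<le> real (Suc n) * \<epsilon> + indicator U \<omega>" using \<epsilon> by simp
    show "continuous_on {0..T} (\<lambda>t. m t k)" for k unfolding m_def by (rule cont)
    fix t k assume t: "t \<in> {0..T}" and k: "k \<le> Suc n"
    show "\<bar>p \<omega> t k - m t k\<bar> \<le> real (Suc n) * \<epsilon> + indicator U \<omega>"
    proof (cases "\<omega> \<in> U")
      case True
      have "\<bar>p \<omega> t k - m t k\<bar> \<le> 1" using p_range[of t \<omega> k] mr[OF t, of k] \<omega> t by (auto simp: abs_le_iff)
      moreover have "0 \<le> real (Suc n) * \<epsilon>" using \<epsilon> by simp
      ultimately show ?thesis using True by simp
    next
      case False
      then have "\<omega> \<notin> ?bad" using U by blast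
      then have "bl_dist (empirical_measure N (\<lambda>i. \<Lambda> i t \<omega>)) (\<mu> t) \<le> \<epsilon>" using \<omega> t by force
      then have "real k * bl_dist (empirical_measure N (\<lambda>i. \<Lambda> i t \<omega>)) (\<mu> t) \<le> real k * \<epsilon>"
        by (intro mult_left_mono) auto
      also have "\<dots> \<le> real (Suc n) * \<epsilon>" using k \<epsilon> by (intro mult_right_mono) auto
      finally have "real k * bl_dist (empirical_measure N (\<lambda>i. \<Lambda> i t \<omega>)) (\<mu> t) \<le> real (Suc n) * \<epsilon>" .
      moreover have "\<bar>p \<omega> t k - m t k\<bar> \<le> real k * bl_dist (empirical_measure N (\<lambda>i. \<Lambda> i t \<omega>)) (\<mu> t)"
        unfolding p_def m_def using t \<omega> by (intro power_mean_bl_dist N \<Lambda>01 \<mu>) auto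
      ultimately show ?thesis using False by simp
    qed
  qed
  have i: "integrable M (defect T n)" "expectation (defect T n) = 0" using defect_expectation[OF T] by auto
  have "\<bar>z\<bar> = \<bar>expectation (\<lambda>\<omega>. defect T n \<omega> - z)\<bar>" using i by (simp add: prob_space)
  also have "\<dots> \<le> expectation (\<lambda>\<omega>. \<bar>defect T n \<omega> - z\<bar>)" by (rule integral_abs_bound)
  also have "\<dots> \<le> expectation (\<lambda>\<omega>. (2 + C * T) * (real (Suc n) * \<epsilon> + indicator U \<omega>) + K)"
  proof (rule integral_mono[OF _ _ bound])
    show "integrable M (\<lambda>\<omega>. \<bar>defect T n \<omega> - z\<bar>)" using i by auto
    show "integrable M (\<lambda>\<omega>. (2 + C * T) * (real (Suc n) * \<epsilon> + indicator U \<omega>) + K)"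
      using U(1) by (intro Bochner_Integration.integrable_add integrable_mult_right integrable_real_indicator)
        (auto simp: emeasure_eq_measure)
  qed
  also have "\<dots> = (2 + C * T) * (real (Suc n) * \<epsilon> + prob U) + K"
  proof -
    have iU: "integrable M (indicator U :: 'w \<Rightarrow> real)"
      using U(1) by (intro integrable_real_indicator) (auto simp: emeasure_eq_measure)
    then have "integrable M (\<lambda>\<omega>. (2 + C * T) * (real (Suc n) * \<epsilon> + indicator U \<omega>))"
      by (intro integrable_mult_right Bochner_Integration.integrable_add) auto
    then have "expectation (\<lambda>\<omega>. (2 + C * T) * (real (Suc n) * \<epsilon> + indicator U \<omega>) + K)
        = (2 + C * T) * expectation (\<lambda>\<omega>. real (Suc n) * \<epsilon> + indicator U \<omega>) + K"
      by (subst Bochner_Integration.integral_add) (simp_all add: prob_space)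
    also have "expectation (\<lambda>\<omega>. real (Suc n) * \<epsilon> + indicator U \<omega>) = real (Suc n) * \<epsilon> + prob U"
      using iU U(1) by (subst Bochner_Integration.integral_add) (simp_all add: prob_space)
    finally show ?thesis .
  qed
  also have "\<dots> \<le> (2 + C * T) * (real (Suc n) * \<epsilon> + \<epsilon>) + K"
    using PU C0 T by (intro add_right_mono mult_left_mono) auto
  finally show ?thesis by (simp add: z_def K_def algebra_simps)
qed

end

text \<open>The error \<open>z\<close> in the integrated equation for the limit is a number
  independent of \<open>N\<close>. Letting \<open>N\<close> tend to infinity removes the diagonal
  correction from its bound, and then \<open>\<epsilon>\<close> is free to go to 0.\<close>

theorem limit_moment_equation:
  fixes a b c T :: real and P :: "nat \<Rightarrow> 'w measure"
  assumes c: "0 < c"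
    and filt: "\<And>N. N \<ge> 1 \<Longrightarrow> filtered_prob_space (P N) (F N)"
    and process: "\<And>N. N \<ge> 1 \<Longrightarrow> beta_jacobi_process (P N) (F N) N a b (2 * c / real N) (W N) (\<Lambda> N)"
    and path: "continuous_measure_path \<mu>"
    and lim: "uniform_limit_in_probability P (\<lambda>N t \<omega>. empirical_measure N (\<lambda>i. \<Lambda> N i t \<omega>)) \<mu>"
    and t: "t \<in> {0..T}"
  defines "m \<equiv> \<lambda>t k. LINT u|\<mu> t. u ^ k"
  shows "((\<lambda>t. m t (Suc n)) has_real_derivative moment_rhs a b c n (m t)) (at t within {0..T})"
proof (rule has_derivative_if_incr_int[OF _ _ t])
  have \<mu>: "prob_measure_on_unit (\<mu> t)" if "0 \<le> t" for t
    using path that by (simp add: continuous_measure_path_def)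
  have cont: "continuous_on {0..} (\<lambda>t. m t k)" for k
  proof -
    have "bounded (range (\<lambda>u. clamp01 u ^ k))"
      by (rule boundedI[where B = 1]) (use clamp01(2) in \<open>auto simp: power_abs intro!: power_le_one\<close>)
    moreover have "continuous_on UNIV (\<lambda>u. clamp01 u ^ k)" by (intro continuous_intros)
    ultimately have "continuous_on {0..} (\<lambda>t. LINT u|\<mu> t. clamp01 u ^ k)"
      using path unfolding continuous_measure_path_def by blast
    then show ?thesis by (rule continuous_on_cong[THEN iffD1, rotated -1]) (auto simp: m_def clamp01_moment \<mu>)
  qed
  have contT: "continuous_on {0..T} (\<lambda>t. m t k)" for k T
    by (rule continuous_on_subset[OF cont]) auto
  show "continuous_on {0..T} (\<lambda>t. moment_rhs a b c n (m t))"
    unfolding moment_rhs_def by (intro continuous_intros contT)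
  fix T :: real assume T: "0 < T"
  obtain C where C0: "0 \<le> C" and C: "\<And>p m \<delta>. 0 \<le> \<delta> \<Longrightarrow> (\<And>k. k \<le> Suc n \<Longrightarrow> \<bar>p k\<bar> \<le> 1 \<and> \<bar>m k\<bar> \<le> 1 \<and> \<bar>p k - m k\<bar> \<le> \<delta>) \<Longrightarrow>
     \<bar>moment_rhs a b c n p - moment_rhs a b c n m\<bar> \<le> C * \<delta>"
    using moment_rhs_lipschitz by blast
  define z where "z = m T (Suc n) - m 0 (Suc n) - incr_int (\<lambda>t. moment_rhs a b c n (m t)) 0 T"
  have ze: "\<bar>z\<bar> \<le> (2 + C * T) * real (n + 2) * \<epsilon>" if \<epsilon>: "0 < \<epsilon>" for \<epsilon>
  proof (rule LIMSEQ_le_const)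
    define K where "K = c * real (Suc n) * real (2 * n + 3) * T"
    have "(\<lambda>N. (2 + C * T) * real (n + 2) * \<epsilon> + K * (1 / real N)) \<longlonglongrightarrow> (2 + C * T) * real (n + 2) * \<epsilon> + K * 0"
      by (intro tendsto_intros lim_1_over_n)
    then show "(\<lambda>N. (2 + C * T) * real (n + 2) * \<epsilon> + K / real N) \<longlonglongrightarrow> (2 + C * T) * real (n + 2) * \<epsilon>" by simp
    have "(\<lambda>N. outer_measure_of (P N) {\<omega> \<in> space (P N). \<exists>t\<in>{0..T}. bl_dist (empirical_measure N (\<lambda>i. \<Lambda> N i t \<omega>)) (\<mu> t) > \<epsilon>}) \<longlonglongrightarrow> 0"
      using lim T \<epsilon> unfolding uniform_limit_in_probability_def by blast
    then have "\<forall>\<^sub>F N in sequentially. outer_measure_of (P N) {\<omega> \<in> space (P N). \<exists>t\<in>{0..T}. bl_dist (empirical_measure N (\<lambda>i. \<Lambda> N i t \<omega>)) (\<mu> t) > \<epsilon>} < ennreal \<epsilon>"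
      by (rule order_tendstoD) (use \<epsilon> in simp)
    then have "\<forall>\<^sub>F N in sequentially. \<bar>z\<bar> \<le> (2 + C * T) * real (n + 2) * \<epsilon> + K / real N"
      using eventually_ge_at_top[of 1]
    proof eventually_elim
      case (elim N)
      interpret beta_jacobi "P N" "F N" N a b c "W N" "\<Lambda> N"
        using filt[OF elim(2)] process[OF elim(2)] elim(2) c by unfold_locales
      show ?case
        unfolding z_def K_def m_def
        by (rule moment_defect_bound[OF T \<epsilon> _ _ C0 C elim(1)])
           (use \<mu> contT[unfolded m_def] in auto)
    qed
    then show "\<exists>N0. \<forall>N\<ge>N0. \<bar>z\<bar> \<le> (2 + C * T) * real (n + 2) * \<epsilon> + K / real N"
      by (simp add: eventually_sequentially)
  qed
  have "\<bar>z\<bar> \<le> 0"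
  proof (rule LIMSEQ_le_const)
    have "(\<lambda>k. (2 + C * T) * real (n + 2) * (1 / real (Suc k))) \<longlonglongrightarrow> (2 + C * T) * real (n + 2) * 0"
      by (intro tendsto_intros LIMSEQ_Suc lim_1_over_n)
    then show "(\<lambda>k. (2 + C * T) * real (n + 2) * (1 / real (Suc k))) \<longlonglongrightarrow> 0" by simp
    show "\<exists>N. \<forall>k\<ge>N. \<bar>z\<bar> \<le> (2 + C * T) * real (n + 2) * (1 / real (Suc k))"
      using ze[of "1 / real (Suc _)"] by auto
  qed
  then show "m T (Suc n) - m 0 (Suc n) = incr_int (\<lambda>t. moment_rhs a b c n (m t)) 0 T" by (simp add: z_def)
qed

theorem mainTheorem4:
  fixes a b c :: real
    and P :: "nat \<Rightarrow> 'w measure" and F :: "nat \<Rightarrow> real \<Rightarrow> 'w measure"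
    and W \<Lambda> :: "nat \<Rightarrow> nat \<Rightarrow> real \<Rightarrow> 'w \<Rightarrow> real"
    and x :: "nat \<Rightarrow> nat \<Rightarrow> real"
    and \<mu> :: "real \<Rightarrow> real measure"
    and Q :: "'v measure" and G :: "real \<Rightarrow> 'v measure"
    and B Y :: "real \<Rightarrow> 'v \<Rightarrow> real" and \<xi> :: "'v \<Rightarrow> real"
  assumes "c > 0" and "a > - 1 / 2" and "b > - 1 / 2"
    and "\<And>N. N \<ge> 1 \<Longrightarrow> filtered_prob_space (P N) (F N)"
    and "\<And>N. N \<ge> 1 \<Longrightarrow>
           beta_jacobi_process (P N) (F N) N a b (2 * c / real N) (W N) (\<Lambda> N)"
    and "\<And>N i \<omega>. N \<ge> 1 \<Longrightarrow> i \<in> {1..N} \<Longrightarrow> \<omega> \<in> space (P N) \<Longrightarrow> \<Lambda> N i 0 \<omega> = x N i"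
    and "continuous_measure_path \<mu>"
    and "weak_conv_m (\<lambda>N. empirical_measure N (x N)) (\<mu> 0)"
    and "uniform_limit_in_probability P
           (\<lambda>N t \<omega>. empirical_measure N (\<lambda>i. \<Lambda> N i t \<omega>)) \<mu>"
    and "filtered_prob_space Q G"
    and "brownian_motion Q G B"
    and "\<xi> \<in> borel_measurable Q"
    and "is_markov_krein_transform c (\<mu> 0) (distr Q borel \<xi>)"
    and "indep_of_process Q \<xi> B"
    and "\<And>t \<omega>. t \<ge> 0 \<Longrightarrow> \<omega> \<in> space Q \<Longrightarrow> Y t \<omega> \<in> {0..1}"
    and "AE \<omega> in Q. Y 0 \<omega> = \<xi> \<omega>"
    and "has_stochastic_differential Q G B Y
           (\<lambda>t \<omega>. sqrt (2 * Y t \<omega> * (1 - Y t \<omega>)))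
           (\<lambda>t \<omega>. (a + c + 1) - (a + b + 2 * c + 2) * Y t \<omega>)"
  shows "\<forall>t\<ge>0. is_markov_krein_transform c (\<mu> t) (distr Q borel (Y t))"
proof (intro allI impI)
  fix t :: real assume t: "0 \<le> t"
  interpret Q: wiener Q G B
    using wiener_component[OF assms(10), of "{()}" "\<lambda>_. B" "()"] assms(11) by (simp add: brownian_motion_def)
  have Ym: "Y s \<in> borel_measurable Q" if "0 \<le> s" for s
    using assms(17) that by (intro Q.measurable_F[of _ s]) (auto simp: has_stochastic_differential_def adapted_continuous_def)
  have \<mu>: "prob_measure_on_unit (\<mu> s)" if "0 \<le> s" for s
    using assms(7) that by (simp add: continuous_measure_path_def)
  have AEY: "AE u in distr Q borel (Y s). u \<in> {0..1}" if "0 \<le> s" for s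
    using Ym[OF that] assms(15)[OF that] by (subst AE_distr_iff) (auto intro!: AE_I2)
  have momY: "(LINT u|distr Q borel (Y s). u ^ n) = Q.expectation (\<lambda>\<omega>. Y s \<omega> ^ n)" if "0 \<le> s" for s n
    using Ym[OF that] by (intro integral_distr) auto
  \<comment> \<open>The hypothesis on the law of \<open>\<xi>\<close> is transferred to
    \<open>Y 0\<close>, so that moments of \<open>Y\<close> can be followed from time 0.\<close>
  have "distr Q borel \<xi> = distr Q borel (Y 0)"
    using assms(16) Ym[of 0] assms(12) by (intro distr_cong_AE) (auto elim: eventually_mono)
  then have MK0: "is_markov_krein_transform c (\<mu> 0) (distr Q borel (Y 0))" using assms(13) by simp
  define m where "m s k = (LINT u|\<mu> s. u ^ k)" for s and k :: nat
  define y where "y s k = Q.expectation (\<lambda>\<omega>. Y s \<omega> ^ k)" for s and k :: nat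
  have "pochhammer c n / fact n * y t n = mk_coeff c (m t) n" for n
  \<comment> \<open>The horizon is \<open>t\<close> itself; for \<open>t = 0\<close> the interval is
    a single point and the initial relation is returned.\<close>
  proof (rule moment_flow_mk[where T = t])
    show "((\<lambda>t. m t (Suc k)) has_real_derivative moment_rhs a b c k (m s)) (at s within {0..t})" if "s \<in> {0..t}" for s k
      unfolding m_def by (rule limit_moment_equation[OF assms(1,4,5,7,9) that])
    show "((\<lambda>t. y t (Suc k)) has_real_derivative real (Suc k) * (a + c + real k + 1) * y s k
        - real (Suc k) * (a + b + 2 * c + real k + 2) * y s (Suc k)) (at s within {0..t})" if "s \<in> {0..t}" for s k
      unfolding y_def by (rule Q.jacobi_moment_equation[OF assms(17,15) that])
    show "m s 0 = 1" if "s \<in> {0..t}" for s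
      using \<mu>[of s] that by (simp add: m_def prob_measure_on_unit_def prob_space.prob_space)
    show "y s 0 = 1" for s by (simp add: y_def Q.prob_space)
    show "pochhammer c k / fact k * y 0 k = mk_coeff c (m 0) k" for k
      using moments_if_mk_transform[OF MK0 prob_measure_on_unit_AE[OF \<mu>] AEY, of k]
      by (simp add: momY y_def m_def [abs_def])
  qed (use t in auto)
  then show "is_markov_krein_transform c (\<mu> t) (distr Q borel (Y t))"
    using \<mu>[OF t] t
    by (intro mk_transform_if_moments prob_measure_on_unit_AE AEY Q.prob_space_distr Ym)
       (auto simp: prob_measure_on_unit_def momY y_def m_def [abs_def])
qed

end
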